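(* Let $n\ge2$, $s\in(0,1)$, and let $\mathcal{O}\subset\mathbb{R}^n$ be a bounded Lipschitz domain. Let $\{T_\varepsilon\}_{\varepsilon>0}$ be a sequence of closed subsets of $\mathbb{R}^n$ and set $$\mathcal{O}_\varepsilon=\mathcal{O}\setminus\bigcup_{0<\delta\le\varepsilon}T_\delta,\qquad\text{with}\qquad\lim_{\varepsilon\to0}|\mathcal{O}\setminus\mathcal{O}_\varepsilon|=0,$$ where $|\cdot|$ is Lebesgue measure. Assume that there exists a sequence of functions $\{w_\varepsilon\}_{\varepsilon>0}$ such that (i) $w_\varepsilon\in H^1(\mathcal{O})$; (ii) $w_\varepsilon=0$ on the holes $\bigcup_{0<\delta\le\varepsilon}T_\delta$; (iii) $w_\varepsilon\rightharpoonup1$ weakly in $H^1(\mathcal{O})$ as $\varepsilon\to0$. Let $f\in\widetilde H^s(\mathcal{O})^*$ and $g\in H^s(\mathbb{R}^n)$ be given, and for each $\varepsilon>0$ let $u_\varepsilon\in H^s(\mathbb{R}^n)$ be the solution of $$(-\Delta)^s u_\varepsilon=f\ \text{ in }\mathcal{O}_\varepsilon,\qquad u_\varepsilon=g\ \text{ in }\mathbb{R}^n\setminus\mathcal{O}_\varepsilon.$$ Then, as $\varepsilon\to0$, up to a subsequence, $$u_\varepsilon\rightharpoonup u\quad\text{weakly in }H^s(\mathbb{R}^n),$$ where the limit $u\in H^s(\mathbb{R}^n)$ is characterized as the unique solution of $$(-\Delta)^s u=f\ \text{ in }\mathcal{O},\qquad u=g\ \text{ in }\mathbb{R}^n\setm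inus\mathcal{O}.$$
   Context: $H^s(\mathbb{R}^n)$ is the standard $L^2$-based fractional Sobolev space. For a set $E\subset\mathbb{R}^n$, $\widetilde H^s(E)=\{v\in H^s(\mathbb{R}^n):\operatorname{supp}v\subset\overline{E}\}$; $\widetilde H^s(\mathcal{O})^*$ is the dual of $\widetilde H^s(\mathcal{O})$, and $\langle\cdot,\cdot\rangle$ denotes the duality pairing (restricted to $\widetilde H^s(\mathcal{O}_\varepsilon)\subset\widetilde H^s(\mathcal{O})$ where needed). $(-\Delta)^\sigma$ is the fractional Laplacian on $\mathbb{R}^n$, i.e. the Fourier multiplier $|\xi|^{2\sigma}$. For $v,w\in H^s(\mathbb{R}^n)$ put $\mathcal{B}^s(v,w)=\int_{\mathbb{R}^n}(-\Delta)^{s/2}v\,(-\Delta)^{s/2}w\,dx$. For $E=\mathcal{O}$ or $E=\mathcal{O}_\varepsilon$, $u\in H^s(\mathbb{R}^n)$ is the solution of $(-\Delta)^s u=f$ in $E$, $u=g$ in $\mathbb{R}^n\setminus E$, if $u-g\in\widetilde H^s(E)$ and $\mathcal{B}^s(u,w)=\langle f,w\rangle$ for all $w\in\widetilde H^s(E)$; such a solution exists and is unique. In (ii), $w_\varepsilon=0$ on the holes means $w_\varepsilon=0$ almost everywhere on $\mathcal{O}\cap\bigcup_{0<\delta\le\varepsilon}T_\delta$. *)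

theory Defs
  imports "HOL-Analysis.Analysis"
begin

text \<open>
  Elements of the function spaces below are honest functions, identified up to equality almost
  everywhere: all norms are seminorms on functions that vanish exactly on the null functions, and
  uniqueness is stated almost everywhere. All Sobolev functions are real-valued; complex values
  occur only on the Fourier side.
\<close>

definition L2 :: "'a measure \<Rightarrow> ('a \<Rightarrow> 'b::{real_normed_vector, second_countable_topology, banach}) set" where
  "L2 M = {f \<in> borel_measurable M. integrable M (\<lambda>x. (norm (f x))\<^sup>2)}"


subsection \<open>Duals and weak convergence\<close>

text \<open>A space is given by a set \<open>V\<close> of functions, closed under linear combinations, and a seminorm
  \<open>N\<close> on it. Continuity forces a functional to agree on functions at \<open>N\<close>-distance zero, so
  this is the dual of the quotient.\<close>

definition dual_space :: "('a \<Rightarrow> real) set \<Rightarrow> (('a \<Rightarrow> real) \<Rightarrow> real) \<Rightarrow> (('a \<Rightarrow> real) \<Rightarrow> real) set" where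
  "dual_space V N = {l.
     (\<forall>v\<in>V. \<forall>w\<in>V. l (\<lambda>x. v x + w x) = l v + l w) \<and>
     (\<forall>c. \<forall>v\<in>V. l (\<lambda>x. c * v x) = c * l v) \<and>
     (\<exists>C. \<forall>v\<in>V. \<bar>l v\<bar> \<le> C * N v)}"

definition weakly_tendsto ::
  "('a \<Rightarrow> real) set \<Rightarrow> (('a \<Rightarrow> real) \<Rightarrow> real) \<Rightarrow> ('i \<Rightarrow> 'a \<Rightarrow> real) \<Rightarrow> ('a \<Rightarrow> real) \<Rightarrow> 'i filter \<Rightarrow> bool" where
  "weakly_tendsto V N X v F \<longleftrightarrow>
     v \<in> V \<and> (\<forall>\<^sub>F i in F. X i \<in> V) \<and>
     (\<forall>l \<in> dual_space V N. ((\<lambda>i. l (X i)) \<longlongrightarrow> l v) F)"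


subsection \<open>Fourier transform and fractional Laplacian\<close>

definition fourier_integral :: "(real^'n \<Rightarrow> complex) \<Rightarrow> real^'n \<Rightarrow> complex" where
  "fourier_integral f \<xi> =
     complex_of_real ((2 * pi) powr (- real CARD('n) / 2)) *
       (LINT x|lebesgue. cis (- (x \<bullet> \<xi>)) * f x)"

text \<open>The Fourier transform on $L^2$ (Plancherel): the $L^2$ limit of the Fourier integrals of the
  truncations to balls. As an element of $L^2$ it is determined only almost everywhere, hence the
  choice operator.\<close>

definition is_fourier :: "(real^'n \<Rightarrow> complex) \<Rightarrow> (real^'n \<Rightarrow> complex) \<Rightarrow> bool" where
  "is_fourier f F \<longleftrightarrow> F \<in> L2 lebesgue \<and>
     ((\<lambda>R. \<integral>\<^sup>+ \<xi>. ennreal ((norm (F \<xi> -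
          fourier_integral (\<lambda>x. indicator (cball 0 R) x *\<^sub>R f x) \<xi>))\<^sup>2) \<partial>lebesgue) \<longlongrightarrow> 0) at_top"

definition fourier :: "(real^'n \<Rightarrow> real) \<Rightarrow> real^'n \<Rightarrow> complex" where
  "fourier v = (SOME F. is_fourier (\<lambda>x. complex_of_real (v x)) F)"

text \<open>The Fourier multiplier $|\xi|^{2\sigma}$. The symbol is real and even, so real functions are
  mapped to real functions.\<close>

definition frac_laplacian :: "real \<Rightarrow> (real^'n \<Rightarrow> real) \<Rightarrow> real^'n \<Rightarrow> real" where
  "frac_laplacian \<sigma> v = (SOME w. w \<in> L2 lebesgue \<and>
     (AE \<xi> in lebesgue. fourier w \<xi> = complex_of_real (norm \<xi> powr (2 * \<sigma>)) * fourier v \<xi>))"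


subsection \<open>Fractional Sobolev spaces\<close>

definition Hs :: "real \<Rightarrow> (real^'n \<Rightarrow> real) set" where
  "Hs s = {v \<in> L2 lebesgue.
     integrable lebesgue (\<lambda>\<xi>. (1 + (norm \<xi>)\<^sup>2) powr s * (norm (fourier v \<xi>))\<^sup>2)}"

definition Hs_norm :: "real \<Rightarrow> (real^'n \<Rightarrow> real) \<Rightarrow> real" where
  "Hs_norm s v =
     sqrt (LINT \<xi>|lebesgue. (1 + (norm \<xi>)\<^sup>2) powr s * (norm (fourier v \<xi>))\<^sup>2)"

text \<open>The support of an almost-everywhere class: the complement of the largest open set on which it
  vanishes almost everywhere.\<close>

definition ess_support :: "(real^'n \<Rightarrow> real) \<Rightarrow> (real^'n) set" where
  "ess_support v = - \<Union>{U. open U \<and> (AE x in lebesgue. x \<in> U \<longrightarrow> v x = 0)}"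

definition tilde_Hs :: "real \<Rightarrow> (real^'n) set \<Rightarrow> (real^'n \<Rightarrow> real) set" where
  "tilde_Hs s E = {v \<in> Hs s. ess_support v \<subseteq> closure E}"

definition tilde_Hs_dual :: "real \<Rightarrow> (real^'n) set \<Rightarrow> ((real^'n \<Rightarrow> real) \<Rightarrow> real) set" where
  "tilde_Hs_dual s E = dual_space (tilde_Hs s E) (Hs_norm s)"

definition frac_form :: "real \<Rightarrow> (real^'n \<Rightarrow> real) \<Rightarrow> (real^'n \<Rightarrow> real) \<Rightarrow> real" where
  "frac_form s v w = (LINT x|lebesgue. frac_laplacian (s/2) v x * frac_laplacian (s/2) w x)"

definition is_solution ::
  "real \<Rightarrow> (real^'n) set \<Rightarrow> ((real^'n \<Rightarrow> real) \<Rightarrow> real) \<Rightarrow> (real^'n \<Rightarrow> real) \<Rightarrow> (real^'n \<Rightarrow> real) \<Rightarrow> bool" where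
  "is_solution s E f g u \<longleftrightarrow>
     u \<in> Hs s \<and> (\<lambda>x. u x - g x) \<in> tilde_Hs s E \<and>
     (\<forall>w \<in> tilde_Hs s E. frac_form s u w = f w)"


subsection \<open>The Sobolev space of order one on an open set\<close>

definition partial :: "'n \<Rightarrow> (real^'n \<Rightarrow> real) \<Rightarrow> real^'n \<Rightarrow> real" where
  "partial i \<phi> x = frechet_derivative \<phi> (at x) (axis i 1)"

primrec Ck :: "nat \<Rightarrow> (real^'n \<Rightarrow> real) \<Rightarrow> bool" where
  "Ck 0 \<phi> \<longleftrightarrow> continuous_on UNIV \<phi>"
| "Ck (Suc k) \<phi> \<longleftrightarrow> (\<forall>x. \<phi> differentiable (at x)) \<and> (\<forall>i. Ck k (partial i \<phi>))"

definition test_functions :: "(real^'n) set \<Rightarrow> (real^'n \<Rightarrow> real) set" where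
  "test_functions \<Omega> = {\<phi>. (\<forall>k. Ck k \<phi>) \<and>
     compact (closure {x. \<phi> x \<noteq> 0}) \<and> closure {x. \<phi> x \<noteq> 0} \<subseteq> \<Omega>}"

definition is_weak_partial ::
  "(real^'n) set \<Rightarrow> 'n \<Rightarrow> (real^'n \<Rightarrow> real) \<Rightarrow> (real^'n \<Rightarrow> real) \<Rightarrow> bool" where
  "is_weak_partial \<Omega> i v h \<longleftrightarrow> h \<in> L2 (lebesgue_on \<Omega>) \<and>
     (\<forall>\<phi> \<in> test_functions \<Omega>.
        (LINT x|lebesgue_on \<Omega>. v x * partial i \<phi> x) = - (LINT x|lebesgue_on \<Omega>. h x * \<phi> x))"

definition weak_partial :: "(real^'n) set \<Rightarrow> 'n \<Rightarrow> (real^'n \<Rightarrow> real) \<Rightarrow> real^'n \<Rightarrow> real" where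
  "weak_partial \<Omega> i v = (SOME h. is_weak_partial \<Omega> i v h)"

text \<open>Members are total functions of which only the values on \<open>\<Omega>\<close> matter.\<close>

definition H1 :: "(real^'n) set \<Rightarrow> (real^'n \<Rightarrow> real) set" where
  "H1 \<Omega> = {v \<in> L2 (lebesgue_on \<Omega>). \<forall>i. \<exists>h. is_weak_partial \<Omega> i v h}"

definition H1_norm :: "(real^'n) set \<Rightarrow> (real^'n \<Rightarrow> real) \<Rightarrow> real" where
  "H1_norm \<Omega> v = sqrt ((LINT x|lebesgue_on \<Omega>. (v x)\<^sup>2) +
     (\<Sum>i\<in>UNIV. LINT x|lebesgue_on \<Omega>. (weak_partial \<Omega> i v x)\<^sup>2))"


subsection \<open>Domains\<close>

text \<open>Near each boundary point, after a rotation taking the last coordinate axis to the unit vector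
  \<open>\<nu>\<close>, the set is the strict epigraph of a Lipschitz function \<open>\<gamma>\<close> of the remaining
  coordinates, i.e. of the orthogonal projection to the hyperplane perpendicular to \<open>\<nu>\<close>.\<close>

definition bounded_Lipschitz_domain :: "(real^'n) set \<Rightarrow> bool" where
  "bounded_Lipschitz_domain \<Omega> \<longleftrightarrow>
     open \<Omega> \<and> connected \<Omega> \<and> \<Omega> \<noteq> {} \<and> bounded \<Omega> \<and>
     (\<forall>p \<in> frontier \<Omega>. \<exists>r>0. \<exists>\<nu> \<gamma> L. norm \<nu> = 1 \<and>
        L-lipschitz_on {y. y \<bullet> \<nu> = 0} \<gamma> \<and>
        \<Omega> \<inter> ball p r = {x \<in> ball p r. x \<bullet> \<nu> > (\<gamma> (x - (x \<bullet> \<nu>) *\<^sub>R \<nu>) :: real)})"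

definition holes :: "(real \<Rightarrow> (real^'n) set) \<Rightarrow> real \<Rightarrow> (real^'n) set" where
  "holes T \<epsilon> = (\<Union>\<delta>\<in>{0<..\<epsilon>}. T \<delta>)"

definition perforated :: "(real^'n) set \<Rightarrow> (real \<Rightarrow> (real^'n) set) \<Rightarrow> real \<Rightarrow> (real^'n) set" where
  "perforated \<Omega> T \<epsilon> = \<Omega> - holes T \<epsilon>"

text \<open>An uncountable union of closed sets need not be Lebesgue measurable. Lebesgue measure is therefore
  taken in the form of outer measure, which is total and agrees with it on measurable sets
  (\<open>outer_measure_of_eq\<close>); \<open>measure lebesgue\<close> would be zero on non-measurable sets.\<close>

definition vanishing_holes :: "(real^'n) set \<Rightarrow> (real \<Rightarrow> (real^'n) set) \<Rightarrow> bool" where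
  "vanishing_holes \<Omega> T \<longleftrightarrow>
     ((\<lambda>\<epsilon>. outer_measure_of lebesgue (\<Omega> - perforated \<Omega> T \<epsilon>)) \<longlongrightarrow> 0) (at_right 0)"

end

(* The holes shrink with epsilon, so the spaces V_eps of functions supported in the perforated domains
   increase as eps tends to 0.  The functions u_eps - g are then Galerkin projections onto an
   increasing family of subspaces: by orthogonality their energies are monotone and bounded, hence they
   form a Cauchy family and converge strongly in H^s (a Fourier-side Poincare inequality gives
   coercivity).  It remains to see that the limit solves the problem on all of Omega, i.e. that a
   continuous functional L vanishing on every V_eps vanishes on the whole space.  For a test function
   phi the product phi * w_eps lies in V_eps, and v |-> L (phi * v) is continuous on H^1(Omega), so the
   weak convergence of w_eps to 1 gives L phi = 0; test functions are dense because the domain is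
   Lipschitz. *)

theory Submission
  imports Defs "HOL-Probability.Probability"
begin

text \<open>Because the convergence is strong, the residual \<open>L\<close> of the limit equation
  is a fixed functional: a test function from one perforated space stays admissible for all smaller
  \<epsilon>, so \<open>L\<close> is known to vanish on every such space before \<open>w\<close>
  enters. Only one weakly convergent factor then remains, and no product of two weak limits has to
  be controlled. The Fourier transform and the fractional Laplacian are defined by choice, so they
  become usable only through Plancherel, inversion and the Hermitian symmetry of transforms of real
  functions; afterwards the form is an L2 inner product of weighted transforms. Two operations are
  not multiplications on the Fourier side. Localising near a boundary point multiplies by a
  Lipschitz cutoff; this is handled by norms of dyadic differences, which can be computed both in
  space and in frequency. Multiplying a member of \<open>H1 \<Omega>\<close> by a test function is
  handled by testing its weak derivative against products with cosines and sines.\<close>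

subsection \<open>Square-integrable functions\<close>

text \<open>For complex functions this is the real part of the Hermitian product.\<close>

definition inner_L2 :: "'a measure \<Rightarrow> ('a \<Rightarrow> 'b::euclidean_space) \<Rightarrow> ('a \<Rightarrow> 'b) \<Rightarrow> real" where
  "inner_L2 M f g = (LINT x|M. f x \<bullet> g x)"

definition norm_L2 :: "'a measure \<Rightarrow> ('a \<Rightarrow> 'b::euclidean_space) \<Rightarrow> real" where
  "norm_L2 M f = sqrt (LINT x|M. (norm (f x))\<^sup>2)"

lemma norm_L2_nonneg [simp]: "0 \<le> norm_L2 M f"
  by (simp add: norm_L2_def)

lemma norm_L2_sq: "(norm_L2 M f)\<^sup>2 = (LINT x|M. (norm (f x))\<^sup>2)"
  by (simp add: norm_L2_def)

lemma inner_L2_self: "inner_L2 M f f = (norm_L2 M f)\<^sup>2"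
  by (simp add: norm_L2_sq inner_L2_def power2_norm_eq_inner)

lemma L2_measurable: "f \<in> L2 M \<Longrightarrow> f \<in> borel_measurable M"
  by (simp add: L2_def)

lemma L2_integrable: "f \<in> L2 M \<Longrightarrow> integrable M (\<lambda>x. (norm (f x))\<^sup>2)"
  by (simp add: L2_def)

lemma nn_integral_L2:
  "f \<in> L2 M \<Longrightarrow> (\<integral>\<^sup>+x. ennreal ((norm (f x))\<^sup>2) \<partial>M) = ennreal ((norm_L2 M f)\<^sup>2)"
  unfolding norm_L2_sq by (intro nn_integral_eq_integral) (auto simp: L2_integrable)

lemma L2_I_nn:
  assumes "f \<in> borel_measurable M" "(\<integral>\<^sup>+x. ennreal ((norm (f x))\<^sup>2) \<partial>M) < \<infinity>"
  shows "f \<in> L2 M"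
  using assms by (auto simp: L2_def intro!: integrableI_bounded)

lemma norm_L2_le_nn:
  assumes "f \<in> L2 M" "(\<integral>\<^sup>+x. ennreal ((norm (f x))\<^sup>2) \<partial>M) \<le> ennreal (c\<^sup>2)" "0 \<le> c"
  shows "norm_L2 M f \<le> c"
proof -
  have "(norm_L2 M f)\<^sup>2 \<le> c\<^sup>2"
    using assms(2) by (simp add: nn_integral_L2[OF assms(1)])
  then show ?thesis using assms(3) by (rule power2_le_imp_le)
qed

text \<open>The codomains of \<open>f\<close> and \<open>g\<close> may differ, so a real indicator
  or weight can majorise a vector-valued function. Membership and the norm bound come from one
  pointwise comparison.\<close>

lemma L2_dominate:
  fixes f :: "'a \<Rightarrow> 'b::euclidean_space" and g :: "'a \<Rightarrow> 'c::euclidean_space"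
  assumes g: "g \<in> L2 M" and f: "f \<in> borel_measurable M" and C: "0 \<le> C"
    and le: "AE x in M. norm (f x) \<le> C * norm (g x)"
  shows "f \<in> L2 M" "norm_L2 M f \<le> C * norm_L2 M g"
proof -
  have le2: "AE x in M. (norm (f x))\<^sup>2 \<le> C\<^sup>2 * (norm (g x))\<^sup>2"
    using le
  proof eventually_elim
    case (elim x)
    then have "(norm (f x))\<^sup>2 \<le> (C * norm (g x))\<^sup>2" by (intro power_mono) auto
    then show ?case by (simp add: power_mult_distrib)
  qed
  have i: "integrable M (\<lambda>x. C\<^sup>2 * (norm (g x))\<^sup>2)"
    using L2_integrable[OF g] by simp
  have "integrable M (\<lambda>x. (norm (f x))\<^sup>2)"
    by (rule Bochner_Integration.integrable_bound[OF i]) (use f le2 in auto)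
  then show L: "f \<in> L2 M" using f by (simp add: L2_def)
  have "(norm_L2 M f)\<^sup>2 \<le> (LINT x|M. C\<^sup>2 * (norm (g x))\<^sup>2)"
    unfolding norm_L2_sq using le2 i L2_integrable[OF L] by (intro integral_mono_AE) auto
  also have "\<dots> = (C * norm_L2 M g)\<^sup>2"
    by (simp add: power_mult_distrib norm_L2_sq)
  finally show "norm_L2 M f \<le> C * norm_L2 M g"
    by (rule power2_le_imp_le) (simp add: C)
qed

lemma L2_cong_AE:
  fixes f g :: "'a \<Rightarrow> 'b::euclidean_space"
  assumes "f \<in> L2 M" "g \<in> borel_measurable M" "AE x in M. g x = f x"
  shows "g \<in> L2 M" "norm_L2 M g = norm_L2 M f"
proof -
  show g: "g \<in> L2 M"
    by (rule L2_dominate(1)[OF assms(1,2), of 1]) (use assms(3) in auto)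
  show "norm_L2 M g = norm_L2 M f"
    unfolding norm_L2_def using assms(3) L2_measurable[OF assms(1)] assms(2)
    by (intro arg_cong[where f=sqrt] integral_cong_AE) auto
qed

lemma norm_add_sq_le: "(norm (a + b :: 'b::real_normed_vector))\<^sup>2 \<le> 2 * (norm a)\<^sup>2 + 2 * (norm b)\<^sup>2"
proof -
  have "(norm (a + b))\<^sup>2 \<le> (norm a + norm b)\<^sup>2" by (intro power_mono norm_triangle_ineq) auto
  also have "\<dots> \<le> 2 * (norm a)\<^sup>2 + 2 * (norm b)\<^sup>2"
    using sum_squares_bound[of "norm a" "norm b"] by (simp add: power2_sum)
  finally show ?thesis .
qed

lemma L2_add [intro]:
  fixes f g :: "'a \<Rightarrow> 'b::euclidean_space"
  assumes "f \<in> L2 M" "g \<in> L2 M" shows "(\<lambda>x. f x + g x) \<in> L2 M"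
proof -
  have "integrable M (\<lambda>x. (norm (f x + g x))\<^sup>2)"
    by (rule Bochner_Integration.integrable_bound[of M "\<lambda>x. 2 * (norm (f x))\<^sup>2 + 2 * (norm (g x))\<^sup>2"])
      (use assms norm_add_sq_le in \<open>auto simp: L2_def\<close>)
  then show ?thesis using assms by (auto simp: L2_def)
qed

lemma L2_scaleR [intro]:
  fixes f :: "'a \<Rightarrow> 'b::euclidean_space"
  assumes "f \<in> L2 M" shows "(\<lambda>x. c *\<^sub>R f x) \<in> L2 M"
  by (rule L2_dominate(1)[OF assms, of _ "\<bar>c\<bar>"]) (use assms in \<open>auto simp: L2_def\<close>)

lemma L2_cmult [intro]: "f \<in> L2 M \<Longrightarrow> (\<lambda>x. c * f x :: real) \<in> L2 M"
  using L2_scaleR[of f M c] by simp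

lemma L2_diff [intro]:
  fixes f g :: "'a \<Rightarrow> 'b::euclidean_space"
  assumes "f \<in> L2 M" "g \<in> L2 M" shows "(\<lambda>x. f x - g x) \<in> L2 M"
  using L2_add[OF assms(1) L2_scaleR[OF assms(2), of "-1"]] by simp

lemma L2_of_real: "v \<in> L2 M \<Longrightarrow> (\<lambda>x. complex_of_real (v x)) \<in> L2 M"
  by (auto simp: L2_def)

lemma norm_L2_of_real [simp]: "norm_L2 M (\<lambda>x. complex_of_real (v x)) = norm_L2 M v"
  by (simp add: norm_L2_def)

lemma norm_L2_minus_commute: "norm_L2 M (\<lambda>x. f x - g x) = norm_L2 M (\<lambda>x. g x - f x)"
  by (simp add: norm_L2_def norm_minus_commute)

lemma L2_norm_mult_integrable:
  fixes f :: "'a \<Rightarrow> 'b::euclidean_space" and g :: "'a \<Rightarrow> 'c::euclidean_space"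
  assumes "f \<in> L2 M" "g \<in> L2 M"
  shows "integrable M (\<lambda>x. norm (f x) * norm (g x))"
proof (rule Bochner_Integration.integrable_bound[of M "\<lambda>x. (norm (f x))\<^sup>2 + (norm (g x))\<^sup>2"])
  show "AE x in M. norm (norm (f x) * norm (g x)) \<le> norm ((norm (f x))\<^sup>2 + (norm (g x))\<^sup>2)"
  proof (rule AE_I2)
    fix x
    have "2 * (norm (f x) * norm (g x)) \<le> (norm (f x))\<^sup>2 + (norm (g x))\<^sup>2"
      using sum_squares_bound[of "norm (f x)" "norm (g x)"] by simp
    moreover have "0 \<le> norm (f x) * norm (g x)" by simp
    ultimately show "norm (norm (f x) * norm (g x)) \<le> norm ((norm (f x))\<^sup>2 + (norm (g x))\<^sup>2)"
      unfolding real_norm_def by linarith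
  qed
qed (use assms in \<open>auto simp: L2_def\<close>)

text \<open>Squaring the integral moves it to \<open>ennreal\<close>, where
  \<open>Cauchy_Schwarz_nn_integral\<close> asks for measurability only.\<close>

lemma L2_CS:
  fixes f :: "'a \<Rightarrow> 'b::euclidean_space" and g :: "'a \<Rightarrow> 'c::euclidean_space"
  assumes f: "f \<in> L2 M" and g: "g \<in> L2 M"
  shows "(LINT x|M. norm (f x) * norm (g x)) \<le> norm_L2 M f * norm_L2 M g"
proof -
  let ?I = "LINT x|M. norm (f x) * norm (g x)"
  have "ennreal (?I\<^sup>2) = (\<integral>\<^sup>+x. ennreal (norm (f x)) * ennreal (norm (g x)) \<partial>M)\<^sup>2"
    using L2_norm_mult_integrable[OF f g]
    by (subst ennreal_power[symmetric]) (auto simp: nn_integral_eq_integral ennreal_mult' [symmetric])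
  also have "\<dots> \<le> (\<integral>\<^sup>+x. (ennreal (norm (f x)))\<^sup>2 \<partial>M) * (\<integral>\<^sup>+x. (ennreal (norm (g x)))\<^sup>2 \<partial>M)"
    using f g by (intro Cauchy_Schwarz_nn_integral) (auto simp: L2_def)
  also have "\<dots> = ennreal ((norm_L2 M f * norm_L2 M g)\<^sup>2)"
    using nn_integral_L2[OF f] nn_integral_L2[OF g]
    by (simp add: ennreal_power power_mult_distrib ennreal_mult)
  finally have "?I\<^sup>2 \<le> (norm_L2 M f * norm_L2 M g)\<^sup>2" by simp
  then show ?thesis by (rule power2_le_imp_le) simp
qed

lemma L2_inner_integrable [intro]:
  fixes f g :: "'a \<Rightarrow> 'b::euclidean_space"
  assumes "f \<in> L2 M" "g \<in> L2 M"
  shows "integrable M (\<lambda>x. f x \<bullet> g x)"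
  by (rule Bochner_Integration.integrable_bound[OF L2_norm_mult_integrable[OF assms]])
    (use assms Cauchy_Schwarz_ineq2 in \<open>auto simp: L2_def\<close>)

lemma L2_mult_integrable:
  fixes f g :: "'a \<Rightarrow> complex"
  assumes "f \<in> L2 M" "g \<in> L2 M"
  shows "integrable M (\<lambda>x. f x * g x)"
  by (rule Bochner_Integration.integrable_bound[OF L2_norm_mult_integrable[OF assms]])
    (use assms in \<open>auto simp: L2_def norm_mult\<close>)

lemma L2_mult_bound:
  fixes f g :: "'a \<Rightarrow> complex"
  assumes "f \<in> L2 M" "g \<in> L2 M"
  shows "norm (LINT x|M. f x * g x) \<le> norm_L2 M f * norm_L2 M g"
proof -
  have "norm (LINT x|M. f x * g x) \<le> (LINT x|M. norm (f x * g x))" by (rule integral_norm_bound)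
  also have "\<dots> \<le> norm_L2 M f * norm_L2 M g" using L2_CS[OF assms] by (simp add: norm_mult)
  finally show ?thesis .
qed

lemma inner_L2_commute: "inner_L2 M f g = inner_L2 M g f"
  by (simp add: inner_L2_def inner_commute)

lemma inner_L2_add:
  "f \<in> L2 M \<Longrightarrow> g \<in> L2 M \<Longrightarrow> h \<in> L2 M \<Longrightarrow> inner_L2 M (\<lambda>x. f x + g x) h = inner_L2 M f h + inner_L2 M g h"
  unfolding inner_L2_def by (simp add: inner_add_left L2_inner_integrable)

lemma inner_L2_add_right:
  "f \<in> L2 M \<Longrightarrow> g \<in> L2 M \<Longrightarrow> h \<in> L2 M \<Longrightarrow> inner_L2 M h (\<lambda>x. f x + g x) = inner_L2 M h f + inner_L2 M h g"
  unfolding inner_L2_def by (simp add: inner_add_right L2_inner_integrable)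

lemma inner_L2_scaleR: "inner_L2 M (\<lambda>x. c *\<^sub>R f x) h = c * inner_L2 M f h"
  unfolding inner_L2_def by simp

lemma inner_L2_diff:
  "f \<in> L2 M \<Longrightarrow> g \<in> L2 M \<Longrightarrow> h \<in> L2 M \<Longrightarrow> inner_L2 M (\<lambda>x. f x - g x) h = inner_L2 M f h - inner_L2 M g h"
  unfolding inner_L2_def by (simp add: inner_diff_left L2_inner_integrable)

lemma inner_L2_CS:
  assumes "f \<in> L2 M" "g \<in> L2 M" shows "\<bar>inner_L2 M f g\<bar> \<le> norm_L2 M f * norm_L2 M g"
proof -
  have "\<bar>inner_L2 M f g\<bar> \<le> (LINT x|M. \<bar>f x \<bullet> g x\<bar>)"
    unfolding inner_L2_def by (rule integral_abs_bound)
  also have "\<dots> \<le> (LINT x|M. norm (f x) * norm (g x))"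
    by (intro integral_mono integrable_abs L2_inner_integrable L2_norm_mult_integrable assms Cauchy_Schwarz_ineq2)
  finally show ?thesis using L2_CS[OF assms] by linarith
qed

lemma norm_L2_triangle:
  assumes f: "f \<in> L2 M" and g: "g \<in> L2 M"
  shows "norm_L2 M (\<lambda>x. f x + g x) \<le> norm_L2 M f + norm_L2 M g"
proof (rule power2_le_imp_le)
  have "(norm_L2 M (\<lambda>x. f x + g x))\<^sup>2 = inner_L2 M f f + 2 * inner_L2 M f g + inner_L2 M g g"
    unfolding inner_L2_self[symmetric] using f g
    by (simp add: inner_L2_add inner_L2_add_right L2_add inner_L2_commute[of M g f])
  also have "\<dots> \<le> (norm_L2 M f)\<^sup>2 + 2 * (norm_L2 M f * norm_L2 M g) + (norm_L2 M g)\<^sup>2"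
    unfolding inner_L2_self using inner_L2_CS[OF f g] by linarith
  finally show "(norm_L2 M (\<lambda>x. f x + g x))\<^sup>2 \<le> (norm_L2 M f + norm_L2 M g)\<^sup>2"
    by (simp add: power2_sum)
qed simp

lemma norm_L2_triangle_diff:
  assumes "f \<in> L2 M" "g \<in> L2 M" "h \<in> L2 M"
  shows "norm_L2 M (\<lambda>x. f x - h x) \<le> norm_L2 M (\<lambda>x. f x - g x) + norm_L2 M (\<lambda>x. g x - h x)"
  using norm_L2_triangle[OF L2_diff[OF assms(1,2)] L2_diff[OF assms(2,3)]] by simp

lemma norm_L2_diff_abs:
  assumes "f \<in> L2 M" "g \<in> L2 M"
  shows "\<bar>norm_L2 M f - norm_L2 M g\<bar> \<le> norm_L2 M (\<lambda>x. f x - g x)"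
  using norm_L2_triangle[OF L2_diff[OF assms] assms(2)] norm_L2_triangle[OF L2_diff[OF assms(2,1)] assms(1)]
  by (simp add: norm_L2_minus_commute[of M g f])

lemma norm_L2_eq_0_iff:
  assumes "f \<in> L2 M" shows "norm_L2 M f = 0 \<longleftrightarrow> (AE x in M. f x = 0)"
  using integral_nonneg_eq_0_iff_AE[OF L2_integrable[OF assms]] by (simp add: norm_L2_def)

lemma norm_L2_diff_eq_0_iff:
  assumes "f \<in> L2 M" "g \<in> L2 M" shows "norm_L2 M (\<lambda>x. f x - g x) = 0 \<longleftrightarrow> (AE x in M. f x = g x)"
  using norm_L2_eq_0_iff[OF L2_diff[OF assms]] by simp

lemma norm_L2_tendsto:
  assumes "\<forall>\<^sub>F n in F. f n \<in> L2 M" "g \<in> L2 M" "((\<lambda>n. norm_L2 M (\<lambda>x. f n x - g x)) \<longlongrightarrow> 0) F"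
  shows "((\<lambda>n. norm_L2 M (f n)) \<longlongrightarrow> norm_L2 M g) F"
proof -
  have "((\<lambda>n. norm_L2 M (f n) - norm_L2 M g) \<longlongrightarrow> 0) F"
    by (rule Lim_null_comparison[OF _ assms(3)])
      (use assms(1) in eventually_elim, use norm_L2_diff_abs assms(2) in auto)
  then show ?thesis by (simp add: LIM_zero_iff)
qed

text \<open>The squared distances tend to 0 in L1, which yields almost everywhere convergence along
  a subsequence; a square root removes the square.\<close>

lemma L2_limit_AE:
  fixes f :: "nat \<Rightarrow> 'a \<Rightarrow> 'b::euclidean_space"
  assumes f: "\<And>n. f n \<in> L2 M" and g: "g \<in> L2 M" and lim: "(\<lambda>n. norm_L2 M (\<lambda>x. f n x - g x)) \<longlonglongrightarrow> 0"
  shows "\<exists>r. strict_mono r \<and> (AE x in M. (\<lambda>n. f (r n) x) \<longlonglongrightarrow> g x)"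
proof -
  have "\<exists>r. strict_mono r \<and> (AE x in M. (\<lambda>n. (norm (f (r n) x - g x))\<^sup>2) \<longlonglongrightarrow> 0)"
    by (rule tendsto_L1_AE_subseq[where u="\<lambda>n x. (norm (f n x - g x))\<^sup>2"])
      (use L2_integrable[OF L2_diff[OF f g]] tendsto_power[OF lim, of 2] in \<open>auto simp: norm_L2_sq\<close>)
  then obtain r where r: "strict_mono r" "AE x in M. (\<lambda>n. (norm (f (r n) x - g x))\<^sup>2) \<longlonglongrightarrow> 0" by blast
  have "AE x in M. (\<lambda>n. f (r n) x) \<longlonglongrightarrow> g x"
    using r(2)
  proof eventually_elim
    case (elim x)
    then have "(\<lambda>n. sqrt ((norm (f (r n) x - g x))\<^sup>2)) \<longlonglongrightarrow> sqrt 0" by (intro tendsto_real_sqrt)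
    then show ?case by (simp add: tendsto_norm_zero_iff LIM_zero_iff)
  qed
  then show ?thesis using r(1) by blast
qed

text \<open>The limit inherits the bound of the sequence, so the squared difference has the
  integrable majorant \<open>4 * (norm (h x))\<^sup>2\<close>.\<close>

lemma L2_dominated_convergence:
  fixes f :: "nat \<Rightarrow> 'a \<Rightarrow> 'b::euclidean_space" and h :: "'a \<Rightarrow> 'c::euclidean_space"
  assumes f: "\<And>n. f n \<in> borel_measurable M" and g: "g \<in> borel_measurable M" and h: "h \<in> L2 M"
    and le: "\<And>n. AE x in M. norm (f n x) \<le> norm (h x)"
    and lim: "AE x in M. (\<lambda>n. f n x) \<longlonglongrightarrow> g x"
  shows "g \<in> L2 M" "(\<lambda>n. norm_L2 M (\<lambda>x. f n x - g x)) \<longlonglongrightarrow> 0"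
proof -
  have le': "AE x in M. \<forall>n. norm (f n x) \<le> norm (h x)" using le by (simp add: AE_all_countable)
  have gle: "AE x in M. norm (g x) \<le> norm (h x)"
    using le' lim
  proof eventually_elim
    case (elim x)
    then show ?case using LIMSEQ_le_const2[OF tendsto_norm[OF elim(2)]] by blast
  qed
  show gL: "g \<in> L2 M" by (rule L2_dominate(1)[OF h g, of 1]) (use gle in auto)
  have "(\<lambda>n. LINT x|M. (norm (f n x - g x))\<^sup>2) \<longlonglongrightarrow> (LINT x|M. 0)"
  proof (rule integral_dominated_convergence[where w="\<lambda>x. 4 * (norm (h x))\<^sup>2"])
    show "AE x in M. (\<lambda>n. (norm (f n x - g x))\<^sup>2) \<longlonglongrightarrow> 0"
      using lim
    proof eventually_elim
      case (elim x)
      have "(\<lambda>n. (norm (f n x - g x))\<^sup>2) \<longlonglongrightarrow> (norm (g x - g x))\<^sup>2"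
        by (intro tendsto_intros elim)
      then show ?case by simp
    qed
    fix n
    show "AE x in M. norm ((norm (f n x - g x))\<^sup>2) \<le> 4 * (norm (h x))\<^sup>2"
      using le[of n] gle
    proof eventually_elim
      case (elim x)
      have "norm (f n x - g x) \<le> 2 * norm (h x)"
        using elim norm_triangle_ineq4[of "f n x" "g x"] by linarith
      then have "(norm (f n x - g x))\<^sup>2 \<le> (2 * norm (h x))\<^sup>2" by (intro power_mono) auto
      then show ?case by (simp add: power_mult_distrib)
    qed
  qed (use f g L2_integrable[OF h] in auto)
  then have "(\<lambda>n. sqrt (LINT x|M. (norm (f n x - g x))\<^sup>2)) \<longlonglongrightarrow> sqrt 0"
    by (intro tendsto_real_sqrt) simp
  then show "(\<lambda>n. norm_L2 M (\<lambda>x. f n x - g x)) \<longlonglongrightarrow> 0" by (simp add: norm_L2_def)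
qed

text \<open>Riesz-Fischer. A fast subsequence has increments whose weighted squares have a finite
  summed integral, so it converges almost everywhere; Fatou's lemma then bounds the distance of the
  whole sequence to the pointwise limit.\<close>

lemma L2_complete:
  fixes f :: "nat \<Rightarrow> 'a \<Rightarrow> 'b::euclidean_space"
  assumes f: "\<And>n. f n \<in> L2 M"
    and cauchy: "\<And>e. 0 < e \<Longrightarrow> \<exists>N. \<forall>m\<ge>N. \<forall>n\<ge>N. norm_L2 M (\<lambda>x. f m x - f n x) < e"
  shows "\<exists>g. g \<in> L2 M \<and> (\<lambda>n. norm_L2 M (\<lambda>x. f n x - g x)) \<longlonglongrightarrow> 0"
proof -
  have [measurable]: "\<And>n. f n \<in> borel_measurable M" using f by (simp add: L2_def)
  have "\<exists>N. \<forall>k::nat. (\<forall>m\<ge>N k. \<forall>n\<ge>N k. norm_L2 M (\<lambda>x. f m x - f n x) < (1/2)^k)"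
    by (intro choice allI cauchy) auto
  then obtain N where N: "\<And>k m n. m \<ge> N k \<Longrightarrow> n \<ge> N k \<Longrightarrow> norm_L2 M (\<lambda>x. f m x - f n x) < (1/2)^k" by metis
  \<comment> \<open>Summing all earlier \<open>N j\<close> makes \<open>r m\<close> exceed
    \<open>N k\<close> for every k up to m, without assuming \<open>N\<close> monotone.\<close>
  define r where "r = (\<lambda>k. (\<Sum>j\<le>k. N j) + k)"
  have rN: "r m \<ge> N k" if "m \<ge> k" for k m
  proof -
    have "N k \<le> (\<Sum>j\<le>m. N j)" using that by (intro member_le_sum) auto
    then show ?thesis by (simp add: r_def)
  qed
  \<comment> \<open>The sum below carries the weight \<open>2^k\<close>: against squared norms of
    size \<open>(1/4)^k\<close> it leaves a convergent geometric series, and pointwise it upgrades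
    square summability to absolute summability.\<close>
  define D where "D = (\<lambda>k x. norm (f (r (Suc k)) x - f (r k) x))"
  have [measurable]: "D k \<in> borel_measurable M" for k by (simp add: D_def)
  have "(\<integral>\<^sup>+x. (\<Sum>k. ennreal (2^k * (D k x)\<^sup>2)) \<partial>M) = (\<Sum>k. \<integral>\<^sup>+x. ennreal (2^k * (D k x)\<^sup>2) \<partial>M)"
    by (intro nn_integral_suminf) auto
  also have "\<dots> \<le> (\<Sum>k. ennreal ((1/2)^k))"
  proof (intro suminf_le)
    fix k
    have L: "(\<lambda>x. f (r (Suc k)) x - f (r k) x) \<in> L2 M" by (intro L2_diff f)
    have "(\<integral>\<^sup>+x. ennreal (2^k * (D k x)\<^sup>2) \<partial>M) = ennreal (2^k) * ennreal ((norm_L2 M (\<lambda>x. f (r (Suc k)) x - f (r k) x))\<^sup>2)"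
      unfolding nn_integral_L2[OF L, symmetric] D_def
      by (subst nn_integral_cmult[symmetric]) (auto simp: ennreal_mult)
    also have "\<dots> = ennreal (2^k * (norm_L2 M (\<lambda>x. f (r (Suc k)) x - f (r k) x))\<^sup>2)"
      by (simp add: ennreal_mult)
    also have "\<dots> \<le> ennreal ((1/2)^k)"
    proof (rule ennreal_leI)
      have "norm_L2 M (\<lambda>x. f (r (Suc k)) x - f (r k) x) \<le> (1/2)^k"
        by (intro less_imp_le[OF N] rN) auto
      then have "(norm_L2 M (\<lambda>x. f (r (Suc k)) x - f (r k) x))\<^sup>2 \<le> ((1/2)^k)\<^sup>2" by (intro power_mono) auto
      then have "2^k * (norm_L2 M (\<lambda>x. f (r (Suc k)) x - f (r k) x))\<^sup>2 \<le> 2^k * ((1/2)^k)\<^sup>2" by simp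
      also have "\<dots> = (1/2)^k" by (simp add: power2_eq_square power_divide)
      finally show "2^k * (norm_L2 M (\<lambda>x. f (r (Suc k)) x - f (r k) x))\<^sup>2 \<le> (1/2)^k" .
    qed
    finally show "(\<integral>\<^sup>+x. ennreal (2^k * (D k x)\<^sup>2) \<partial>M) \<le> ennreal ((1/2)^k)" .
  qed auto
  also have "\<dots> < \<infinity>"
    by (subst suminf_ennreal2) (auto simp: summable_geometric)
  finally have "AE x in M. (\<Sum>k. ennreal (2^k * (D k x)\<^sup>2)) \<noteq> \<infinity>"
    by (intro nn_integral_PInf_AE) auto
  then have conv: "AE x in M. convergent (\<lambda>k. f (r k) x)"
  proof eventually_elim
    case (elim x)
    then have s1: "summable (\<lambda>k. 2^k * (D k x)\<^sup>2)"
      by (intro summable_suminf_not_top) auto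
    have s2: "summable (\<lambda>k. 2^k * (D k x)\<^sup>2 + (1/2)^k)"
      by (intro summable_add s1 summable_geometric) auto
    have "summable (\<lambda>k. f (r (Suc k)) x - f (r k) x)"
    proof (rule summable_comparison_test[OF _ s2], intro exI allI impI)
      fix k
      have p: "(0::real) < 2^k" by simp
      \<comment> \<open>This is 2ab at most the sum of the squares, with a = 2^(k/2) D and b =
        2^(-k/2); it bounds the increment by two summable terms.\<close>
      have "0 \<le> (2^k * D k x - 1)\<^sup>2 / 2^k" by simp
      also have "\<dots> = 2^k * (D k x)\<^sup>2 - 2 * D k x + (1/2)^k"
        using p by (simp add: power2_diff power_mult_distrib field_simps power2_eq_square)
      finally have "2 * D k x \<le> 2^k * (D k x)\<^sup>2 + (1/2)^k" by simp
      moreover have "0 \<le> D k x" by (simp add: D_def)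
      ultimately show "norm (f (r (Suc k)) x - f (r k) x) \<le> 2^k * (D k x)\<^sup>2 + (1/2)^k"
        unfolding D_def by linarith
    qed
    then have "convergent (\<lambda>n. \<Sum>k<n. f (r (Suc k)) x - f (r k) x)"
      by (simp only: summable_iff_convergent)
    then have "convergent (\<lambda>n. f (r n) x - f (r 0) x)"
      by (simp only: sum_lessThan_telescope[of "\<lambda>k. f (r k) x"])
    from convergent_add[OF this convergent_const[of "f (r 0) x"]] show ?case by simp
  qed
  define g where "g = (\<lambda>x. lim (\<lambda>k. f (r k) x))"
  have [measurable]: "g \<in> borel_measurable M" unfolding g_def by measurable
  have lim: "AE x in M. (\<lambda>k. f (r k) x) \<longlonglongrightarrow> g x"
    using conv by eventually_elim (simp add: g_def convergent_LIMSEQ_iff)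
  \<comment> \<open>\<open>m\<close> stays fixed while the subsequence index tends to infinity, so
    the bound between \<open>f m\<close> and \<open>f (r j)\<close> passes to \<open>f m\<close> and
    \<open>g\<close>.\<close>
  have fatou: "(\<integral>\<^sup>+x. ennreal ((norm (f m x - g x))\<^sup>2) \<partial>M) \<le> ennreal (((1/2)^k)\<^sup>2)" if m: "m \<ge> N k" for m k
  proof -
    have "(\<integral>\<^sup>+x. ennreal ((norm (f m x - g x))\<^sup>2) \<partial>M)
       = (\<integral>\<^sup>+x. liminf (\<lambda>j. ennreal ((norm (f m x - f (r j) x))\<^sup>2)) \<partial>M)"
    proof (rule nn_integral_cong_AE, use lim in eventually_elim)
      fix x assume "(\<lambda>k. f (r k) x) \<longlonglongrightarrow> g x"
      then have "(\<lambda>j. ennreal ((norm (f m x - f (r j) x))\<^sup>2)) \<longlonglongrightarrow> ennreal ((norm (f m x - g x))\<^sup>2)"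
        by (intro tendsto_intros)
      then show "ennreal ((norm (f m x - g x))\<^sup>2) = liminf (\<lambda>j. ennreal ((norm (f m x - f (r j) x))\<^sup>2))"
        by (intro lim_imp_Liminf[symmetric]) auto
    qed
    also have "\<dots> \<le> liminf (\<lambda>j. \<integral>\<^sup>+x. ennreal ((norm (f m x - f (r j) x))\<^sup>2) \<partial>M)"
      by (intro nn_integral_liminf) auto
    also have "\<dots> \<le> ennreal (((1/2)^k)\<^sup>2)"
    proof (rule Liminf_le)
      show "\<forall>\<^sub>F j in sequentially. (\<integral>\<^sup>+x. ennreal ((norm (f m x - f (r j) x))\<^sup>2) \<partial>M) \<le> ennreal (((1/2)^k)\<^sup>2)"
        using eventually_ge_at_top[of k]
      proof eventually_elim
        case (elim j)
        have "norm_L2 M (\<lambda>x. f m x - f (r j) x) \<le> (1/2)^k" by (intro less_imp_le[OF N] m rN elim)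
        then show ?case
          by (subst nn_integral_L2) (auto intro!: f ennreal_leI power_mono L2_diff simp del: power_divide)
      qed
    qed simp
    finally show ?thesis .
  qed
  have dL: "(\<lambda>x. f m x - g x) \<in> L2 M" if "m \<ge> N 0" for m
    by (rule L2_I_nn) (use fatou[OF that] in \<open>auto simp: less_top[symmetric] top_unique\<close>)
  have "(\<lambda>x. f (N 0) x - (f (N 0) x - g x)) \<in> L2 M" by (intro L2_diff f dL) auto
  then have gL: "g \<in> L2 M" by simp
  have "(\<lambda>n. norm_L2 M (\<lambda>x. f n x - g x)) \<longlonglongrightarrow> 0"
  proof (rule LIMSEQ_I)
    fix e :: real assume "0 < e"
    then obtain k where k: "(1/2)^k < e" using real_arch_pow_inv[of e "1/2"] by auto
    show "\<exists>n0. \<forall>n\<ge>n0. norm (norm_L2 M (\<lambda>x. f n x - g x) - 0) < e"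
    proof (intro exI allI impI)
      fix n assume "N k \<le> n"
      then have "norm_L2 M (\<lambda>x. f n x - g x) \<le> (1/2)^k"
        by (intro norm_L2_le_nn fatou L2_diff f gL) auto
      then show "norm (norm_L2 M (\<lambda>x. f n x - g x) - 0) < e" using k by simp
    qed
  qed
  then show ?thesis using gL by blast
qed

subsection \<open>Lebesgue measure: affine maps and continuity of translations\<close>

text \<open>The library fact scales each coordinate by its own factor; here all factors equal
  \<open>c\<close>. Translations are the case \<open>c = 1\<close>, reflection is
  \<open>c = -1\<close>, and the dilations serve the Gaussians.\<close>

lemma lebesgue_affine_density:
  fixes t :: "'a::euclidean_space"
  assumes "c \<noteq> 0"
  shows "lebesgue = density (distr lebesgue lebesgue (\<lambda>x. t + c *\<^sub>R x)) (\<lambda>_. ennreal (\<bar>c\<bar> ^ DIM('a)))"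
  using lebesgue_affine_euclidean[of "\<lambda>_::'a. c" t] assms
  unfolding scaleR_scaleR[symmetric] scaleR_sum_right[symmetric] euclidean_representation prod_constant by simp

lemma lebesgue_affine_map [measurable]:
  fixes t :: "'a::euclidean_space"
  assumes "c \<noteq> 0"
  shows "(\<lambda>x. t + c *\<^sub>R x) \<in> lebesgue \<rightarrow>\<^sub>M lebesgue"
  using lebesgue_affine_measurable[of "\<lambda>_::'a. c" t] assms
  unfolding scaleR_scaleR[symmetric] scaleR_sum_right[symmetric] euclidean_representation by simp

lemma borel_measurable_lebesgue_affine:
  fixes t :: "'a::euclidean_space"
  assumes "c \<noteq> 0" "f \<in> borel_measurable lebesgue"
  shows "(\<lambda>x. f (t + c *\<^sub>R x)) \<in> borel_measurable lebesgue"
  by (rule measurable_compose[OF lebesgue_affine_map[OF assms(1)] assms(2)])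

lemma AE_lebesgue_affine:
  fixes t :: "'a::euclidean_space"
  assumes "c \<noteq> 0" "AE x in lebesgue. P x"
  shows "AE x in lebesgue. P (t + c *\<^sub>R x)"
proof (rule AE_distrD[OF lebesgue_affine_map[OF assms(1)]])
  show "AE x in distr lebesgue lebesgue (\<lambda>x. t + c *\<^sub>R x). P x"
    using assms(2) assms(1) by (subst (asm) lebesgue_affine_density[OF assms(1), of t]) (simp add: AE_density)
qed

lemma nn_integral_lebesgue_affine:
  fixes t :: "'a::euclidean_space"
  assumes "c \<noteq> 0" "f \<in> borel_measurable lebesgue"
  shows "(\<integral>\<^sup>+x. f x \<partial>lebesgue) = ennreal (\<bar>c\<bar> ^ DIM('a)) * (\<integral>\<^sup>+x. f (t + c *\<^sub>R x) \<partial>lebesgue)"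
  using assms lebesgue_affine_map[OF assms(1), of t]
  by (subst lebesgue_affine_density[OF assms(1), of t])
    (simp add: nn_integral_density nn_integral_distr nn_integral_cmult borel_measurable_lebesgue_affine)

lemma integrable_lebesgue_affine:
  fixes t :: "'a::euclidean_space" and f :: "'a \<Rightarrow> 'b::{banach, second_countable_topology}"
  assumes "c \<noteq> 0" "integrable lebesgue f"
  shows "integrable lebesgue (\<lambda>x. f (t + c *\<^sub>R x))"
proof -
  have f[measurable]: "f \<in> borel_measurable lebesgue" using assms(2) by auto
  have "(\<integral>\<^sup>+x. ennreal (norm (f x)) \<partial>lebesgue) < \<infinity>" using assms(2) by (simp add: integrable_iff_bounded)
  then show ?thesis using assms(1)
    by (subst (asm) nn_integral_lebesgue_affine[OF assms(1), of _ t])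
      (auto simp: integrable_iff_bounded f borel_measurable_lebesgue_affine ennreal_mult_less_top)
qed

lemma integral_lebesgue_affine:
  fixes t :: "'a::euclidean_space" and f :: "'a \<Rightarrow> 'b::{banach, second_countable_topology}"
  assumes "c \<noteq> 0" "f \<in> borel_measurable lebesgue"
  shows "(LINT x|lebesgue. f x) = \<bar>c\<bar> ^ DIM('a) *\<^sub>R (LINT x|lebesgue. f (t + c *\<^sub>R x))"
  using assms lebesgue_affine_map[OF assms(1), of t]
  by (subst lebesgue_affine_density[OF assms(1), of t])
    (simp add: integral_density integral_distr)

lemma borel_measurable_lebesgue_shift:
  fixes h :: "'a::euclidean_space"
  shows "f \<in> borel_measurable lebesgue \<Longrightarrow> (\<lambda>x. f (x + h)) \<in> borel_measurable lebesgue"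
  using borel_measurable_lebesgue_affine[of 1 f h] by (simp add: add.commute)

lemma AE_lebesgue_shift:
  fixes h :: "'a::euclidean_space"
  shows "AE x in lebesgue. P x \<Longrightarrow> AE x in lebesgue. P (x + h)"
  using AE_lebesgue_affine[of 1 P h] by (simp add: add.commute)

lemma integral_lebesgue_shift:
  fixes h :: "'a::euclidean_space" and f :: "'a \<Rightarrow> 'b::{banach, second_countable_topology}"
  assumes "f \<in> borel_measurable lebesgue"
  shows "(LINT x|lebesgue. f (x + h)) = (LINT x|lebesgue. f x)"
  using integral_lebesgue_affine[of 1 f h, OF _ assms] by (simp add: add.commute)

lemma
  fixes h :: "'a::euclidean_space" and f :: "'a \<Rightarrow> 'b::euclidean_space"
  assumes "f \<in> L2 lebesgue"
  shows L2_shift: "(\<lambda>x. f (x + h)) \<in> L2 lebesgue"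
    and norm_L2_shift: "norm_L2 lebesgue (\<lambda>x. f (x + h)) = norm_L2 lebesgue f"
proof -
  have "integrable lebesgue (\<lambda>x. (norm (f (h + 1 *\<^sub>R x)))\<^sup>2)"
    by (rule integrable_lebesgue_affine[OF _ L2_integrable[OF assms]]) simp
  then show "(\<lambda>x. f (x + h)) \<in> L2 lebesgue"
    using L2_measurable[OF assms] by (simp add: L2_def borel_measurable_lebesgue_shift add.commute)
  show "norm_L2 lebesgue (\<lambda>x. f (x + h)) = norm_L2 lebesgue f"
    unfolding norm_L2_def using L2_measurable[OF assms]
    by (subst integral_lebesgue_shift[of "\<lambda>x. (norm (f x))\<^sup>2" h, symmetric]) auto
qed

lemma
  fixes f :: "'a::euclidean_space \<Rightarrow> 'b::euclidean_space"
  assumes "f \<in> L2 lebesgue"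
  shows L2_reflect: "(\<lambda>x. f (- x)) \<in> L2 lebesgue"
    and norm_L2_reflect: "norm_L2 lebesgue (\<lambda>x. f (- x)) = norm_L2 lebesgue f"
proof -
  have "integrable lebesgue (\<lambda>x. (norm (f (0 + (- 1) *\<^sub>R x)))\<^sup>2)"
    by (rule integrable_lebesgue_affine[OF _ L2_integrable[OF assms]]) simp
  then show "(\<lambda>x. f (- x)) \<in> L2 lebesgue"
    using L2_measurable[OF assms] borel_measurable_lebesgue_affine[of "-1" f 0]
    by (simp add: L2_def)
  show "norm_L2 lebesgue (\<lambda>x. f (- x)) = norm_L2 lebesgue f"
    unfolding norm_L2_def using L2_measurable[OF assms]
    by (subst integral_lebesgue_affine[of "-1" "\<lambda>x. (norm (f x))\<^sup>2" 0]) auto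
qed

lemma AE_lebesgue_reflect:
  "AE x in lebesgue. P x \<Longrightarrow> AE x in lebesgue. P (- x::'a::euclidean_space)"
  using AE_lebesgue_affine[of "-1" P 0] by simp

lemma bounded_emeasure_lebesgue: "bounded S \<Longrightarrow> emeasure lebesgue (S::'a::euclidean_space set) < \<infinity>"
proof -
  assume "bounded S"
  then obtain r where "S \<subseteq> cball 0 r" by (auto simp: bounded_iff subset_iff)
  then have "emeasure lebesgue S \<le> emeasure lebesgue (cball (0::'a) r)" by (intro emeasure_mono) auto
  also have "\<dots> < \<infinity>" using emeasure_bounded_finite[of "cball (0::'a) r"] by simp
  finally show ?thesis .
qed

lemma L2_indicator: "S \<in> sets lebesgue \<Longrightarrow> bounded S \<Longrightarrow> indicat_real S \<in> L2 (lebesgue::'a::euclidean_space measure)"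
proof -
  assume S: "S \<in> sets lebesgue" "bounded S"
  have "(\<lambda>x. (norm (indicat_real S x))\<^sup>2) = indicat_real S" by (auto simp: indicator_def)
  then show ?thesis using S bounded_emeasure_lebesgue[OF S(2)] by (auto simp: L2_def)
qed

lemma L2_bounded_support:
  fixes f :: "'a::euclidean_space \<Rightarrow> 'b::euclidean_space"
  assumes "f \<in> borel_measurable lebesgue" "S \<in> sets lebesgue" "bounded S" "0 \<le> C"
    and "AE x in lebesgue. norm (f x) \<le> C * indicat_real S x"
  shows "f \<in> L2 lebesgue" "norm_L2 lebesgue f \<le> C * norm_L2 lebesgue (indicat_real S)"
  by (rule L2_dominate[OF L2_indicator[OF assms(2,3)] assms(1,4)], use assms(5) in simp)+

text \<open>The radial truncation \<open>z / max 1 (|z| / m)\<close> makes a pointwise a.e. approximation by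
  continuous functions bounded.\<close>

lemma L2_approx_continuous:
  fixes f :: "'a::euclidean_space \<Rightarrow> 'b::euclidean_space"
  assumes f: "f \<in> L2 lebesgue" and e: "0 < e"
  shows "\<exists>g R. continuous_on UNIV g \<and> (\<forall>x. R < norm x \<longrightarrow> g x = 0) \<and> g \<in> L2 lebesgue \<and> norm_L2 lebesgue (\<lambda>x. f x - g x) < e"
proof -
  have [measurable]: "f \<in> borel_measurable lebesgue" using f by (simp add: L2_def)
  have "f measurable_on UNIV" by (rule lebesgue_measurable_imp_measurable_on) auto
  then obtain N g where N: "negligible N" and gc: "\<And>n. continuous_on UNIV (g n)"
    and gl: "\<And>x. x \<notin> N \<Longrightarrow> (\<lambda>n. g n x) \<longlonglongrightarrow> f x"
    unfolding measurable_on_def by auto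
  have AEN: "AE x in lebesgue. x \<notin> N" using N by (simp add: AE_not_in negligible_iff_null_sets)
  define tr where "tr = (\<lambda>(m::real) (z::'b). (1 / max 1 (norm z / m)) *\<^sub>R z)"
  \<comment> \<open>A continuous cutoff in space: 1 up to radius \<open>m\<close>, 0 beyond
    \<open>m + 1\<close>.\<close>
  define et where "et = (\<lambda>(m::real) (x::'a). max 0 (min 1 (m + 1 - norm x)))"
  have trc: "continuous_on UNIV (tr m)" for m unfolding tr_def divide_inverse
    by (intro continuous_intros) auto
  have etc: "continuous_on UNIV (et m)" for m unfolding et_def by (intro continuous_intros)
  have tr1: "norm (tr m z) \<le> norm z" for m z
  proof -
    have "norm (tr m z) = norm z / max 1 (norm z / m)" by (simp add: tr_def)
    also have "\<dots> \<le> norm z / 1" by (intro divide_left_mono) auto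
    finally show ?thesis by simp
  qed
  have tr2: "norm (tr m z) \<le> m" if "m \<ge> 1" for m z
    using that unfolding tr_def by (auto simp: divide_simps max_def)
  have et01: "0 \<le> et m x" "et m x \<le> 1" for m x by (auto simp: et_def)
  have et0: "et m x = 0" if "norm x > m + 1" for m x using that by (auto simp: et_def)
  have norm_le: "norm (et m x *\<^sub>R tr m z) \<le> norm z" for m x z
    using mult_mono[OF et01(2)[of m x] tr1[of m z]] et01[of m x] by simp
  have norm_le2: "norm (et m x *\<^sub>R tr m z) \<le> m * indicat_real (cball 0 (m+1)) x" if "m \<ge> 1" for m x z
    using mult_mono[OF et01(2)[of m x] tr2[OF that, of z]] et01[of m x] et0[of m x] that
    by (auto simp: indicator_def)
  have meas: "(\<lambda>x. et m x *\<^sub>R tr m (k x)) \<in> borel_measurable lebesgue" if [measurable]: "k \<in> borel_measurable lebesgue" for m k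
  proof -
    have [measurable]: "tr m \<in> borel_measurable borel" "et m \<in> borel_measurable borel"
      using trc etc by (auto intro: borel_measurable_continuous_onI)
    have [measurable]: "et m \<in> borel_measurable lebesgue" by (intro measurable_completion) simp
    show ?thesis by measurable
  qed
  have gm: "g n \<in> borel_measurable lebesgue" for n
    using borel_measurable_continuous_onI[OF gc[of n]] by (intro measurable_completion) simp
  \<comment> \<open>First error: \<open>f\<close> itself is cut in value and in space. This fixes
    the level \<open>m\<close>.\<close>
  have "(\<lambda>k. norm_L2 lebesgue (\<lambda>x. et (real (Suc k)) x *\<^sub>R tr (real (Suc k)) (f x) - f x)) \<longlonglongrightarrow> 0"
  proof (rule L2_dominated_convergence(2)[OF _ _ f])
    show "AE x in lebesgue. (\<lambda>k. et (real (Suc k)) x *\<^sub>R tr (real (Suc k)) (f x)) \<longlonglongrightarrow> f x"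
    proof (rule AE_I2, rule tendsto_eventually)
      fix x
      have "\<forall>\<^sub>F k in sequentially. real k \<ge> norm x + norm (f x)"
        using filterlim_real_sequentially by (simp add: filterlim_at_top)
      then show "\<forall>\<^sub>F k in sequentially. et (real (Suc k)) x *\<^sub>R tr (real (Suc k)) (f x) = f x"
      proof eventually_elim
        case (elim k)
        have a: "norm x \<le> real (Suc k)" "norm (f x) \<le> real (Suc k)"
          using elim norm_ge_zero[of x] norm_ge_zero[of "f x"] unfolding of_nat_Suc by linarith+
        then have "et (real (Suc k)) x = 1" by (auto simp: et_def)
        moreover have "norm (f x) / real (Suc k) \<le> 1" using a by (auto simp: divide_simps)
        then have "tr (real (Suc k)) (f x) = f x" by (simp add: tr_def max_def)
        ultimately show ?case by simp
      qed
    qed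
  qed (use norm_le meas in auto)
  from LIMSEQ_D[OF this, of "e/2"] obtain k where "norm_L2 lebesgue (\<lambda>x. et (real (Suc k)) x *\<^sub>R tr (real (Suc k)) (f x) - f x) < e/2"
    using e by fastforce
  moreover define m where "m = real (Suc k)"
  ultimately have k: "norm_L2 lebesgue (\<lambda>x. et m x *\<^sub>R tr m (f x) - f x) < e/2" by simp
  have m: "m \<ge> 1" by (simp add: m_def)
  have hL: "(\<lambda>x. m * indicat_real (cball 0 (m+1)) (x::'a)) \<in> L2 lebesgue"
    by (intro L2_cmult L2_indicator) auto
  have le': "AE x in lebesgue. norm (et m x *\<^sub>R tr m (q x)) \<le> norm (m * indicat_real (cball 0 (m+1)) x)" for q
    using norm_le2[OF m] m by auto
  have L: "(\<lambda>x. et m x *\<^sub>R tr m (q x)) \<in> L2 lebesgue" if "q \<in> borel_measurable lebesgue" for q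
    by (rule L2_dominate(1)[OF hL meas[OF that], of 1]) (use le' in auto)
  \<comment> \<open>Second error, at fixed \<open>m\<close>: the continuous \<open>g n\<close>
    replace \<open>f\<close> inside the cut. The cut supplies a common majorant, although nothing
    bounds the \<open>g n\<close> themselves.\<close>
  have "(\<lambda>n. norm_L2 lebesgue (\<lambda>x. et m x *\<^sub>R tr m (g n x) - et m x *\<^sub>R tr m (f x))) \<longlonglongrightarrow> 0"
  proof (rule L2_dominated_convergence(2)[OF _ _ hL])
    show "AE x in lebesgue. (\<lambda>n. et m x *\<^sub>R tr m (g n x)) \<longlonglongrightarrow> et m x *\<^sub>R tr m (f x)"
      using AEN
    proof eventually_elim
      case (elim x)
      have "(\<lambda>n. tr m (g n x)) \<longlonglongrightarrow> tr m (f x)"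
        using trc[of m] gl[OF elim] by (metis UNIV_I continuous_on_eq_continuous_at isCont_tendsto_compose open_UNIV)
      then show ?case by (intro tendsto_intros)
    qed
  qed (use meas gm le' in auto)
  from LIMSEQ_D[OF this, of "e/2"] obtain n where n: "norm_L2 lebesgue (\<lambda>x. et m x *\<^sub>R tr m (g n x) - et m x *\<^sub>R tr m (f x)) < e/2"
    using e by fastforce
  let ?g = "\<lambda>x. et m x *\<^sub>R tr m (g n x)"
  have "norm_L2 lebesgue (\<lambda>x. ?g x - f x) < e"
    using norm_L2_triangle_diff[OF L[OF gm[of n]] L[of f] f] n k by simp
  moreover have "continuous_on UNIV ?g"
    by (intro continuous_on_scaleR etc continuous_on_compose2[OF trc gc]) auto
  ultimately show ?thesis
    using L[OF gm] et0 by (intro exI[of _ ?g] exI[of _ "m+1"]) (auto simp: norm_L2_minus_commute[of _ f])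
qed

text \<open>Translates of a continuous function of bounded support converge by uniform continuity;
  density and the isometry of translation carry this to all of L2 by an e/3 argument.\<close>

lemma L2_shift_continuous:
  fixes f :: "'a::euclidean_space \<Rightarrow> 'b::euclidean_space"
  assumes f: "f \<in> L2 lebesgue" and e: "0 < e"
  shows "\<exists>d>0. \<forall>h. norm h < d \<longrightarrow> norm_L2 lebesgue (\<lambda>x. f (x + h) - f x) < e"
proof -
  obtain g R where g: "continuous_on UNIV g" "\<And>x. R < norm x \<Longrightarrow> g x = 0" "g \<in> L2 lebesgue"
    and fg: "norm_L2 lebesgue (\<lambda>x. f x - g x) < e/3"
    using L2_approx_continuous[OF f, of "e/3"] e by auto
  \<comment> \<open>Shifts have length below 1 and matter only at points within
    \<open>R + 1\<close>, so both points compared stay within \<open>R + 2\<close>.\<close>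
  have "uniformly_continuous_on (cball 0 (R+2)) g"
    using g(1) continuous_on_subset by (intro compact_uniformly_continuous) auto
  define K where "K = norm_L2 lebesgue (indicat_real (cball (0::'a) (R+1)))"
  \<comment> \<open>The modulus is chosen so that \<open>w * K\<close> is below \<open>e/3\<close>;
    the summand 1 keeps the denominator positive should \<open>K\<close> vanish.\<close>
  define w where "w = e / (3 * (K + 1))"
  have K: "0 \<le> K" by (simp add: K_def)
  have w: "0 < w" using e K by (simp add: w_def)
  have wK: "w * K < e/3"
  proof -
    have "w * K < w * (K+1)" using w by simp
    also have "\<dots> = e/3" using K by (simp add: w_def field_simps)
    finally show ?thesis .
  qed
  obtain d where d: "0 < d" "\<And>x y. x \<in> cball 0 (R+2) \<Longrightarrow> y \<in> cball 0 (R+2) \<Longrightarrow> dist y x < d \<Longrightarrow> dist (g y) (g x) < w"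
    using \<open>uniformly_continuous_on (cball 0 (R+2)) g\<close> w unfolding uniformly_continuous_on_def by metis
  show ?thesis
  proof (intro exI[of _ "min d 1"] conjI allI impI)
    fix h :: 'a assume h: "norm h < min d 1"
    have ptw: "norm (g (x + h) - g x) \<le> w * indicat_real (cball 0 (R+1)) x" for x
    proof (cases "norm x \<le> R + 1")
      case True
      have "norm (x + h) \<le> norm x + norm h" by (rule norm_triangle_ineq)
      then have "x + h \<in> cball 0 (R+2)" "x \<in> cball 0 (R+2)" "dist (x + h) x < d"
        using True h by (simp_all add: dist_norm[of "x+h" x])
      then have "dist (g (x + h)) (g x) < w" by (intro d)
      then show ?thesis using True by (simp add: dist_norm)
    next
      case False
      have "norm x \<le> norm (x + h) + norm h" using norm_triangle_ineq4[of "x+h" h] by simp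
      then have "norm (x + h) > R" using False h by simp
      then show ?thesis using g(2)[of x] g(2)[of "x+h"] False by simp
    qed
    have "norm_L2 lebesgue (\<lambda>x. g (x + h) - g x) \<le> w * K"
      unfolding K_def using g(3) w ptw
      by (intro L2_bounded_support(2) L2_measurable[OF L2_diff] L2_shift) auto
    moreover have "norm_L2 lebesgue (\<lambda>x. f (x + h) - g (x + h)) < e/3"
      using fg norm_L2_shift[OF L2_diff[OF f g(3)], of h] by simp
    moreover have "norm_L2 lebesgue (\<lambda>x. f (x + h) - f x) \<le> norm_L2 lebesgue (\<lambda>x. f (x + h) - g (x + h))
        + (norm_L2 lebesgue (\<lambda>x. g (x + h) - g x) + norm_L2 lebesgue (\<lambda>x. g x - f x))"
      using norm_L2_triangle_diff[OF L2_shift[OF f] L2_shift[OF g(3)] f, of h h]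
        norm_L2_triangle_diff[OF L2_shift[OF g(3)] g(3) f, of h] by linarith
    ultimately show "norm_L2 lebesgue (\<lambda>x. f (x + h) - f x) < e"
      using wK fg by (simp add: norm_L2_minus_commute[of _ g f])
  qed (use d in auto)
qed

subsection \<open>Fourier integrals\<close>

text \<open>The normalisation inside \<open>fourier_integral\<close>. It depends on the dimension
  alone and is therefore indexed by the type of coordinates.\<close>

definition ft_const :: "'n::finite itself \<Rightarrow> real" where
  "ft_const _ = (2 * pi) powr (- real CARD('n) / 2)"

lemma ft_const_pos [simp]: "0 < ft_const TYPE('n::finite)"
  by (simp add: ft_const_def)

lemma fourier_integral_eq:
  "fourier_integral f \<xi> = complex_of_real (ft_const TYPE('n)) * (LINT x|lebesgue. cis (- (x \<bullet> \<xi>)) * f x)"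
  for f :: "real^'n \<Rightarrow> complex"
  by (simp add: fourier_integral_def ft_const_def)

lemma continuous_lebesgue_measurable: "continuous_on UNIV f \<Longrightarrow> f \<in> borel_measurable lebesgue"
  by (intro measurable_completion) (simp add: borel_measurable_continuous_onI)

lemma cis_inner_measurable [measurable]:
  "(\<lambda>x. cis (- (x \<bullet> \<xi>))) \<in> borel_measurable borel"
  "(\<lambda>x. cis (x \<bullet> \<xi>)) \<in> borel_measurable borel"
  "(\<lambda>x. cis (- (x \<bullet> \<xi>))) \<in> borel_measurable lebesgue"
  "(\<lambda>x. cis (x \<bullet> \<xi>)) \<in> borel_measurable lebesgue"
  by (auto intro!: borel_measurable_continuous_onI continuous_lebesgue_measurable continuous_intros)

lemma integrable_cis_mult:
  assumes "integrable lebesgue f"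
  shows "integrable lebesgue (\<lambda>x. cis (- (x \<bullet> \<xi>)) * f x :: complex)"
  by (rule Bochner_Integration.integrable_bound[OF assms]) (use assms in \<open>auto simp: norm_mult\<close>)

lemma fourier_integral_cong_AE:
  assumes "f \<in> borel_measurable lebesgue" "g \<in> borel_measurable lebesgue" "AE x in lebesgue. f x = g x"
  shows "fourier_integral f = fourier_integral g"
  unfolding fourier_integral_eq[abs_def] using assms
  by (intro ext arg_cong2[where f="(*)"] integral_cong_AE) auto

text \<open>Fubini's theorem is applied on the product of two copies of \<open>lborel\<close>, which
  knows only Borel measurability; Lebesgue measurable functions are first replaced by Borel
  ones.\<close>

lemma borel_representative:
  fixes f :: "'a::euclidean_space \<Rightarrow> complex"
  assumes "f \<in> borel_measurable lebesgue"
  shows "\<exists>g \<in> borel_measurable borel. AE x in lebesgue. f x = g x"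
proof -
  have "(\<lambda>x. Re (f x)) \<in> borel_measurable lebesgue" "(\<lambda>x. Im (f x)) \<in> borel_measurable lebesgue"
    using assms by measurable
  then obtain a b where ab: "a \<in> borel_measurable lborel" "AE x in lborel. Re (f x) = a x"
     "b \<in> borel_measurable lborel" "AE x in lborel. Im (f x) = b x"
    using completion_ex_borel_measurable_real by metis
  have "AE x in lborel. f x = Complex (a x) (b x)"
    using ab(2,4) by eventually_elim (auto simp: complex_eq_iff)
  moreover have "(\<lambda>x. Complex (a x) (b x)) \<in> borel_measurable borel"
    using ab(1,3) unfolding Complex_eq by simp
  ultimately show ?thesis
    by (intro bexI[of _ "\<lambda>x. Complex (a x) (b x)"] AE_completion)
qed

lemma norm_fourier_integral_le:
  fixes f :: "real^'n \<Rightarrow> complex"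
  shows "norm (fourier_integral f \<xi>) \<le> ft_const TYPE('n) * (LINT x|lebesgue. norm (f x))"
proof -
  have "norm (LINT x|lebesgue. cis (- (x \<bullet> \<xi>)) * f x) \<le> (LINT x|lebesgue. norm (cis (- (x \<bullet> \<xi>)) * f x))"
    by (rule integral_norm_bound)
  then have "norm (LINT x|lebesgue. cis (- (x \<bullet> \<xi>)) * f x) \<le> (LINT x|lebesgue. norm (f x))"
    by (simp add: norm_mult)
  then show ?thesis
    unfolding fourier_integral_eq norm_mult by (simp add: mult_left_mono less_imp_le)
qed

lemma continuous_fourier_integral:
  fixes f :: "real^'n \<Rightarrow> complex"
  assumes f: "integrable lebesgue f"
  shows "continuous_on UNIV (fourier_integral f)"
proof -
  have "isCont (fourier_integral f) \<xi>" for \<xi>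
  proof -
    have "(\<lambda>k. LINT x|lebesgue. cis (- (x \<bullet> X k)) * f x) \<longlonglongrightarrow> (LINT x|lebesgue. cis (- (x \<bullet> \<xi>)) * f x)"
      if X: "X \<longlonglongrightarrow> \<xi>" for X
    proof (rule integral_dominated_convergence[where w="\<lambda>x. norm (f x)"])
      show "AE x in lebesgue. (\<lambda>k. cis (- (x \<bullet> X k)) * f x) \<longlonglongrightarrow> cis (- (x \<bullet> \<xi>)) * f x"
        by (intro AE_I2 tendsto_intros X)
    qed (use f in \<open>auto simp: norm_mult\<close>)
    then show ?thesis
      unfolding fourier_integral_eq[abs_def] continuous_at_sequentially comp_def
      by (auto intro!: tendsto_intros)
  qed
  then show ?thesis by (simp add: continuous_on_eq_continuous_at)
qed

lemma fourier_integral_measurable: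
  "integrable lebesgue f \<Longrightarrow> fourier_integral f \<in> borel_measurable lebesgue"
  by (intro continuous_lebesgue_measurable continuous_fourier_integral)

text \<open>The kernel \<open>cis (- (x \<bullet> y))\<close> is symmetric in its arguments, so
  Fubini's theorem moves the transform from one factor to the other.\<close>

lemma fourier_integral_mult_formula:
  fixes f g :: "real^'n \<Rightarrow> complex"
  assumes f: "integrable lebesgue f" and g: "integrable lebesgue g"
  shows "(LINT x|lebesgue. fourier_integral f x * g x) = (LINT x|lebesgue. f x * fourier_integral g x)"
proof -
  obtain f' where f'[measurable]: "f' \<in> borel_measurable borel" and ff: "AE x in lebesgue. f x = f' x"
    using borel_representative[of f] f by auto
  obtain g' where g'[measurable]: "g' \<in> borel_measurable borel" and gg: "AE x in lebesgue. g x = g' x"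
    using borel_representative[of g] g by auto
  have [measurable]: "f' \<in> borel_measurable lebesgue" "g' \<in> borel_measurable lebesgue"
    by (auto intro: measurable_completion)
  have [measurable]: "f \<in> borel_measurable lebesgue" "g \<in> borel_measurable lebesgue"
    using f g by auto
  have f'i: "integrable lborel f'"
    using f integrable_cong_AE[of f lebesgue f'] ff integrable_completion[of f' lborel] by simp
  have g'i: "integrable lborel g'"
    using g integrable_cong_AE[of g lebesgue g'] gg integrable_completion[of g' lborel] by simp
  define P where "P = (\<lambda>(x::real^'n) y. f' x * g' y * cis (- (x \<bullet> y)))"
  have [measurable]: "(\<lambda>p::(real^'n) \<times> (real^'n). cis (- (fst p \<bullet> snd p))) \<in> borel_measurable borel"
    by (intro borel_measurable_continuous_onI continuous_intros)
  have [measurable]: "(\<lambda>(x, y). P x y) \<in> borel_measurable (lborel \<Otimes>\<^sub>M lborel)"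
  proof -
    have "(\<lambda>p. f' (fst p) * g' (snd p) * cis (- (fst p \<bullet> snd p))) \<in> borel_measurable (borel \<Otimes>\<^sub>M borel)"
      by (intro borel_measurable_times) (measurable, simp add: borel_prod)
    then show ?thesis unfolding P_def by (simp add: case_prod_beta' cong: measurable_cong_sets)
  qed
  have int: "integrable (lborel \<Otimes>\<^sub>M lborel) (\<lambda>(x, y). P x y)"
  proof (rule lborel_pair.Fubini_integrable)
    show "integrable lborel (\<lambda>x. LINT y|lborel. norm (case (x, y) of (x, y) \<Rightarrow> P x y))"
      using f'i by (simp add: P_def norm_mult)
    show "AE x in lborel. integrable lborel (\<lambda>y. case (x, y) of (x, y) \<Rightarrow> P x y)"
    proof (rule AE_I2)
      fix x
      show "integrable lborel (\<lambda>y. case (x, y) of (x, y) \<Rightarrow> P x y)"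
        unfolding prod.case
      proof (rule Bochner_Integration.integrable_bound[of lborel "\<lambda>y. norm (f' x) * norm (g' y)"])
        show "(\<lambda>y. P x y) \<in> borel_measurable lborel"
          unfolding P_def inner_commute[of x] by measurable
      qed (use g'i in \<open>auto simp: P_def norm_mult\<close>)
    qed
  qed simp
  have 1: "fourier_integral f = fourier_integral f'" "fourier_integral g = fourier_integral g'"
    by (auto intro!: fourier_integral_cong_AE ff gg)
  have i1: "integrable lebesgue f'" "integrable lebesgue g'" using f'i g'i by (auto simp: integrable_completion)
  have e1: "(LINT x|lborel. cis (- (x \<bullet> y)) * f' x) * g' y = (LINT x|lborel. P x y)" for y
  proof -
    have "(LINT x|lborel. P x y) = (LINT x|lborel. (cis (- (x \<bullet> y)) * f' x) * g' y)"
      unfolding P_def by (intro Bochner_Integration.integral_cong refl) (simp only: mult_ac)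
    then show ?thesis by (simp only: integral_mult_left_zero)
  qed
  have e2: "f' x * (LINT y|lborel. cis (- (y \<bullet> x)) * g' y) = (LINT y|lborel. P x y)" for x
  proof -
    have "(LINT y|lborel. P x y) = (LINT y|lborel. f' x * (cis (- (y \<bullet> x)) * g' y))"
      unfolding P_def by (intro Bochner_Integration.integral_cong refl) (simp only: mult_ac inner_commute[of x])
    then show ?thesis by (simp only: integral_mult_right_zero)
  qed
  let ?c = "complex_of_real (ft_const TYPE('n))"
  have "(LINT x|lebesgue. fourier_integral f x * g x) = (LINT x|lebesgue. fourier_integral f' x * g' x)"
    unfolding 1 using gg fourier_integral_measurable[OF i1(1)] by (intro integral_cong_AE) auto
  also have "\<dots> = (LINT y|lborel. fourier_integral f' y * g' y)"
    using borel_measurable_continuous_onI[OF continuous_fourier_integral[OF i1(1)]]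
    by (intro integral_completion) simp
  also have "\<dots> = (LINT y|lborel. ?c * (LINT x|lborel. P x y))"
    by (simp add: fourier_integral_eq integral_completion e1 mult.assoc)
  also have "\<dots> = (LINT x|lborel. ?c * (LINT y|lborel. P x y))"
    using lborel_pair.Fubini_integral[OF int] by simp
  also have "\<dots> = (LINT y|lborel. f' y * fourier_integral g' y)"
    by (simp add: fourier_integral_eq integral_completion e2[symmetric] mult.left_commute)
  also have "\<dots> = (LINT x|lebesgue. f' x * fourier_integral g' x)"
    using borel_measurable_continuous_onI[OF continuous_fourier_integral[OF i1(2)]]
    by (intro integral_completion[symmetric]) simp
  also have "\<dots> = (LINT x|lebesgue. f x * fourier_integral g x)"
    unfolding 1 using ff fourier_integral_measurable[OF i1(2)] by (intro integral_cong_AE) auto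
  finally show ?thesis .
qed

text \<open>Substituting \<open>y + z\<close> splits the phase, with the opposite sign falling on
  \<open>g\<close>. With \<open>g\<close> the conjugate of \<open>f\<close> this is the
  autocorrelation behind Plancherel; with a mollifier it turns smoothing into a Fourier
  multiplier.\<close>

lemma fourier_integral_correlation:
  fixes f g :: "real^'n \<Rightarrow> complex"
  assumes [measurable]: "f \<in> borel_measurable borel" "g \<in> borel_measurable borel"
    and f: "integrable lborel f" and g: "integrable lborel g"
  defines "h \<equiv> \<lambda>z. LINT y|lborel. f (y + z) * g y"
  shows "h \<in> borel_measurable borel" "integrable lborel h"
    "fourier_integral h \<xi> = fourier_integral f \<xi> * (LINT y|lborel. cis (y \<bullet> \<xi>) * g y)"
proof -
  define P where "P = (\<lambda>\<xi> (y::real^'n) z. cis (- (z \<bullet> \<xi>)) * (f (y + z) * g y))"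
  have m1: "(\<lambda>p. f (fst p + snd p) * g (fst p)) \<in> borel_measurable (borel \<Otimes>\<^sub>M borel)"
    by measurable
  have m2: "(\<lambda>p. cis (- (snd p \<bullet> \<xi>)) * (f (fst p + snd p) * g (fst p))) \<in> borel_measurable (borel \<Otimes>\<^sub>M borel)" for \<xi>
    by measurable
  have mP[measurable]: "(\<lambda>(y, z). P \<xi> y z) \<in> borel_measurable (lborel \<Otimes>\<^sub>M lborel)" for \<xi>
    using m2[of \<xi>] unfolding P_def by (simp add: case_prod_beta' cong: measurable_cong_sets)
  have shift: "integrable lborel (\<lambda>z. f (y + z))" "(LINT z|lborel. norm (f (y + z))) = (LINT z|lborel. norm (f z))"
    "(LINT z|lborel. cis (- ((y + z) \<bullet> \<xi>)) * f (y + z)) = (LINT z|lborel. cis (- (z \<bullet> \<xi>)) * f z)" for y \<xi>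
  proof -
    have l: "f \<in> borel_measurable lebesgue" "integrable lebesgue f"
      using f by (auto intro: measurable_completion simp: integrable_completion)
    have m: "(\<lambda>z. f (y + z)) \<in> borel_measurable borel" by measurable
    show "integrable lborel (\<lambda>z. f (y + z))"
      using integrable_lebesgue_affine[of 1 f y, OF _ l(2)] integrable_completion[of "\<lambda>z. f (y + z)" lborel] m by simp
    have "(LINT z|lebesgue. norm (f (y + z))) = (LINT z|lebesgue. norm (f z))"
      using integral_lebesgue_shift[of "\<lambda>z. norm (f z)" y] l by (simp add: add.commute)
    then show "(LINT z|lborel. norm (f (y + z))) = (LINT z|lborel. norm (f z))"
      by (simp add: integral_completion)
    have "(LINT z|lebesgue. cis (- ((y + z) \<bullet> \<xi>)) * f (y + z)) = (LINT z|lebesgue. cis (- (z \<bullet> \<xi>)) * f z)"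
      using integral_lebesgue_shift[of "\<lambda>z. cis (- (z \<bullet> \<xi>)) * f z" y] l by (simp add: add.commute)
    moreover have "(\<lambda>z. cis (- ((y + z) \<bullet> \<xi>)) * f (y + z)) \<in> borel_measurable borel"
      by (rule measurable_compose[of "\<lambda>z. y + z" _ borel "\<lambda>z. cis (- (z \<bullet> \<xi>)) * f z"]) measurable
    ultimately show "(LINT z|lborel. cis (- ((y + z) \<bullet> \<xi>)) * f (y + z)) = (LINT z|lborel. cis (- (z \<bullet> \<xi>)) * f z)"
      by (simp add: integral_completion)
  qed
  have int: "integrable (lborel \<Otimes>\<^sub>M lborel) (\<lambda>(y, z). P \<xi> y z)" for \<xi>
  proof (rule lborel_pair.Fubini_integrable)
    show "integrable lborel (\<lambda>y. LINT z|lborel. norm (case (y, z) of (y, z) \<Rightarrow> P \<xi> y z))"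
      using g by (simp add: P_def norm_mult shift(2))
    show "AE y in lborel. integrable lborel (\<lambda>z. case (y, z) of (y, z) \<Rightarrow> P \<xi> y z)"
    proof (rule AE_I2)
      fix y
      have "(\<lambda>z. P \<xi> y z) \<in> borel_measurable borel" unfolding P_def by measurable
      then have m: "(\<lambda>z. P \<xi> y z) \<in> borel_measurable lborel" by simp
      have i: "integrable lborel (\<lambda>z. norm (f (y + z)) * norm (g y))"
        by (intro integrable_mult_left integrable_norm shift(1))
      have "integrable lborel (\<lambda>z. P \<xi> y z)"
        by (rule Bochner_Integration.integrable_bound[OF i m]) (simp add: P_def norm_mult)
      then show "integrable lborel (\<lambda>z. case (y, z) of (y, z) \<Rightarrow> P \<xi> y z)"
        unfolding prod.case .
    qed
  qed simp
  \<comment> \<open>At frequency 0 the phase is 1, so the joint integrability of \<open>P\<close>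
    contains that of the correlation itself.\<close>
  have P0: "P 0 y z = f (y + z) * g y" for y z by (simp add: P_def)
  have sw: "integrable (lborel \<Otimes>\<^sub>M lborel) (\<lambda>(z, y). P 0 y z)"
    using lborel_pair.integrable_product_swap[OF int[of 0]] by (simp only: prod.case)
  have "integrable lborel (\<lambda>z. LINT y|lborel. (case (z, y) of (z, y) \<Rightarrow> P 0 y z))"
    by (rule lborel_pair.integrable_fst'[OF sw])
  then show hi: "integrable lborel h" by (simp add: P0 h_def)
  then show hm: "h \<in> borel_measurable borel" by auto
  have "(LINT z|lborel. cis (- (z \<bullet> \<xi>)) * h z) = (LINT z|lborel. LINT y|lborel. P \<xi> y z)"
    by (simp add: P_def h_def)
  also have "\<dots> = (LINT y|lborel. LINT z|lborel. P \<xi> y z)"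
    using lborel_pair.Fubini_integral[OF int[of \<xi>]] by simp
  also have "\<dots> = (LINT y|lborel. (LINT z|lborel. cis (- (z \<bullet> \<xi>)) * f z) * (cis (y \<bullet> \<xi>) * g y))"
  proof (intro Bochner_Integration.integral_cong refl)
    fix y
    have "P \<xi> y z = (cis (- ((y + z) \<bullet> \<xi>)) * f (y + z)) * (cis (y \<bullet> \<xi>) * g y)" for z
    proof -
      have "cis (- (z \<bullet> \<xi>)) = cis (- ((y + z) \<bullet> \<xi>)) * cis (y \<bullet> \<xi>)"
        by (simp add: cis_mult inner_add_left)
      then show ?thesis by (simp add: P_def)
    qed
    then have "(LINT z|lborel. P \<xi> y z) = (LINT z|lborel. (cis (- ((y + z) \<bullet> \<xi>)) * f (y + z)) * (cis (y \<bullet> \<xi>) * g y))"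
      by simp
    also have "\<dots> = (LINT z|lborel. cis (- ((y + z) \<bullet> \<xi>)) * f (y + z)) * (cis (y \<bullet> \<xi>) * g y)"
      by (rule integral_mult_left_zero)
    finally show "(LINT z|lborel. P \<xi> y z) = (LINT z|lborel. cis (- (z \<bullet> \<xi>)) * f z) * (cis (y \<bullet> \<xi>) * g y)"
      by (simp only: shift(3))
  qed
  also have "\<dots> = (LINT z|lborel. cis (- (z \<bullet> \<xi>)) * f z) * (LINT y|lborel. cis (y \<bullet> \<xi>) * g y)"
    by (rule integral_mult_right_zero)
  finally show "fourier_integral h \<xi> = fourier_integral f \<xi> * (LINT y|lborel. cis (y \<bullet> \<xi>) * g y)"
    using hm by (simp add: fourier_integral_eq integral_completion)
qed

subsection \<open>Gaussians and the Plancherel identity\<close>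

lemma cnj_measurable [measurable]: "cnj \<in> borel_measurable borel"
  by (intro borel_measurable_continuous_onI continuous_intros)

text \<open>\<open>lborel\<close> on a Euclidean space is the image of a product of one-dimensional
  measures under the map that assembles coordinates; the product formulas are transported along
  it.\<close>

lemma
  fixes f :: "'a::euclidean_space \<Rightarrow> real \<Rightarrow> complex"
  assumes f: "\<And>b. b \<in> Basis \<Longrightarrow> integrable lborel (f b)"
  shows integrable_lborel_prod: "integrable lborel (\<lambda>x. \<Prod>b\<in>Basis. f b (x \<bullet> b))"
    and integral_lborel_prod: "(LINT x|lborel. (\<Prod>b\<in>Basis. f b (x \<bullet> b))) = (\<Prod>b\<in>Basis. (LINT t|lborel. f b t))"
proof -
  interpret product_sigma_finite "\<lambda>_::'a. lborel :: real measure" ..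
  define S where "S = (\<lambda>g::'a \<Rightarrow> real. \<Sum>b\<in>Basis. g b *\<^sub>R b)"
  have S: "S \<in> (\<Pi>\<^sub>M b\<in>(Basis::'a set). lborel) \<rightarrow>\<^sub>M borel" unfolding S_def by measurable
  have m: "(\<lambda>x. \<Prod>b\<in>Basis. f b (x \<bullet> b)) \<in> borel_measurable borel"
  proof (intro borel_measurable_prod)
    fix b :: 'a assume "b \<in> Basis"
    then have [measurable]: "f b \<in> borel_measurable borel" using f by auto
    show "(\<lambda>x. f b (x \<bullet> b)) \<in> borel_measurable borel" by measurable
  qed
  have eq: "(\<Prod>b\<in>Basis. f b (S g \<bullet> b)) = (\<Prod>b\<in>Basis. f b (g b))" for g
    by (intro prod.cong refl) (simp add: S_def)
  have i: "integrable (\<Pi>\<^sub>M b\<in>(Basis::'a set). lborel) (\<lambda>g. \<Prod>b\<in>Basis. f b (g b))"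
    by (rule product_integrable_prod) (auto intro: f)
  have l: "(lborel :: 'a measure) = distr (\<Pi>\<^sub>M b\<in>Basis. lborel) borel S"
    unfolding S_def by (rule lborel_eq)
  show "integrable lborel (\<lambda>x. \<Prod>b\<in>Basis. f b (x \<bullet> b))"
    using i unfolding l by (subst integrable_distr_eq[OF S m]) (simp add: eq)
  have "(LINT x|distr (\<Pi>\<^sub>M b\<in>Basis. lborel) borel S. (\<Prod>b\<in>Basis. f b (x \<bullet> b)))
     = (LINT g|Pi\<^sub>M Basis (\<lambda>_. lborel). (\<Prod>b\<in>Basis. f b (g b)))"
    by (subst integral_distr[OF S m]) (simp add: eq)
  then show "(LINT x|lborel. (\<Prod>b\<in>Basis. f b (x \<bullet> b))) = (\<Prod>b\<in>Basis. (LINT t|lborel. f b t))"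
    unfolding l[symmetric] by (subst (asm) product_integral_prod) (auto intro: f)
qed

text \<open>Up to the factor \<open>sqrt (2 * pi)\<close> this is the characteristic function of the
  standard normal distribution.\<close>

lemma gaussian_fourier_1d:
  "integrable lborel (\<lambda>x. exp (complex_of_real (- (x\<^sup>2) / 2) + \<i> * complex_of_real (t * x)))"
  "(LINT x|lborel. exp (complex_of_real (- (x\<^sup>2) / 2) + \<i> * complex_of_real (t * x))) = complex_of_real (sqrt (2 * pi) * exp (- (t\<^sup>2) / 2))"
proof -
  let ?g = "\<lambda>x. complex_of_real (std_normal_density x) * exp (\<i> * complex_of_real (t * x))"
  have e: "exp (complex_of_real (- (x\<^sup>2) / 2) + \<i> * complex_of_real (t * x)) = complex_of_real (sqrt (2 * pi)) * ?g x" for x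
    by (simp only: exp_add) (simp add: std_normal_density_def exp_of_real[symmetric])
  have "integrable lborel ?g"
  proof (rule Bochner_Integration.integrable_bound[of lborel std_normal_density])
    show "AE x in lborel. norm (?g x) \<le> norm (std_normal_density x)"
      using norm_exp_i_times by (auto simp: norm_mult mult_le_cancel_left)
  qed auto
  then show "integrable lborel (\<lambda>x. exp (complex_of_real (- (x\<^sup>2) / 2) + \<i> * complex_of_real (t * x)))"
    unfolding e by simp
  have "(LINT x|lborel. ?g x) = char std_normal_distribution t"
    unfolding char_def by (subst integral_density) (auto simp: scaleR_conv_of_real)
  then have "(LINT x|lborel. ?g x) = complex_of_real (exp (- (t\<^sup>2) / 2))"
    by (simp add: char_std_normal_distribution)
  then show "(LINT x|lborel. exp (complex_of_real (- (x\<^sup>2) / 2) + \<i> * complex_of_real (t * x))) = complex_of_real (sqrt (2 * pi) * exp (- (t\<^sup>2) / 2))"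
    unfolding e by simp
qed

text \<open>The case \<open>a = 1\<close> is its own Fourier transform. As \<open>a\<close>
  decreases to 0 the function increases to 1, so it can regularise integrals not yet known to be
  finite.\<close>

definition gauss :: "real \<Rightarrow> real^'n \<Rightarrow> real" where
  "gauss a x = exp (- a * (norm x)\<^sup>2 / 2)"

lemma continuous_gauss: "continuous_on UNIV (gauss a)"
  unfolding gauss_def by (intro continuous_intros) auto

lemma gauss_measurable [measurable]: "gauss a \<in> borel_measurable borel" "gauss a \<in> borel_measurable lebesgue"
  using continuous_gauss[of a] by (auto intro: borel_measurable_continuous_onI continuous_lebesgue_measurable)

lemma gauss_pos [simp]: "0 < gauss a x" "0 \<le> gauss a x"
  by (auto simp: gauss_def)

text \<open>Gaussian and phase both factor over coordinates, which reduces the claim to one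
  dimension; the powers of \<open>sqrt (2 * pi)\<close> cancel the normalisation.\<close>

lemma fourier_gauss_1:
  fixes \<xi> :: "real^'n"
  shows "integrable lebesgue (gauss 1 :: real^'n \<Rightarrow> real)"
    "fourier_integral (\<lambda>x. complex_of_real (gauss 1 x)) \<xi> = complex_of_real (gauss 1 \<xi>)"
proof -
  define F where "F = (\<lambda>\<xi> (b::real^'n) t. exp (complex_of_real (- (t\<^sup>2) / 2) + \<i> * complex_of_real (- (\<xi> \<bullet> b) * t)))"
  have ns: "(norm (x::real^'n))\<^sup>2 = (\<Sum>b\<in>Basis. (x \<bullet> b)\<^sup>2)" for x
    by (subst power2_norm_eq_inner, subst euclidean_inner) (simp add: power2_eq_square)
  have e: "cis (- (x \<bullet> \<xi>)) * complex_of_real (gauss 1 x) = (\<Prod>b\<in>Basis. F \<xi> b (x \<bullet> b))" for x \<xi>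
  proof -
    have "cis (- (x \<bullet> \<xi>)) * complex_of_real (gauss 1 x) = exp (complex_of_real (- (norm x)\<^sup>2 / 2) + \<i> * complex_of_real (- (x \<bullet> \<xi>)))"
      by (simp only: exp_add) (simp add: gauss_def cis_conv_exp exp_of_real[symmetric])
    also have "complex_of_real (- (norm x)\<^sup>2 / 2) + \<i> * complex_of_real (- (x \<bullet> \<xi>))
        = (\<Sum>b\<in>Basis. complex_of_real (- ((x \<bullet> b)\<^sup>2) / 2) + \<i> * complex_of_real (- (\<xi> \<bullet> b) * (x \<bullet> b)))"
      unfolding ns euclidean_inner[of x \<xi>]
      by (simp add: sum.distrib sum_subtractf sum_negf sum_divide_distrib sum_distrib_left mult.commute)
    finally show ?thesis by (simp add: F_def exp_sum)
  qed
  have iF: "integrable lborel (F \<xi> b)" for \<xi> b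
    unfolding F_def by (rule gaussian_fourier_1d)
  have mg: "(\<lambda>x. complex_of_real (gauss 1 x)) \<in> borel_measurable borel" by measurable
  have "integrable lborel (\<lambda>x::real^'n. cis (- (x \<bullet> 0)) * complex_of_real (gauss 1 x))"
    unfolding e by (rule integrable_lborel_prod[OF iF])
  from integrable_Re[OF this] have "integrable lborel (gauss 1 :: real^'n \<Rightarrow> real)" by simp
  then show "integrable lebesgue (gauss 1 :: real^'n \<Rightarrow> real)" by (simp add: integrable_completion)
  have "(LINT x|lborel. cis (- (x \<bullet> \<xi>)) * complex_of_real (gauss 1 x))
     = (\<Prod>b\<in>(Basis::(real^'n) set). complex_of_real (sqrt (2 * pi) * exp (- ((\<xi> \<bullet> b)\<^sup>2) / 2)))"
    unfolding e integral_lborel_prod[OF iF]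
    unfolding F_def gaussian_fourier_1d(2) by simp
  also have "\<dots> = complex_of_real (sqrt (2 * pi) ^ CARD('n) * gauss 1 \<xi>)"
    unfolding gauss_def ns by (simp add: prod.distrib exp_sum[symmetric] sum_negf sum_divide_distrib of_real_prod[symmetric] del: of_real_prod)
  finally have "fourier_integral (\<lambda>x. complex_of_real (gauss 1 x)) \<xi> =
      complex_of_real (ft_const TYPE('n) * sqrt (2 * pi) ^ CARD('n)) * complex_of_real (gauss 1 \<xi>)"
    using mg by (simp add: fourier_integral_eq integral_completion)
  also have "ft_const TYPE('n) * sqrt (2 * pi) ^ CARD('n) = 1"
  proof -
    have "sqrt (2 * pi) ^ CARD('n) = (2 * pi) powr (real CARD('n) / 2)"
      by (simp add: powr_half_sqrt[symmetric] powr_realpow[symmetric] powr_powr)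
    then show ?thesis by (simp add: ft_const_def powr_minus)
  qed
  finally show "fourier_integral (\<lambda>x. complex_of_real (gauss 1 x)) \<xi> = complex_of_real (gauss 1 \<xi>)" by simp
qed

lemma gauss_scale: "0 < a \<Longrightarrow> gauss a (inverse (sqrt a) *\<^sub>R x) = gauss 1 x"
  by (simp add: gauss_def power_mult_distrib power_inverse)

lemma gauss_scale': "0 < a \<Longrightarrow> gauss a x = gauss 1 (sqrt a *\<^sub>R x)"
  by (simp add: gauss_def power_mult_distrib)

lemma integral_gauss_1: "complex_of_real (ft_const TYPE('n)) * (LINT x|lebesgue. complex_of_real (gauss 1 (x::real^'n))) = 1"
  using fourier_gauss_1(2)[of 0] by (simp add: fourier_integral_eq) (simp add: gauss_def)

lemma integrable_gauss: "0 < a \<Longrightarrow> integrable lebesgue (gauss a :: real^'n \<Rightarrow> real)"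
  using integrable_lebesgue_affine[of "sqrt a" "gauss 1" 0, OF _ fourier_gauss_1(1)]
  by (simp flip: gauss_scale')

lemma fourier_gauss:
  fixes \<xi> :: "real^'n"
  assumes a: "0 < a"
  shows "fourier_integral (\<lambda>x. complex_of_real (gauss a x)) \<xi>
     = complex_of_real (inverse (sqrt a) ^ CARD('n) * gauss 1 (inverse (sqrt a) *\<^sub>R \<xi>))"
proof -
  have "(LINT x|lebesgue. cis (- (x \<bullet> \<xi>)) * complex_of_real (gauss a x))
    = inverse (sqrt a) ^ CARD('n) *\<^sub>R (LINT x|lebesgue. cis (- (x \<bullet> (inverse (sqrt a) *\<^sub>R \<xi>))) * complex_of_real (gauss 1 x))"
    using a by (subst integral_lebesgue_affine[of "inverse (sqrt a)" _ 0]) (auto simp: gauss_scale)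
  then have "fourier_integral (\<lambda>x. complex_of_real (gauss a x)) \<xi>
     = complex_of_real (inverse (sqrt a) ^ CARD('n)) * fourier_integral (\<lambda>x. complex_of_real (gauss 1 x)) (inverse (sqrt a) *\<^sub>R \<xi>)"
    by (simp add: fourier_integral_eq scaleR_conv_of_real mult_ac)
  then show ?thesis by (simp only: fourier_gauss_1 of_real_mult)
qed

text \<open>The transform of \<open>gauss a\<close> concentrates at 0 as \<open>a\<close> decreases.
  Dilating by \<open>sqrt a\<close> moves the concentration into the argument of \<open>h\<close>
  and leaves a fixed Gaussian weight.\<close>

lemma integral_mult_fourier_gauss:
  fixes h :: "real^'n \<Rightarrow> complex"
  assumes a: "0 < a" and h: "h \<in> borel_measurable lebesgue"
  shows "(LINT z|lebesgue. h z * fourier_integral (\<lambda>x. complex_of_real (gauss a x)) z)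
    = (LINT z|lebesgue. h (sqrt a *\<^sub>R z) * complex_of_real (gauss 1 z))"
proof -
  have [measurable]: "(\<lambda>z. gauss 1 (inverse (sqrt a) *\<^sub>R z)) \<in> borel_measurable lebesgue"
    by (intro continuous_lebesgue_measurable continuous_on_compose2[OF continuous_gauss]) (auto intro!: continuous_intros)
  have "(LINT z|lebesgue. h z * fourier_integral (\<lambda>x. complex_of_real (gauss a x)) z)
     = sqrt a ^ CARD('n) *\<^sub>R (LINT z|lebesgue. h (sqrt a *\<^sub>R z) * complex_of_real (inverse (sqrt a) ^ CARD('n) * gauss 1 z))"
    using a h unfolding fourier_gauss[OF a]
    by (subst integral_lebesgue_affine[of "sqrt a" _ 0]) auto
  also have "\<dots> = sqrt a ^ CARD('n) *\<^sub>R (LINT z|lebesgue. inverse (sqrt a) ^ CARD('n) *\<^sub>R (h (sqrt a *\<^sub>R z) * complex_of_real (gauss 1 z)))"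
    by (simp add: scaleR_conv_of_real mult_ac)
  also have "\<dots> = (sqrt a ^ CARD('n) * inverse (sqrt a) ^ CARD('n)) *\<^sub>R (LINT z|lebesgue. h (sqrt a *\<^sub>R z) * complex_of_real (gauss 1 z))"
    by simp
  also have "sqrt a ^ CARD('n) * inverse (sqrt a) ^ CARD('n) = 1"
    using a by (simp flip: power_mult_distrib)
  finally show ?thesis by simp
qed

text \<open>The autocorrelation \<open>h\<close> takes the squared norm of \<open>f\<close> as its
  value at 0, and its transform is, up to a constant, the squared modulus of the transform of
  \<open>f\<close>. After integration against \<open>gauss a\<close>, one side converges
  monotonically and the other by continuity of \<open>h\<close> at 0.\<close>

lemma plancherel_integrable:
  fixes f :: "real^'n \<Rightarrow> complex"
  assumes f: "integrable lebesgue f" and f2: "f \<in> L2 lebesgue"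
  shows "fourier_integral f \<in> L2 lebesgue" "norm_L2 lebesgue (fourier_integral f) = norm_L2 lebesgue f"
proof -
  obtain b where b[measurable]: "b \<in> borel_measurable borel" and fb: "AE x in lebesgue. f x = b x"
    using borel_representative[of f] f by auto
  have bL[measurable]: "b \<in> borel_measurable lebesgue" by (auto intro: measurable_completion)
  have fm[measurable]: "f \<in> borel_measurable lebesgue" using f by auto
  have b2: "b \<in> L2 lebesgue" "norm_L2 lebesgue b = norm_L2 lebesgue f"
    using L2_cong_AE[OF f2 bL] fb by (auto simp: eq_commute)
  have bi': "integrable lebesgue b" using f integrable_cong_AE[of f lebesgue b] fb by simp
  then have bi: "integrable lborel b" by (simp add: integrable_completion)
  have fbF: "fourier_integral f = fourier_integral b"
    by (intro fourier_integral_cong_AE fb) auto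
  define h where "h = (\<lambda>z. LINT y|lborel. b (y + z) * cnj (b y))"
  have cb: "(\<lambda>y. cnj (b y)) \<in> borel_measurable borel" "integrable lborel (\<lambda>y. cnj (b y))"
    using bi by auto
  note cor = fourier_integral_correlation[OF b cb(1) bi cb(2), folded h_def]
  let ?c = "ft_const TYPE('n)"
  let ?F = "\<lambda>\<xi>. (norm (fourier_integral f \<xi>))\<^sup>2"
  have Fh: "complex_of_real ?c * fourier_integral h \<xi> = complex_of_real (?F \<xi>)" for \<xi>
  proof -
    have "cnj (LINT y|lborel. cis (- (y \<bullet> \<xi>)) * b y) = (LINT y|lborel. cis (y \<bullet> \<xi>) * cnj (b y))"
      using Bochner_Integration.integral_cnj[of lborel "\<lambda>y. cis (- (y \<bullet> \<xi>)) * b y"] by (simp add: cis_cnj)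
    then have "complex_of_real ?c * (LINT y|lborel. cis (y \<bullet> \<xi>) * cnj (b y)) = cnj (fourier_integral f \<xi>)"
      by (simp add: fbF fourier_integral_eq integral_completion)
    then show ?thesis
      unfolding cor(3) fbF complex_norm_square by (simp add: mult.left_commute)
  qed
  have hm[measurable]: "h \<in> borel_measurable lebesgue" using cor(1) by (auto intro: measurable_completion)
  have hi: "integrable lebesgue h" using cor by (simp add: integrable_completion)
  have hL: "h z = (LINT y|lebesgue. b (y + z) * cnj (b y))" for z
    unfolding h_def by (intro integral_completion[symmetric]) measurable
  have cb2: "(\<lambda>y. cnj (b y)) \<in> L2 lebesgue" "norm_L2 lebesgue (\<lambda>y. cnj (b y)) = norm_L2 lebesgue b"
    using b2 by (auto simp: L2_def norm_L2_def)
  have hbd: "norm (h z) \<le> (norm_L2 lebesgue b)\<^sup>2" for z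
    unfolding hL using L2_mult_bound[OF L2_shift[OF b2(1)] cb2(1), of z]
    by (simp add: norm_L2_shift[OF b2(1)] cb2 power2_eq_square)
  have h0: "h 0 = complex_of_real ((norm_L2 lebesgue b)\<^sup>2)"
    unfolding hL norm_L2_sq
    by (simp add: complex_norm_square[symmetric] flip: integral_complex_of_real)
  \<comment> \<open>Written this way, continuity of \<open>h\<close> at 0 is continuity of
    translations in L2, through Cauchy-Schwarz.\<close>
  have hcont: "h (z) - h 0 = (LINT y|lebesgue. (b (y + z) - b y) * cnj (b y))" for z
    unfolding hL left_diff_distrib
    by (subst Bochner_Integration.integral_diff) (auto intro!: L2_mult_integrable L2_shift b2 cb2)
  have hlim: "(h \<longlongrightarrow> h 0) (at 0)"
  proof (rule LIM_I)
    fix e :: real assume e: "0 < e"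
    define e' where "e' = e / (norm_L2 lebesgue b + 1)"
    have n: "0 < norm_L2 lebesgue b + 1" using norm_L2_nonneg[of lebesgue b] by linarith
    have e': "0 < e'" using e n by (simp add: e'_def)
    obtain d where d: "d > 0" "\<And>h. norm h < d \<Longrightarrow> norm_L2 lebesgue (\<lambda>x. b (x + h) - b x) < e'"
      using L2_shift_continuous[OF b2(1) e'] by auto
    show "\<exists>s>0. \<forall>x. x \<noteq> 0 \<and> norm (x - 0) < s \<longrightarrow> norm (h x - h 0) < e"
    proof (intro exI[of _ d] conjI allI impI d(1))
      fix z :: "real^'n" assume z: "z \<noteq> 0 \<and> norm (z - 0) < d"
      have "norm (h z - h 0) \<le> norm_L2 lebesgue (\<lambda>x. b (x + z) - b x) * norm_L2 lebesgue b"
        unfolding hcont using L2_mult_bound[OF L2_diff[OF L2_shift[OF b2(1)] b2(1)] cb2(1), of z]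
        by (simp add: cb2)
      also have "\<dots> \<le> e' * norm_L2 lebesgue b"
        using d(2)[of z] z by (intro mult_right_mono) auto
      also have "\<dots> < e' * (norm_L2 lebesgue b + 1)" using e' by simp
      also have "\<dots> = e" using n by (simp add: e'_def)
      finally show "norm (h z - h 0) < e" .
    qed
  qed
  \<comment> \<open>A decreasing null sequence: the Gaussian factors then increase to 1, as monotone
    convergence requires.\<close>
  define a where "a = (\<lambda>k. 1 / real (Suc k))"
  have a: "0 < a k" for k by (simp add: a_def)
  have a0: "(\<lambda>k. sqrt (a k)) \<longlonglongrightarrow> 0"
    using tendsto_real_sqrt[OF LIMSEQ_Suc[OF lim_1_over_n]] by (simp add: a_def)
  have lim1: "(\<lambda>k. LINT z|lebesgue. h (sqrt (a k) *\<^sub>R z) * complex_of_real (gauss 1 z))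
      \<longlonglongrightarrow> (LINT z|lebesgue. h 0 * complex_of_real (gauss 1 (z::real^'n)))"
  proof (rule integral_dominated_convergence[where w="\<lambda>z::real^'n. (norm_L2 lebesgue b)\<^sup>2 * gauss 1 z"])
    show "AE z in lebesgue. (\<lambda>k. h (sqrt (a k) *\<^sub>R z) * complex_of_real (gauss 1 z)) \<longlonglongrightarrow> h 0 * complex_of_real (gauss 1 z)"
    proof (intro AE_I2 tendsto_mult tendsto_const)
      fix z :: "real^'n"
      have "isCont h 0" using hlim by (simp add: isCont_def)
      moreover have "(\<lambda>k. sqrt (a k) *\<^sub>R z) \<longlonglongrightarrow> 0 *\<^sub>R z" by (intro tendsto_intros a0)
      ultimately show "(\<lambda>k. h (sqrt (a k) *\<^sub>R z)) \<longlonglongrightarrow> h 0"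
        by (intro isCont_tendsto_compose[of 0 h]) auto
    qed
    show "AE z in lebesgue. norm (h (sqrt (a k) *\<^sub>R z) * complex_of_real (gauss 1 z)) \<le> (norm_L2 lebesgue b)\<^sup>2 * gauss 1 z" for k
      using hbd by (auto simp: norm_mult intro!: mult_right_mono)
    show "(\<lambda>z. h (sqrt (a k) *\<^sub>R z) * complex_of_real (gauss 1 z)) \<in> borel_measurable lebesgue" for k
      using borel_measurable_lebesgue_affine[of "sqrt (a k)" h 0, OF _ hm] a[of k] by simp
  qed (use fourier_gauss_1(1) in auto)
  have int: "integrable lebesgue (\<lambda>\<xi>. ?F \<xi> * gauss (a k) \<xi>)" for k
  proof (rule Bochner_Integration.integrable_bound[of lebesgue "\<lambda>\<xi>. (?c * (LINT x|lebesgue. norm (f x)))\<^sup>2 * gauss (a k) \<xi>"])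
    show "AE \<xi> in lebesgue. norm (?F \<xi> * gauss (a k) \<xi>) \<le> norm ((?c * (LINT x|lebesgue. norm (f x)))\<^sup>2 * gauss (a k) \<xi>)"
      using norm_fourier_integral_le[of f] by (auto simp: norm_mult intro!: mult_right_mono power_mono)
  qed (use integrable_gauss[OF a] fourier_integral_measurable[OF f] in auto)
  have eq: "(LINT \<xi>|lebesgue. complex_of_real (?F \<xi> * gauss (a k) \<xi>))
      = complex_of_real ?c * (LINT z|lebesgue. h (sqrt (a k) *\<^sub>R z) * complex_of_real (gauss 1 z))" for k
  proof -
    have "(LINT \<xi>|lebesgue. complex_of_real (?F \<xi> * gauss (a k) \<xi>))
       = complex_of_real ?c * (LINT \<xi>|lebesgue. fourier_integral h \<xi> * complex_of_real (gauss (a k) \<xi>))"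
      unfolding of_real_mult Fh[symmetric] mult.assoc by simp
    also have "(LINT \<xi>|lebesgue. fourier_integral h \<xi> * complex_of_real (gauss (a k) \<xi>))
       = (LINT z|lebesgue. h z * fourier_integral (\<lambda>x. complex_of_real (gauss (a k) x)) z)"
      using integrable_gauss[OF a] hi by (intro fourier_integral_mult_formula) auto
    also have "\<dots> = (LINT z|lebesgue. h (sqrt (a k) *\<^sub>R z) * complex_of_real (gauss 1 z))"
      by (rule integral_mult_fourier_gauss[OF a hm])
    finally show ?thesis .
  qed
  have "(\<lambda>k. complex_of_real ?c * (LINT z|lebesgue. h (sqrt (a k) *\<^sub>R z) * complex_of_real (gauss 1 z)))
     \<longlonglongrightarrow> complex_of_real ?c * (LINT z|lebesgue. h 0 * complex_of_real (gauss 1 (z::real^'n)))"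
    by (intro tendsto_intros lim1)
  also have "complex_of_real ?c * (LINT z|lebesgue. h 0 * complex_of_real (gauss 1 (z::real^'n))) = h 0"
    using integral_gauss_1[where 'n='n] by (simp add: mult.left_commute)
  finally have "(\<lambda>k. complex_of_real (LINT \<xi>|lebesgue. ?F \<xi> * gauss (a k) \<xi>)) \<longlonglongrightarrow> complex_of_real ((norm_L2 lebesgue b)\<^sup>2)"
    unfolding h0 eq[symmetric] by (simp only: integral_complex_of_real)
  then have l2: "(\<lambda>k. LINT \<xi>|lebesgue. ?F \<xi> * gauss (a k) \<xi>) \<longlonglongrightarrow> (norm_L2 lebesgue f)\<^sup>2"
    unfolding tendsto_of_real_iff by (simp add: b2)
  have nn: "(\<integral>\<^sup>+\<xi>. ennreal (?F \<xi> * gauss (a k) \<xi>) \<partial>lebesgue) = ennreal (LINT \<xi>|lebesgue. ?F \<xi> * gauss (a k) \<xi>)" for k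
    by (intro nn_integral_eq_integral int) auto
  have l3: "(\<lambda>k. \<integral>\<^sup>+\<xi>. ennreal (?F \<xi> * gauss (a k) \<xi>) \<partial>lebesgue) \<longlonglongrightarrow> (\<integral>\<^sup>+\<xi>. ennreal (?F \<xi>) \<partial>lebesgue)"
  proof (rule nn_integral_LIMSEQ)
    have amono: "a l \<le> a k" if "k \<le> l" for k l
      using that by (simp add: a_def frac_le)
    show "incseq (\<lambda>k \<xi>. ennreal (?F \<xi> * gauss (a k) \<xi>))"
      using amono by (auto simp: incseq_def le_fun_def gauss_def intro!: ennreal_leI mult_left_mono mult_right_mono)
    show "(\<lambda>k. ennreal (?F x * gauss (a k) x)) \<longlonglongrightarrow> ennreal (?F x)" for x
    proof -
      have "a \<longlonglongrightarrow> 0" using LIMSEQ_Suc[OF lim_1_over_n] by (simp add: a_def)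
      then have "(\<lambda>k. ?F x * gauss (a k) x) \<longlonglongrightarrow> ?F x * exp (- 0 * (norm x)\<^sup>2 / 2)"
        unfolding gauss_def by (intro tendsto_intros) auto
      then show ?thesis by (intro tendsto_ennrealI) simp
    qed
  qed (use fourier_integral_measurable[OF f] in measurable)
  have "(\<lambda>k. \<integral>\<^sup>+\<xi>. ennreal (?F \<xi> * gauss (a k) \<xi>) \<partial>lebesgue) \<longlonglongrightarrow> ennreal ((norm_L2 lebesgue f)\<^sup>2)"
    unfolding nn by (intro tendsto_ennrealI l2)
  with l3 have *: "(\<integral>\<^sup>+\<xi>. ennreal (?F \<xi>) \<partial>lebesgue) = ennreal ((norm_L2 lebesgue f)\<^sup>2)"
    by (rule LIMSEQ_unique)
  show L: "fourier_integral f \<in> L2 lebesgue"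
    by (rule L2_I_nn[OF fourier_integral_measurable[OF f]]) (simp add: *)
  have "(norm_L2 lebesgue (fourier_integral f))\<^sup>2 = (norm_L2 lebesgue f)\<^sup>2"
    using * unfolding nn_integral_L2[OF L] by simp
  then show "norm_L2 lebesgue (fourier_integral f) = norm_L2 lebesgue f"
    by (simp add: power2_eq_iff_nonneg)
qed

subsection \<open>The Fourier transform on square-integrable functions\<close>

definition truncate_ball :: "real \<Rightarrow> (real^'n \<Rightarrow> complex) \<Rightarrow> real^'n \<Rightarrow> complex" where
  "truncate_ball R f x = indicator (cball 0 R) x *\<^sub>R f x"

text \<open>\<open>fourier\<close> accepts real functions only, but inversion applies the transform
  twice and so needs complex arguments.\<close>

definition fourier_cplx :: "(real^'n \<Rightarrow> complex) \<Rightarrow> real^'n \<Rightarrow> complex" where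
  "fourier_cplx f = (SOME F. is_fourier f F)"

lemma fourier_eq_fourier_cplx: "fourier v = fourier_cplx (\<lambda>x. complex_of_real (v x))"
  by (simp add: fourier_def fourier_cplx_def)

lemma L2_integrable_bounded_support:
  fixes f :: "real^'n \<Rightarrow> complex"
  assumes f: "f \<in> L2 lebesgue" and R: "\<And>x. R < norm x \<Longrightarrow> f x = 0"
  shows "integrable lebesgue f"
proof (rule Bochner_Integration.integrable_bound)
  show "integrable lebesgue (\<lambda>x. norm (f x) * norm (indicat_real (cball 0 R) x))"
    by (intro L2_norm_mult_integrable f L2_indicator) auto
  show "AE x in lebesgue. norm (f x) \<le> norm (norm (f x) * norm (indicat_real (cball 0 R) x))"
    using R by (auto simp: indicator_def not_le)
qed (use f in \<open>auto simp: L2_def\<close>)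

lemma truncate_ball_L2:
  assumes "f \<in> L2 lebesgue" shows "truncate_ball R f \<in> L2 lebesgue"
proof (rule L2_dominate(1)[OF assms, of _ 1])
  show "truncate_ball R f \<in> borel_measurable lebesgue" unfolding truncate_ball_def[abs_def]
    by (intro borel_measurable_scaleR borel_measurable_indicator L2_measurable[OF assms]) auto
qed (auto simp: truncate_ball_def indicator_def)

lemma truncate_ball_integrable: "f \<in> L2 lebesgue \<Longrightarrow> integrable lebesgue (truncate_ball R f)"
  by (rule L2_integrable_bounded_support[OF truncate_ball_L2, of _ R]) (auto simp: truncate_ball_def)

lemma truncate_ball_tendsto:
  fixes f :: "real^'n \<Rightarrow> complex"
  assumes f: "f \<in> L2 lebesgue"
  shows "((\<lambda>R. norm_L2 lebesgue (\<lambda>x. truncate_ball R f x - f x)) \<longlongrightarrow> 0) at_top"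
proof (rule tendsto_at_topI_sequentially)
  fix X :: "nat \<Rightarrow> real" assume X: "filterlim X at_top sequentially"
  show "(\<lambda>n. norm_L2 lebesgue (\<lambda>x. truncate_ball (X n) f x - f x)) \<longlonglongrightarrow> 0"
  proof (rule L2_dominated_convergence(2)[OF _ _ f])
    show "AE x in lebesgue. (\<lambda>n. truncate_ball (X n) f x) \<longlonglongrightarrow> f x"
    proof (intro AE_I2 tendsto_eventually)
      fix x :: "real^'n"
      have "\<forall>\<^sub>F n in sequentially. norm x \<le> X n" using X by (simp add: filterlim_at_top)
      then show "\<forall>\<^sub>F n in sequentially. truncate_ball (X n) f x = f x"
        by eventually_elim (simp add: truncate_ball_def)
    qed
    show "AE x in lebesgue. norm (truncate_ball (X n) f x) \<le> norm (f x)" for n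
      by (simp add: truncate_ball_def indicator_def)
  qed (intro L2_measurable truncate_ball_L2 f)+
qed

lemma truncate_ball_tendsto_nat:
  "f \<in> L2 lebesgue \<Longrightarrow> (\<lambda>n. norm_L2 lebesgue (\<lambda>x. truncate_ball (real n) f x - f x)) \<longlonglongrightarrow> 0"
  by (rule filterlim_compose[OF truncate_ball_tendsto filterlim_real_sequentially])

lemma fourier_integral_diff:
  assumes "integrable lebesgue f" "integrable lebesgue g"
  shows "fourier_integral (\<lambda>x. f x - g x) \<xi> = fourier_integral f \<xi> - fourier_integral g \<xi>"
  using assms unfolding fourier_integral_eq
  by (simp add: right_diff_distrib integrable_cis_mult)

lemma fourier_integral_add:
  assumes "integrable lebesgue f" "integrable lebesgue g"
  shows "fourier_integral (\<lambda>x. f x + g x) \<xi> = fourier_integral f \<xi> + fourier_integral g \<xi>"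
  using assms unfolding fourier_integral_eq
  by (simp add: distrib_left integrable_cis_mult)

lemma fourier_integral_cmult: "fourier_integral (\<lambda>x. c * f x) \<xi> = c * fourier_integral f \<xi>"
  unfolding fourier_integral_eq by (simp add: mult.left_commute[of _ c])

lemma plancherel_diff:
  fixes f g :: "real^'n \<Rightarrow> complex"
  assumes "integrable lebesgue f" "f \<in> L2 lebesgue" "integrable lebesgue g" "g \<in> L2 lebesgue"
  shows "norm_L2 lebesgue (\<lambda>x. fourier_integral f x - fourier_integral g x) = norm_L2 lebesgue (\<lambda>x. f x - g x)"
proof -
  have "norm_L2 lebesgue (fourier_integral (\<lambda>x. f x - g x)) = norm_L2 lebesgue (\<lambda>x. f x - g x)"
    by (intro plancherel_integrable L2_diff Bochner_Integration.integrable_diff assms)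
  moreover have "fourier_integral (\<lambda>x. f x - g x) = (\<lambda>x. fourier_integral f x - fourier_integral g x)"
    by (intro ext fourier_integral_diff assms)
  ultimately show ?thesis by simp
qed

lemma fourier_integral_truncate_L2: "f \<in> L2 lebesgue \<Longrightarrow> fourier_integral (truncate_ball R f) \<in> L2 lebesgue"
  by (intro plancherel_integrable truncate_ball_integrable truncate_ball_L2)

text \<open>For members of L2 the extended-valued integrals are squares of finite norms, so the
  defining limit becomes one of real numbers.\<close>

lemma is_fourier_iff:
  fixes f :: "real^'n \<Rightarrow> complex"
  assumes f: "f \<in> L2 lebesgue"
  shows "is_fourier f F \<longleftrightarrow> F \<in> L2 lebesgue \<and>
    ((\<lambda>R. norm_L2 lebesgue (\<lambda>x. F x - fourier_integral (truncate_ball R f) x)) \<longlongrightarrow> 0) at_top"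
proof (cases "F \<in> L2 lebesgue")
  case True
  let ?N = "\<lambda>R. norm_L2 lebesgue (\<lambda>x. F x - fourier_integral (truncate_ball R f) x)"
  have t: "(\<lambda>x. indicator (cball 0 R) x *\<^sub>R f x) = truncate_ball R f" for R by (simp add: truncate_ball_def[abs_def])
  have e: "(\<integral>\<^sup>+ \<xi>. ennreal ((norm (F \<xi> - fourier_integral (truncate_ball R f) \<xi>))\<^sup>2) \<partial>lebesgue) = ennreal ((?N R)\<^sup>2)" for R
    by (intro nn_integral_L2 L2_diff True fourier_integral_truncate_L2 f)
  have "((\<lambda>R. ennreal ((?N R)\<^sup>2)) \<longlongrightarrow> 0) at_top \<longleftrightarrow> ((\<lambda>R. (?N R)\<^sup>2) \<longlongrightarrow> 0) at_top"
    using tendsto_ennreal_iff[of "\<lambda>R. (?N R)\<^sup>2" at_top 0] by simp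
  also have "\<dots> \<longleftrightarrow> (?N \<longlongrightarrow> 0) at_top"
  proof
    assume "((\<lambda>R. (?N R)\<^sup>2) \<longlongrightarrow> 0) at_top"
    from tendsto_real_sqrt[OF this] show "(?N \<longlongrightarrow> 0) at_top" by simp
  next
    assume "(?N \<longlongrightarrow> 0) at_top"
    from tendsto_power[OF this, of 2] show "((\<lambda>R. (?N R)\<^sup>2) \<longlongrightarrow> 0) at_top" by simp
  qed
  finally show ?thesis using True unfolding is_fourier_def t e by simp
qed (simp add: is_fourier_def)

text \<open>Truncations are integrable and converge in L2, so Plancherel makes their transforms a
  Cauchy family.\<close>

lemma is_fourier_exists:
  fixes f :: "real^'n \<Rightarrow> complex"
  assumes f: "f \<in> L2 lebesgue"
  shows "\<exists>F. is_fourier f F"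
proof -
  let ?G = "\<lambda>R. fourier_integral (truncate_ball R f)"
  let ?d = "\<lambda>R. norm_L2 lebesgue (\<lambda>x. truncate_ball R f x - f x)"
  have G: "?G R \<in> L2 lebesgue" for R by (rule fourier_integral_truncate_L2[OF f])
  have le: "norm_L2 lebesgue (\<lambda>x. ?G R x - ?G S x) \<le> ?d R + ?d S" for R S
    using norm_L2_triangle_diff[OF truncate_ball_L2[OF f] f truncate_ball_L2[OF f], of R S]
      plancherel_diff[OF truncate_ball_integrable[OF f] truncate_ball_L2[OF f] truncate_ball_integrable[OF f] truncate_ball_L2[OF f], of R S]
    by (simp add: norm_L2_minus_commute[of _ f])
  have "\<exists>F. F \<in> L2 lebesgue \<and> (\<lambda>n. norm_L2 lebesgue (\<lambda>x. ?G (real n) x - F x)) \<longlonglongrightarrow> 0"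
  proof (rule L2_complete[OF G])
    fix e :: real assume e: "0 < e"
    obtain N where N: "\<And>n. n \<ge> N \<Longrightarrow> ?d (real n) < e/2"
      using LIMSEQ_D[OF truncate_ball_tendsto_nat[OF f], of "e/2"] e by auto
    show "\<exists>N. \<forall>m\<ge>N. \<forall>n\<ge>N. norm_L2 lebesgue (\<lambda>x. ?G (real m) x - ?G (real n) x) < e"
    proof (intro exI allI impI)
      fix m n assume "N \<le> m" "N \<le> n"
      then show "norm_L2 lebesgue (\<lambda>x. ?G (real m) x - ?G (real n) x) < e"
        using le[of "real m" "real n"] N[of m] N[of n] by linarith
    qed
  qed
  then obtain F where F: "F \<in> L2 lebesgue" "(\<lambda>n. norm_L2 lebesgue (\<lambda>x. ?G (real n) x - F x)) \<longlonglongrightarrow> 0" by blast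
  \<comment> \<open>Completeness gives a limit along integer radii only. Letting the integer radius
    tend to infinity bounds the error at any real radius R by the truncation error at R.\<close>
  have "((\<lambda>R. norm_L2 lebesgue (\<lambda>x. F x - ?G R x)) \<longlongrightarrow> 0) at_top"
  proof (rule tendsto_sandwich[OF _ _ tendsto_const truncate_ball_tendsto[OF f]])
    have "norm_L2 lebesgue (\<lambda>x. F x - ?G R x) \<le> ?d R" for R
    proof -
      have l: "(\<lambda>n. norm_L2 lebesgue (\<lambda>x. ?G (real n) x - F x) + (?d (real n) + ?d R)) \<longlonglongrightarrow> 0 + (0 + ?d R)"
        by (intro tendsto_intros F truncate_ball_tendsto_nat f)
      have "norm_L2 lebesgue (\<lambda>x. F x - ?G R x) \<le> norm_L2 lebesgue (\<lambda>x. ?G (real n) x - F x) + (?d (real n) + ?d R)" for n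
        using norm_L2_triangle_diff[OF F(1) G[of "real n"] G[of R]] le[of "real n" R]
        by (simp add: norm_L2_minus_commute[of _ F])
      then show ?thesis using LIMSEQ_le_const[OF l] by auto
    qed
    then show "\<forall>\<^sub>F R in at_top. norm_L2 lebesgue (\<lambda>x. F x - ?G R x) \<le> ?d R" by simp
  qed simp
  then show ?thesis using is_fourier_iff[OF f] F(1) by blast
qed

lemma is_fourier_fourier_cplx:
  assumes "f \<in> L2 lebesgue" shows "is_fourier f (fourier_cplx f)"
  unfolding fourier_cplx_def by (rule someI_ex[OF is_fourier_exists[OF assms]])

lemma fourier_cplx_L2 [intro]: "f \<in> L2 lebesgue \<Longrightarrow> fourier_cplx f \<in> L2 lebesgue"
  using is_fourier_fourier_cplx by (auto simp: is_fourier_def)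

lemma fourier_cplx_tendsto:
  assumes "f \<in> L2 lebesgue"
  shows "(\<lambda>n. norm_L2 lebesgue (\<lambda>x. fourier_cplx f x - fourier_integral (truncate_ball (real n) f) x)) \<longlonglongrightarrow> 0"
  using is_fourier_fourier_cplx[OF assms] is_fourier_iff[OF assms]
  by (auto intro: filterlim_compose[OF _ filterlim_real_sequentially])

text \<open>Plancherel compares any approximation by integrable L2 functions with the truncations,
  so each of them determines the chosen transform. The algebraic rules follow by picking an
  approximation that suits the operation.\<close>

lemma fourier_cplx_eqI:
  fixes f :: "real^'n \<Rightarrow> complex"
  assumes f: "f \<in> L2 lebesgue" and G: "G \<in> L2 lebesgue"
    and g: "\<And>n::nat. g n \<in> L2 lebesgue" "\<And>n. integrable lebesgue (g n)"
    and riesz_hat: "(\<lambda>n. norm_L2 lebesgue (\<lambda>x. g n x - f x)) \<longlonglongrightarrow> 0"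
    and gG: "(\<lambda>n. norm_L2 lebesgue (\<lambda>x. fourier_integral (g n) x - G x)) \<longlonglongrightarrow> 0"
  shows "AE x in lebesgue. fourier_cplx f x = G x"
proof -
  let ?t = "\<lambda>n. truncate_ball (real n) f"
  have "norm_L2 lebesgue (\<lambda>x. fourier_cplx f x - G x) \<le> norm_L2 lebesgue (\<lambda>x. fourier_cplx f x - fourier_integral (?t n) x)
    + ((norm_L2 lebesgue (\<lambda>x. ?t n x - f x) + norm_L2 lebesgue (\<lambda>x. g n x - f x)) + norm_L2 lebesgue (\<lambda>x. fourier_integral (g n) x - G x))" for n
  proof -
    have t: "?t n \<in> L2 lebesgue" "integrable lebesgue (?t n)" by (intro truncate_ball_L2 truncate_ball_integrable f)+
    have L: "fourier_integral (?t n) \<in> L2 lebesgue" "fourier_integral (g n) \<in> L2 lebesgue"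
      by (intro plancherel_integrable t g)+
    have 1: "norm_L2 lebesgue (\<lambda>x. fourier_integral (?t n) x - fourier_integral (g n) x) \<le> norm_L2 lebesgue (\<lambda>x. ?t n x - f x) + norm_L2 lebesgue (\<lambda>x. g n x - f x)"
      using norm_L2_triangle_diff[OF t(1) f g(1)[of n]] plancherel_diff[OF t(2,1) g(2,1), of n] by (simp add: norm_L2_minus_commute[of _ f])
    show ?thesis
      using 1 norm_L2_triangle_diff[OF fourier_cplx_L2[OF f] L(1) G] norm_L2_triangle_diff[OF L G] by linarith
  qed
  moreover have "(\<lambda>n. norm_L2 lebesgue (\<lambda>x. fourier_cplx f x - fourier_integral (?t n) x)
    + ((norm_L2 lebesgue (\<lambda>x. ?t n x - f x) + norm_L2 lebesgue (\<lambda>x. g n x - f x)) + norm_L2 lebesgue (\<lambda>x. fourier_integral (g n) x - G x))) \<longlonglongrightarrow> 0 + ((0 + 0) + 0)"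
    by (intro tendsto_add fourier_cplx_tendsto truncate_ball_tendsto_nat f riesz_hat gG)
  ultimately have "norm_L2 lebesgue (\<lambda>x. fourier_cplx f x - G x) \<le> 0 + ((0 + 0) + 0)"
    by (intro LIMSEQ_le_const) auto
  then have "norm_L2 lebesgue (\<lambda>x. fourier_cplx f x - G x) = 0" using norm_L2_nonneg[of lebesgue "\<lambda>x. fourier_cplx f x - G x"] by linarith
  then show ?thesis by (simp add: norm_L2_diff_eq_0_iff fourier_cplx_L2 f G)
qed

lemma fourier_cplx_integrable:
  assumes "f \<in> L2 lebesgue" "integrable lebesgue f"
  shows "AE x in lebesgue. fourier_cplx f x = fourier_integral f x"
  by (rule fourier_cplx_eqI[OF assms(1) plancherel_integrable(1)[OF assms(2,1)] assms]) (simp_all add: norm_L2_def)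

lemma norm_L2_add_tendsto:
  assumes "\<And>n::nat. a n \<in> L2 M" "f \<in> L2 M" "\<And>n. b n \<in> L2 M" "g \<in> L2 M"
    "(\<lambda>n. norm_L2 M (\<lambda>x. a n x - f x)) \<longlonglongrightarrow> 0" "(\<lambda>n. norm_L2 M (\<lambda>x. b n x - g x)) \<longlonglongrightarrow> 0"
  shows "(\<lambda>n. norm_L2 M (\<lambda>x. (a n x + b n x) - (f x + g x))) \<longlonglongrightarrow> 0"
proof (rule tendsto_sandwich[OF _ _ tendsto_const])
  show "(\<lambda>n. norm_L2 M (\<lambda>x. a n x - f x) + norm_L2 M (\<lambda>x. b n x - g x)) \<longlonglongrightarrow> 0"
    using tendsto_add[OF assms(5,6)] by simp
  have "norm_L2 M (\<lambda>x. (a n x + b n x) - (f x + g x)) \<le> norm_L2 M (\<lambda>x. a n x - f x) + norm_L2 M (\<lambda>x. b n x - g x)" for n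
    using norm_L2_triangle[OF L2_diff[OF assms(1)[of n] assms(2)] L2_diff[OF assms(3)[of n] assms(4)]]
    by (simp add: algebra_simps)
  then show "\<forall>\<^sub>F n in sequentially. norm_L2 M (\<lambda>x. (a n x + b n x) - (f x + g x)) \<le> norm_L2 M (\<lambda>x. a n x - f x) + norm_L2 M (\<lambda>x. b n x - g x)"
    by simp
qed simp

lemma fourier_cplx_tendsto':
  assumes "f \<in> L2 lebesgue"
  shows "(\<lambda>n. norm_L2 lebesgue (\<lambda>x. fourier_integral (truncate_ball (real n) f) x - fourier_cplx f x)) \<longlonglongrightarrow> 0"
  using fourier_cplx_tendsto[OF assms] by (simp add: norm_L2_minus_commute[of _ "fourier_cplx f"])

lemma fourier_cplx_add:
  assumes f: "f \<in> L2 lebesgue" and g: "g \<in> L2 lebesgue"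
  shows "AE x in lebesgue. fourier_cplx (\<lambda>x. f x + g x) x = fourier_cplx f x + fourier_cplx g x"
proof (rule fourier_cplx_eqI[where g="\<lambda>n x. truncate_ball (real n) f x + truncate_ball (real n) g x"])
  show "(\<lambda>n. norm_L2 lebesgue (\<lambda>x. fourier_integral (\<lambda>x. truncate_ball (real n) f x + truncate_ball (real n) g x) x - (fourier_cplx f x + fourier_cplx g x))) \<longlonglongrightarrow> 0"
    unfolding fourier_integral_add[OF truncate_ball_integrable[OF f] truncate_ball_integrable[OF g]]
    by (intro norm_L2_add_tendsto fourier_cplx_tendsto' fourier_integral_truncate_L2 fourier_cplx_L2 f g)
qed (use f g in \<open>auto intro!: norm_L2_add_tendsto truncate_ball_L2 truncate_ball_tendsto_nat truncate_ball_integrable\<close>)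

lemma norm_L2_cmult: "norm_L2 M (\<lambda>x. c * f x) = norm c * norm_L2 M f" for c :: complex
  by (simp add: norm_L2_def norm_mult power_mult_distrib real_sqrt_mult)

lemma L2_cmult_complex [intro]: "f \<in> L2 M \<Longrightarrow> (\<lambda>x. c * f x) \<in> L2 M" for c :: complex
  by (auto simp: L2_def norm_mult power_mult_distrib)

lemma fourier_cplx_cmult:
  assumes f: "f \<in> L2 lebesgue"
  shows "AE x in lebesgue. fourier_cplx (\<lambda>x. c * f x) x = c * fourier_cplx f x"
proof (rule fourier_cplx_eqI[where g="\<lambda>n x. c * truncate_ball (real n) f x"])
  show "(\<lambda>n. norm_L2 lebesgue (\<lambda>x. c * truncate_ball (real n) f x - c * f x)) \<longlonglongrightarrow> 0"
    using tendsto_mult_right_zero[OF truncate_ball_tendsto_nat[OF f], of "norm c"]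
    by (simp add: right_diff_distrib[symmetric] norm_L2_cmult)
  show "(\<lambda>n. norm_L2 lebesgue (\<lambda>x. fourier_integral (\<lambda>x. c * truncate_ball (real n) f x) x - c * fourier_cplx f x)) \<longlonglongrightarrow> 0"
    using tendsto_mult_right_zero[OF fourier_cplx_tendsto'[OF f], of "norm c"]
    by (simp add: right_diff_distrib[symmetric] norm_L2_cmult fourier_integral_cmult)
qed (use f truncate_ball_integrable[OF f] in \<open>auto intro!: truncate_ball_L2\<close>)

lemma fourier_cplx_diff:
  assumes f: "f \<in> L2 lebesgue" and g: "g \<in> L2 lebesgue"
  shows "AE x in lebesgue. fourier_cplx (\<lambda>x. f x - g x) x = fourier_cplx f x - fourier_cplx g x"
  using fourier_cplx_add[OF f L2_cmult_complex[OF g, of "-1"]] fourier_cplx_cmult[OF g, of "-1"]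
  by eventually_elim simp

lemma plancherel:
  assumes f: "f \<in> L2 lebesgue"
  shows "norm_L2 lebesgue (fourier_cplx f) = norm_L2 lebesgue f"
proof (rule LIMSEQ_unique)
  show "(\<lambda>n. norm_L2 lebesgue (fourier_integral (truncate_ball (real n) f))) \<longlonglongrightarrow> norm_L2 lebesgue (fourier_cplx f)"
    by (rule norm_L2_tendsto[OF _ fourier_cplx_L2[OF f] fourier_cplx_tendsto'[OF f]]) (simp add: fourier_integral_truncate_L2 f)
  have "norm_L2 lebesgue (fourier_integral (truncate_ball (real n) f)) = norm_L2 lebesgue (truncate_ball (real n) f)" for n
    by (intro plancherel_integrable truncate_ball_integrable truncate_ball_L2 f)
  then show "(\<lambda>n. norm_L2 lebesgue (fourier_integral (truncate_ball (real n) f))) \<longlonglongrightarrow> norm_L2 lebesgue f"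
    using norm_L2_tendsto[OF _ f truncate_ball_tendsto_nat[OF f]] by (simp add: truncate_ball_L2 f)
qed

lemma norm_L2_fourier_cplx_diff:
  assumes f: "f \<in> L2 lebesgue" and g: "g \<in> L2 lebesgue"
  shows "norm_L2 lebesgue (\<lambda>x. fourier_cplx f x - fourier_cplx g x) = norm_L2 lebesgue (\<lambda>x. f x - g x)"
proof -
  have "norm_L2 lebesgue (\<lambda>x. fourier_cplx f x - fourier_cplx g x) = norm_L2 lebesgue (fourier_cplx (\<lambda>x. f x - g x))"
    by (rule L2_cong_AE(2)) (use fourier_cplx_diff[OF f g] f g in \<open>auto simp: eq_commute intro!: L2_measurable\<close>)
  then show ?thesis by (simp add: plancherel L2_diff f g)
qed

lemma fourier_cplx_cong_AE:
  assumes f: "f \<in> L2 lebesgue" and g: "g \<in> borel_measurable lebesgue" and eq: "AE x in lebesgue. g x = f x"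
  shows "AE x in lebesgue. fourier_cplx g x = fourier_cplx f x"
proof -
  have gL: "g \<in> L2 lebesgue" by (rule L2_cong_AE[OF f g eq])
  have "norm_L2 lebesgue (\<lambda>x. fourier_cplx g x - fourier_cplx f x) = 0"
    unfolding norm_L2_fourier_cplx_diff[OF gL f] using eq by (simp add: norm_L2_diff_eq_0_iff gL f)
  then show ?thesis by (simp add: norm_L2_diff_eq_0_iff fourier_cplx_L2 gL f)
qed

lemma fourier_cplx_inj:
  assumes "f \<in> L2 lebesgue" "g \<in> L2 lebesgue" "AE x in lebesgue. fourier_cplx f x = fourier_cplx g x"
  shows "AE x in lebesgue. f x = g x"
proof -
  have "norm_L2 lebesgue (\<lambda>x. fourier_cplx f x - fourier_cplx g x) = 0"
    using assms(3) by (simp add: norm_L2_diff_eq_0_iff fourier_cplx_L2 assms(1,2))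
  then have "norm_L2 lebesgue (\<lambda>x. f x - g x) = 0"
    unfolding norm_L2_fourier_cplx_diff[OF assms(1,2)] .
  then show ?thesis by (simp add: norm_L2_diff_eq_0_iff assms(1,2))
qed

lemma inner_L2_diff_right:
  "f \<in> L2 M \<Longrightarrow> g \<in> L2 M \<Longrightarrow> h \<in> L2 M \<Longrightarrow> inner_L2 M h (\<lambda>x. f x - g x) = inner_L2 M h f - inner_L2 M h g"
  unfolding inner_L2_def by (simp add: inner_diff_right L2_inner_integrable)

text \<open>Polarisation: the norms of \<open>f\<close>, \<open>g\<close> and their difference are
  preserved, hence so is the inner product.\<close>

lemma parseval:
  assumes f: "f \<in> L2 lebesgue" and g: "g \<in> L2 lebesgue"
  shows "inner_L2 lebesgue (fourier_cplx f) (fourier_cplx g) = inner_L2 lebesgue f g"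
proof -
  have e: "(norm_L2 lebesgue (\<lambda>x. a x - b x))\<^sup>2 = (norm_L2 lebesgue a)\<^sup>2 - 2 * inner_L2 lebesgue a b + (norm_L2 lebesgue b)\<^sup>2"
    if "a \<in> L2 lebesgue" "b \<in> L2 lebesgue" for a b :: "real^'a \<Rightarrow> complex"
    using that unfolding inner_L2_self[symmetric]
    by (simp add: inner_L2_diff inner_L2_diff_right L2_diff inner_L2_commute[of _ b a])
  show ?thesis
    using e[OF f g] e[OF fourier_cplx_L2[OF f] fourier_cplx_L2[OF g]] norm_L2_fourier_cplx_diff[OF f g] plancherel[OF f] plancherel[OF g] by simp
qed

lemma L2_mult_tendsto:
  fixes a :: "nat \<Rightarrow> 'a \<Rightarrow> complex"
  assumes a: "\<And>n. a n \<in> L2 M" and f: "f \<in> L2 M" and b: "\<And>n. b n \<in> L2 M" and g: "g \<in> L2 M"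
    and af: "(\<lambda>n. norm_L2 M (\<lambda>x. a n x - f x)) \<longlonglongrightarrow> 0" and bg: "(\<lambda>n. norm_L2 M (\<lambda>x. b n x - g x)) \<longlonglongrightarrow> 0"
  shows "(\<lambda>n. LINT x|M. a n x * b n x) \<longlonglongrightarrow> (LINT x|M. f x * g x)"
proof (rule LIM_zero_cancel, rule Lim_null_comparison)
  have bn: "(\<lambda>n. norm_L2 M (b n)) \<longlonglongrightarrow> norm_L2 M g" using norm_L2_tendsto[OF _ g bg] b by simp
  show "(\<lambda>n. norm_L2 M (\<lambda>x. a n x - f x) * norm_L2 M (b n) + norm_L2 M f * norm_L2 M (\<lambda>x. b n x - g x)) \<longlonglongrightarrow> 0"
    using tendsto_add[OF tendsto_mult[OF af bn] tendsto_mult[OF tendsto_const[of "norm_L2 M f"] bg]] by simp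
  have "norm ((LINT x|M. a n x * b n x) - (LINT x|M. f x * g x))
      \<le> norm_L2 M (\<lambda>x. a n x - f x) * norm_L2 M (b n) + norm_L2 M f * norm_L2 M (\<lambda>x. b n x - g x)" for n
  proof -
    have eq: "(LINT x|M. a n x * b n x) - (LINT x|M. f x * g x)
       = (LINT x|M. (a n x - f x) * b n x) + (LINT x|M. f x * (b n x - g x))"
      using a f b g by (simp add: left_diff_distrib right_diff_distrib L2_mult_integrable)
    show ?thesis unfolding eq
      using norm_triangle_ineq[of "LINT x|M. (a n x - f x) * b n x" "LINT x|M. f x * (b n x - g x)"]
        L2_mult_bound[OF L2_diff[OF a[of n] f] b[of n]] L2_mult_bound[OF f L2_diff[OF b[of n] g]] by linarith
  qed
  then show "\<forall>\<^sub>F n in sequentially. norm ((LINT x|M. a n x * b n x) - (LINT x|M. f x * g x))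
      \<le> norm_L2 M (\<lambda>x. a n x - f x) * norm_L2 M (b n) + norm_L2 M f * norm_L2 M (\<lambda>x. b n x - g x)" by simp
qed

text \<open>The identity for integrable functions passes to the limit along truncations of both
  factors.\<close>

lemma fourier_cplx_mult_formula:
  assumes f: "f \<in> L2 lebesgue" and g: "g \<in> L2 lebesgue"
  shows "(LINT x|lebesgue. fourier_cplx f x * g x) = (LINT x|lebesgue. f x * fourier_cplx g x)"
proof (rule LIMSEQ_unique)
  show "(\<lambda>n. LINT x|lebesgue. fourier_integral (truncate_ball (real n) f) x * truncate_ball (real n) g x) \<longlonglongrightarrow> (LINT x|lebesgue. fourier_cplx f x * g x)"
    by (intro L2_mult_tendsto fourier_integral_truncate_L2 truncate_ball_L2 fourier_cplx_L2 f g fourier_cplx_tendsto' truncate_ball_tendsto_nat)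
  have "(\<lambda>n. LINT x|lebesgue. truncate_ball (real n) f x * fourier_integral (truncate_ball (real n) g) x) \<longlonglongrightarrow> (LINT x|lebesgue. f x * fourier_cplx g x)"
    by (intro L2_mult_tendsto fourier_integral_truncate_L2 truncate_ball_L2 fourier_cplx_L2 f g fourier_cplx_tendsto' truncate_ball_tendsto_nat)
  then show "(\<lambda>n. LINT x|lebesgue. fourier_integral (truncate_ball (real n) f) x * truncate_ball (real n) g x) \<longlonglongrightarrow> (LINT x|lebesgue. f x * fourier_cplx g x)"
    by (simp only: fourier_integral_mult_formula[OF truncate_ball_integrable[OF f] truncate_ball_integrable[OF g]])
qed

lemma fourier_integral_shift:
  assumes f: "f \<in> borel_measurable lebesgue"
  shows "fourier_integral (\<lambda>x. f (x + h)) \<xi> = cis (h \<bullet> \<xi>) * fourier_integral f \<xi>"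
proof -
  have e: "cis (- (x \<bullet> \<xi>)) * f (x + h) = cis (h \<bullet> \<xi>) * (cis (- ((x + h) \<bullet> \<xi>)) * f (x + h))" for x
    by (simp add: cis_mult inner_add_left flip: mult.assoc)
  have "(LINT x|lebesgue. cis (- (x \<bullet> \<xi>)) * f (x + h))
     = cis (h \<bullet> \<xi>) * (LINT x|lebesgue. cis (- ((x + h) \<bullet> \<xi>)) * f (x + h))"
    by (subst e) (rule integral_mult_right_zero)
  also have "(LINT x|lebesgue. cis (- ((x + h) \<bullet> \<xi>)) * f (x + h)) = (LINT x|lebesgue. cis (- (x \<bullet> \<xi>)) * f x)"
    using integral_lebesgue_shift[of "\<lambda>x. cis (- (x \<bullet> \<xi>)) * f x" h] f by simp
  finally show ?thesis by (simp add: fourier_integral_eq mult.left_commute)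
qed

lemma fourier_cplx_shift:
  fixes f :: "real^'n \<Rightarrow> complex"
  assumes f: "f \<in> L2 lebesgue"
  shows "AE \<xi> in lebesgue. fourier_cplx (\<lambda>x. f (x + h)) \<xi> = cis (h \<bullet> \<xi>) * fourier_cplx f \<xi>"
proof (rule fourier_cplx_eqI[where g="\<lambda>n x. truncate_ball (real n) f (x + h)"])
  have m: "truncate_ball (real n) f \<in> borel_measurable lebesgue" for n by (intro L2_measurable truncate_ball_L2 f)
  have s: "norm_L2 lebesgue (\<lambda>x. cis (h \<bullet> x) * a x - cis (h \<bullet> x) * b x) = norm_L2 lebesgue (\<lambda>x. a x - b x)" for a b
    by (simp add: right_diff_distrib[symmetric] norm_L2_def norm_mult)
  show "(\<lambda>n. norm_L2 lebesgue (\<lambda>x. truncate_ball (real n) f (x + h) - f (x + h))) \<longlonglongrightarrow> 0"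
    using truncate_ball_tendsto_nat[OF f] norm_L2_shift[OF L2_diff[OF truncate_ball_L2[OF f] f], of _ h] by simp
  show "(\<lambda>n. norm_L2 lebesgue (\<lambda>x. fourier_integral (\<lambda>x. truncate_ball (real n) f (x + h)) x - cis (h \<bullet> x) * fourier_cplx f x)) \<longlonglongrightarrow> 0"
    unfolding fourier_integral_shift[OF m] s by (rule fourier_cplx_tendsto'[OF f])
  show "(\<lambda>\<xi>. cis (h \<bullet> \<xi>) * fourier_cplx f \<xi>) \<in> L2 lebesgue"
    by (rule L2_dominate(1)[OF fourier_cplx_L2[OF f], of _ 1])
      (use L2_measurable[OF fourier_cplx_L2[OF f]] cis_inner_measurable(4)[of h] in \<open>auto simp: norm_mult inner_commute[of h]\<close>)
  show "integrable lebesgue (\<lambda>x. truncate_ball (real n) f (x + h))" for n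
    using integrable_lebesgue_affine[of 1 "truncate_ball (real n) f" h, OF _ truncate_ball_integrable[OF f]] by (simp add: add.commute)
qed (use f truncate_ball_L2[OF f] in \<open>auto intro: L2_shift\<close>)

lemma fourier_integral_cnj: "fourier_integral (\<lambda>x. cnj (f x)) \<xi> = cnj (fourier_integral f (- \<xi>))"
  unfolding fourier_integral_eq by (simp add: cis_cnj flip: Bochner_Integration.integral_cnj)

lemma L2_cnj: "f \<in> L2 M \<Longrightarrow> (\<lambda>x. cnj (f x)) \<in> L2 M"
  by (auto simp: L2_def)

lemma norm_L2_cnj_diff: "norm_L2 M (\<lambda>x. cnj (f x) - cnj (g x)) = norm_L2 M (\<lambda>x. f x - g x)"
  by (simp add: norm_L2_def flip: complex_cnj_diff)

text \<open>For real-valued \<open>f\<close> this becomes the Hermitian symmetry of the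
  transform.\<close>

lemma fourier_cplx_cnj:
  fixes f :: "real^'n \<Rightarrow> complex"
  assumes f: "f \<in> L2 lebesgue"
  shows "AE \<xi> in lebesgue. fourier_cplx (\<lambda>x. cnj (f x)) \<xi> = cnj (fourier_cplx f (- \<xi>))"
proof (rule fourier_cplx_eqI[where g="\<lambda>n x. cnj (truncate_ball (real n) f x)"])
  show "(\<lambda>n. norm_L2 lebesgue (\<lambda>x. cnj (truncate_ball (real n) f x) - cnj (f x))) \<longlonglongrightarrow> 0"
    unfolding norm_L2_cnj_diff by (rule truncate_ball_tendsto_nat[OF f])
  have "norm_L2 lebesgue (\<lambda>x. fourier_integral (truncate_ball (real n) f) (- x) - fourier_cplx f (- x))
      = norm_L2 lebesgue (\<lambda>x. fourier_integral (truncate_ball (real n) f) x - fourier_cplx f x)" for n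
    using norm_L2_reflect[OF L2_diff[OF fourier_integral_truncate_L2[OF f] fourier_cplx_L2[OF f]]] .
  then show "(\<lambda>n. norm_L2 lebesgue (\<lambda>x. fourier_integral (\<lambda>x. cnj (truncate_ball (real n) f x)) x - cnj (fourier_cplx f (- x)))) \<longlonglongrightarrow> 0"
    unfolding fourier_integral_cnj norm_L2_cnj_diff using fourier_cplx_tendsto'[OF f] by simp
qed (use f truncate_ball_integrable[OF f] in \<open>auto intro!: L2_cnj truncate_ball_L2 L2_reflect fourier_cplx_L2\<close>)

text \<open>Inversion: the reflected transform is the adjoint of the isometry \<open>fourier_cplx\<close>, so it suffices to test
  the identity against arbitrary \<open>H\<close>.\<close>

lemma fourier_cplx_inversion:
  fixes F :: "real^'n \<Rightarrow> complex"
  assumes F: "F \<in> L2 lebesgue"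
  shows "AE x in lebesgue. fourier_cplx (\<lambda>x. fourier_cplx F (- x)) x = F x"
proof -
  define G where "G = (\<lambda>x. fourier_cplx F (- x))"
  have G: "G \<in> L2 lebesgue" unfolding G_def by (intro L2_reflect fourier_cplx_L2 F)
  have ipc: "inner_L2 lebesgue a b = Re (LINT x|lebesgue. a x * cnj (b x))" if "a \<in> L2 lebesgue" "b \<in> L2 lebesgue" for a b :: "real^'n \<Rightarrow> complex"
    using L2_mult_integrable[OF that(1) L2_cnj[OF that(2)]]
    unfolding inner_L2_def by (simp add: inner_complex_def flip: integral_Re)
  have key: "inner_L2 lebesgue (fourier_cplx G) H = inner_L2 lebesgue F H" if H: "H \<in> L2 lebesgue" for H
  proof -
    have cH: "(\<lambda>x. cnj (H x)) \<in> L2 lebesgue" by (rule L2_cnj[OF H])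
    have "(LINT x|lebesgue. fourier_cplx G x * cnj (H x)) = (LINT x|lebesgue. G x * fourier_cplx (\<lambda>x. cnj (H x)) x)"
      by (rule fourier_cplx_mult_formula[OF G cH])
    \<comment> \<open>Substituting \<open>- x\<close> undoes the reflection in \<open>G\<close> and
      puts it on the transform of the conjugate, where \<open>fourier_cplx_cnj\<close> removes
      it.\<close>
    also have "\<dots> = (LINT x|lebesgue. fourier_cplx F x * fourier_cplx (\<lambda>x. cnj (H x)) (- x))"
      using integral_lebesgue_affine[of "-1" "\<lambda>x. G x * fourier_cplx (\<lambda>x. cnj (H x)) x" 0]
        L2_measurable[OF G] L2_measurable[OF fourier_cplx_L2[OF cH]] by (simp add: G_def)
    also have "\<dots> = (LINT x|lebesgue. fourier_cplx F x * cnj (fourier_cplx H x))"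
    proof (rule integral_cong_AE)
      show "AE x in lebesgue. fourier_cplx F x * fourier_cplx (\<lambda>x. cnj (H x)) (- x) = fourier_cplx F x * cnj (fourier_cplx H x)"
        using AE_lebesgue_reflect[OF fourier_cplx_cnj[OF H]] by eventually_elim simp
    qed (use L2_measurable[OF fourier_cplx_L2[OF F]] L2_measurable[OF L2_reflect[OF fourier_cplx_L2[OF cH]]] L2_measurable[OF L2_cnj[OF fourier_cplx_L2[OF H]]] in auto)
    finally show ?thesis
      using parseval[OF F H] by (simp add: ipc F H fourier_cplx_L2 G)
  qed
  \<comment> \<open>Testing against the difference itself forces its norm to vanish.\<close>
  let ?J = "\<lambda>x. fourier_cplx G x - F x"
  have J: "?J \<in> L2 lebesgue" by (intro L2_diff fourier_cplx_L2 G F)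
  have "(norm_L2 lebesgue ?J)\<^sup>2 = 0"
    unfolding inner_L2_self[symmetric] using key[OF J] by (simp add: inner_L2_diff fourier_cplx_L2 G F J)
  then show ?thesis using norm_L2_diff_eq_0_iff[OF fourier_cplx_L2[OF G] F] by (simp add: G_def)
qed

text \<open>The inverse transform of a Hermitian function agrees almost everywhere with its own
  conjugate, so taking the real part changes nothing. This supplies witnesses for the choice in
  \<open>frac_laplacian\<close>.\<close>

lemma fourier_surj:
  fixes F :: "real^'n \<Rightarrow> complex"
  assumes F: "F \<in> L2 lebesgue" and herm: "AE \<xi> in lebesgue. F (- \<xi>) = cnj (F \<xi>)"
  shows "\<exists>w \<in> L2 lebesgue. AE \<xi> in lebesgue. fourier w \<xi> = F \<xi>"
proof -
  define G where "G = (\<lambda>x. fourier_cplx F (- x))"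
  have G: "G \<in> L2 lebesgue" unfolding G_def by (intro L2_reflect fourier_cplx_L2 F)
  have FG: "AE x in lebesgue. fourier_cplx G x = F x" unfolding G_def by (rule fourier_cplx_inversion[OF F])
  have "AE x in lebesgue. fourier_cplx (\<lambda>x. cnj (G x)) x = fourier_cplx G x"
    using fourier_cplx_cnj[OF G] AE_lebesgue_reflect[OF FG] FG herm by eventually_elim simp
  then have r: "AE x in lebesgue. cnj (G x) = G x" by (rule fourier_cplx_inj[OF L2_cnj[OF G] G])
  have w: "(\<lambda>x. Re (G x)) \<in> L2 lebesgue"
    by (rule L2_dominate(1)[OF G, of _ 1]) (use L2_measurable[OF G] abs_Re_le_cmod in auto)
  have "AE x in lebesgue. complex_of_real (Re (G x)) = G x"
    using r by eventually_elim (simp add: complex_eq_iff)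
  then have "AE x in lebesgue. fourier_cplx (\<lambda>x. complex_of_real (Re (G x))) x = fourier_cplx G x"
    by (intro fourier_cplx_cong_AE G L2_measurable L2_of_real w)
  then have "AE \<xi> in lebesgue. fourier (\<lambda>x. Re (G x)) \<xi> = F \<xi>"
    using FG unfolding fourier_eq_fourier_cplx by eventually_elim simp
  then show ?thesis using w by blast
qed

subsection \<open>Fractional Sobolev spaces\<close>

lemma borel_imp_lebesgue_measurable: "f \<in> borel_measurable borel \<Longrightarrow> f \<in> borel_measurable lebesgue"
  by (intro measurable_completion) simp

lemma fourier_in_L2 [intro]: "v \<in> L2 lebesgue \<Longrightarrow> fourier v \<in> L2 lebesgue"
  unfolding fourier_eq_fourier_cplx by (intro fourier_cplx_L2 L2_of_real)

lemma fourier_measurable: "v \<in> L2 lebesgue \<Longrightarrow> fourier v \<in> borel_measurable lebesgue"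
  by (intro L2_measurable fourier_in_L2)

lemma norm_L2_fourier: "v \<in> L2 lebesgue \<Longrightarrow> norm_L2 lebesgue (fourier v) = norm_L2 lebesgue v"
  unfolding fourier_eq_fourier_cplx by (simp add: plancherel L2_of_real)

lemma fourier_add:
  "v \<in> L2 lebesgue \<Longrightarrow> w \<in> L2 lebesgue \<Longrightarrow> AE \<xi> in lebesgue. fourier (\<lambda>x. v x + w x) \<xi> = fourier v \<xi> + fourier w \<xi>"
  unfolding fourier_eq_fourier_cplx using fourier_cplx_add[OF L2_of_real L2_of_real, of v w] by simp

lemma fourier_diff:
  "v \<in> L2 lebesgue \<Longrightarrow> w \<in> L2 lebesgue \<Longrightarrow> AE \<xi> in lebesgue. fourier (\<lambda>x. v x - w x) \<xi> = fourier v \<xi> - fourier w \<xi>"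
  unfolding fourier_eq_fourier_cplx using fourier_cplx_diff[OF L2_of_real L2_of_real, of v w] by simp

lemma fourier_cmult:
  "v \<in> L2 lebesgue \<Longrightarrow> AE \<xi> in lebesgue. fourier (\<lambda>x. c * v x) \<xi> = c *\<^sub>R fourier v \<xi>"
  unfolding fourier_eq_fourier_cplx using fourier_cplx_cmult[OF L2_of_real, of v "complex_of_real c"] by (simp add: scaleR_conv_of_real)

lemma fourier_shift:
  "v \<in> L2 lebesgue \<Longrightarrow> AE \<xi> in lebesgue. fourier (\<lambda>x. v (x + h)) \<xi> = cis (h \<bullet> \<xi>) * fourier v \<xi>"
  unfolding fourier_eq_fourier_cplx by (rule fourier_cplx_shift[OF L2_of_real])

lemma fourier_hermitian:
  "v \<in> L2 lebesgue \<Longrightarrow> AE \<xi> in lebesgue. fourier v (- \<xi>) = cnj (fourier v \<xi>)"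
  unfolding fourier_eq_fourier_cplx using fourier_cplx_cnj[OF L2_of_real, of v] by (auto elim!: eventually_mono)

lemma fourier_parseval:
  "v \<in> L2 lebesgue \<Longrightarrow> w \<in> L2 lebesgue \<Longrightarrow> inner_L2 lebesgue (fourier v) (fourier w) = (LINT x|lebesgue. v x * w x)"
  unfolding fourier_eq_fourier_cplx by (simp add: parseval L2_of_real) (simp add: inner_L2_def inner_complex_def)

text \<open>The transform of (1 - Laplacian)^(s/2) applied to \<open>v\<close>; its L2 norm is the
  Sobolev norm.\<close>

definition bessel_hat :: "real \<Rightarrow> (real^'n \<Rightarrow> real) \<Rightarrow> real^'n \<Rightarrow> complex" where
  "bessel_hat s v \<xi> = ((1 + (norm \<xi>)\<^sup>2) powr (s/2)) *\<^sub>R fourier v \<xi>"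

text \<open>The transform of (- Laplacian)^(s/2) applied to \<open>v\<close>; its squared L2 norm is
  the energy \<open>frac_form s v v\<close>.\<close>

definition riesz_hat :: "real \<Rightarrow> (real^'n \<Rightarrow> real) \<Rightarrow> real^'n \<Rightarrow> complex" where
  "riesz_hat s v \<xi> = (norm \<xi> powr s) *\<^sub>R fourier v \<xi>"

lemma powr_half_sq: "(x powr (s/2))\<^sup>2 = x powr (s::real)"
  by (simp add: power2_eq_square flip: powr_add)

lemma sq_powr: "0 \<le> t \<Longrightarrow> (t\<^sup>2) powr a = t powr (2 * a)" for t a :: real
  using powr_powr[of t 2 a] by (cases "t = 0") simp_all

lemma norm_bessel_hat_sq: "(norm (bessel_hat s v \<xi>))\<^sup>2 = (1 + (norm \<xi>)\<^sup>2) powr s * (norm (fourier v \<xi>))\<^sup>2"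
  by (simp add: bessel_hat_def power_mult_distrib powr_half_sq)

lemma weight_measurable:
  "(\<lambda>\<xi>::real^'n. (1 + (norm \<xi>)\<^sup>2) powr s) \<in> borel_measurable lebesgue"
  "(\<lambda>\<xi>::real^'n. norm \<xi> powr s) \<in> borel_measurable lebesgue"
  by (rule borel_imp_lebesgue_measurable, measurable)+

lemma bessel_hat_measurable: "v \<in> L2 lebesgue \<Longrightarrow> bessel_hat s v \<in> borel_measurable lebesgue"
  unfolding bessel_hat_def[abs_def] by (intro borel_measurable_scaleR weight_measurable fourier_measurable)

lemma riesz_hat_measurable: "v \<in> L2 lebesgue \<Longrightarrow> riesz_hat s v \<in> borel_measurable lebesgue"
  unfolding riesz_hat_def[abs_def] by (intro borel_measurable_scaleR weight_measurable fourier_measurable)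

lemma Hs_iff: "v \<in> Hs s \<longleftrightarrow> v \<in> L2 lebesgue \<and> bessel_hat s v \<in> L2 lebesgue"
proof -
  have "bessel_hat s v \<in> L2 lebesgue \<longleftrightarrow> integrable lebesgue (\<lambda>\<xi>. (1 + (norm \<xi>)\<^sup>2) powr s * (norm (fourier v \<xi>))\<^sup>2)"
    if "v \<in> L2 lebesgue"
    using bessel_hat_measurable[OF that, of s] by (simp add: L2_def norm_bessel_hat_sq)
  then show ?thesis by (auto simp: Hs_def)
qed

lemma Hs_L2: "v \<in> Hs s \<Longrightarrow> v \<in> L2 lebesgue"
  by (simp add: Hs_iff)

lemma Hs_bessel_hat_L2: "v \<in> Hs s \<Longrightarrow> bessel_hat s v \<in> L2 lebesgue"
  by (simp add: Hs_iff)

lemma Hs_norm_eq: "Hs_norm s v = norm_L2 lebesgue (bessel_hat s v)"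
  by (simp add: Hs_norm_def norm_L2_def norm_bessel_hat_sq)

lemma Hs_norm_nonneg [simp]: "0 \<le> Hs_norm s v"
  by (simp add: Hs_norm_eq)

lemma bessel_hat_add:
  "v \<in> L2 lebesgue \<Longrightarrow> w \<in> L2 lebesgue \<Longrightarrow> AE \<xi> in lebesgue. bessel_hat s (\<lambda>x. v x + w x) \<xi> = bessel_hat s v \<xi> + bessel_hat s w \<xi>"
  by (drule fourier_add, assumption, erule eventually_mono) (simp add: bessel_hat_def scaleR_add_right)

lemma bessel_hat_diff:
  "v \<in> L2 lebesgue \<Longrightarrow> w \<in> L2 lebesgue \<Longrightarrow> AE \<xi> in lebesgue. bessel_hat s (\<lambda>x. v x - w x) \<xi> = bessel_hat s v \<xi> - bessel_hat s w \<xi>"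
  by (drule fourier_diff, assumption, erule eventually_mono) (simp add: bessel_hat_def scaleR_diff_right)

lemma bessel_hat_cmult:
  "v \<in> L2 lebesgue \<Longrightarrow> AE \<xi> in lebesgue. bessel_hat s (\<lambda>x. c * v x) \<xi> = c *\<^sub>R bessel_hat s v \<xi>"
  by (drule fourier_cmult[of _ c], erule eventually_mono) (simp add: bessel_hat_def)

lemma riesz_hat_add:
  "v \<in> L2 lebesgue \<Longrightarrow> w \<in> L2 lebesgue \<Longrightarrow> AE \<xi> in lebesgue. riesz_hat s (\<lambda>x. v x + w x) \<xi> = riesz_hat s v \<xi> + riesz_hat s w \<xi>"
  by (drule fourier_add, assumption, erule eventually_mono) (simp add: riesz_hat_def scaleR_add_right)

lemma riesz_hat_cmult:
  "v \<in> L2 lebesgue \<Longrightarrow> AE \<xi> in lebesgue. riesz_hat s (\<lambda>x. c * v x) \<xi> = c *\<^sub>R riesz_hat s v \<xi>"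
  by (drule fourier_cmult[of _ c], erule eventually_mono) (simp add: riesz_hat_def)

lemma Hs_add [intro]:
  assumes "v \<in> Hs s" "w \<in> Hs s" shows "(\<lambda>x. v x + w x) \<in> Hs s"
proof -
  have v: "v \<in> L2 lebesgue" "w \<in> L2 lebesgue" using assms by (auto simp: Hs_iff)
  have "bessel_hat s (\<lambda>x. v x + w x) \<in> L2 lebesgue"
    by (rule L2_cong_AE(1)[OF L2_add[OF Hs_bessel_hat_L2[OF assms(1)] Hs_bessel_hat_L2[OF assms(2)]] bessel_hat_measurable bessel_hat_add])
      (auto intro: v)
  then show ?thesis using v by (auto simp: Hs_iff)
qed

lemma Hs_cmult [intro]:
  assumes "v \<in> Hs s" shows "(\<lambda>x. c * v x) \<in> Hs s"
proof -
  have v: "v \<in> L2 lebesgue" using assms by (auto simp: Hs_iff)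
  have "bessel_hat s (\<lambda>x. c * v x) \<in> L2 lebesgue"
    by (rule L2_cong_AE(1)[OF L2_scaleR[OF Hs_bessel_hat_L2[OF assms]] bessel_hat_measurable bessel_hat_cmult]) (auto intro: v)
  then show ?thesis using v by (auto simp: Hs_iff)
qed

lemma Hs_diff [intro]:
  assumes "v \<in> Hs s" "w \<in> Hs s" shows "(\<lambda>x. v x - w x) \<in> Hs s"
  using Hs_add[OF assms(1) Hs_cmult[OF assms(2), of "-1"]] by simp

lemma Hs_norm_diff:
  assumes "v \<in> Hs s" "w \<in> Hs s"
  shows "Hs_norm s (\<lambda>x. v x - w x) = norm_L2 lebesgue (\<lambda>\<xi>. bessel_hat s v \<xi> - bessel_hat s w \<xi>)"
  unfolding Hs_norm_eq
  by (rule L2_cong_AE(2)[OF L2_diff[OF Hs_bessel_hat_L2[OF assms(1)] Hs_bessel_hat_L2[OF assms(2)]] bessel_hat_measurable bessel_hat_diff])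
    (auto intro: Hs_L2 assms)

lemma norm_L2_le_Hs_norm:
  assumes "v \<in> Hs s" "0 \<le> s" shows "norm_L2 lebesgue v \<le> Hs_norm s v"
proof -
  have v: "v \<in> L2 lebesgue" using assms by (simp add: Hs_iff)
  have "norm_L2 lebesgue (fourier v) \<le> 1 * norm_L2 lebesgue (bessel_hat s v)"
  proof (rule L2_dominate(2)[OF Hs_bessel_hat_L2[OF assms(1)] fourier_measurable[OF v]])
    show "AE x in lebesgue. norm (fourier v x) \<le> 1 * norm (bessel_hat s v x)"
    proof (rule AE_I2)
      fix x :: "real^'a"
      have "1 \<le> (1 + (norm x)\<^sup>2) powr (s/2)" using assms(2) by (intro ge_one_powr_ge_zero) auto
      from mult_right_mono[OF this norm_ge_zero[of "fourier v x"]]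
      show "norm (fourier v x) \<le> 1 * norm (bessel_hat s v x)" by (simp add: bessel_hat_def)
    qed
  qed simp
  then show ?thesis by (simp add: norm_L2_fourier v Hs_norm_eq)
qed

lemma norm_powr_le_weight: "0 \<le> s \<Longrightarrow> norm \<xi> powr s \<le> (1 + (norm \<xi>)\<^sup>2) powr (s/2)"
proof -
  assume s: "0 \<le> s"
  have "norm \<xi> powr s = ((norm \<xi>)\<^sup>2) powr (s/2)"
    by (simp add: sq_powr)
  also have "\<dots> \<le> (1 + (norm \<xi>)\<^sup>2) powr (s/2)" using s by (intro powr_mono2) auto
  finally show ?thesis .
qed

lemma
  assumes v: "v \<in> Hs s" and s: "0 \<le> s"
  shows riesz_hat_L2: "riesz_hat s v \<in> L2 lebesgue" and norm_L2_riesz_hat_le: "norm_L2 lebesgue (riesz_hat s v) \<le> Hs_norm s v"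
proof -
  have le: "AE x in lebesgue. norm (riesz_hat s v x) \<le> 1 * norm (bessel_hat s v x)"
    by (intro AE_I2) (simp add: riesz_hat_def bessel_hat_def mult_right_mono norm_powr_le_weight[OF s])
  show "riesz_hat s v \<in> L2 lebesgue" "norm_L2 lebesgue (riesz_hat s v) \<le> Hs_norm s v"
    using L2_dominate[OF Hs_bessel_hat_L2[OF v] riesz_hat_measurable[OF Hs_L2[OF v]] _ le] by (auto simp: Hs_norm_eq)
qed

text \<open>The weight is real and even, so Hermitian symmetry survives multiplication by it and
  \<open>fourier_surj\<close> provides a function for the choice operator to pick.\<close>

lemma frac_laplacian_spec:
  fixes v :: "real^'n \<Rightarrow> real"
  assumes v: "v \<in> Hs s" and s: "0 \<le> s"
  shows "frac_laplacian (s/2) v \<in> L2 lebesgue"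
    "AE \<xi> in lebesgue. fourier (frac_laplacian (s/2) v) \<xi> = riesz_hat s v \<xi>"
proof -
  have herm: "AE \<xi> in lebesgue. riesz_hat s v (- \<xi>) = cnj (riesz_hat s v \<xi>)"
    using fourier_hermitian[OF Hs_L2[OF v]] by eventually_elim (simp add: riesz_hat_def)
  have e: "riesz_hat s v \<xi> = complex_of_real (norm \<xi> powr (2 * (s/2))) * fourier v \<xi>" for \<xi>
    by (simp add: riesz_hat_def scaleR_conv_of_real)
  have "\<exists>w. w \<in> L2 lebesgue \<and> (AE \<xi> in lebesgue. fourier w \<xi> = complex_of_real (norm \<xi> powr (2 * (s/2))) * fourier v \<xi>)"
    using fourier_surj[OF riesz_hat_L2[OF v s] herm] unfolding e by blast
  from someI_ex[OF this] show "frac_laplacian (s/2) v \<in> L2 lebesgue"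
    "AE \<xi> in lebesgue. fourier (frac_laplacian (s/2) v) \<xi> = riesz_hat s v \<xi>"
    unfolding frac_laplacian_def e by auto
qed

text \<open>Parseval. The later estimates of the form are made on this Fourier-side
  expression.\<close>

lemma frac_form_eq:
  assumes v: "v \<in> Hs s" and w: "w \<in> Hs s" and s: "0 \<le> s"
  shows "frac_form s v w = inner_L2 lebesgue (riesz_hat s v) (riesz_hat s w)"
proof -
  note V = frac_laplacian_spec[OF v s] and W = frac_laplacian_spec[OF w s]
  have "frac_form s v w = inner_L2 lebesgue (fourier (frac_laplacian (s/2) v)) (fourier (frac_laplacian (s/2) w))"
    by (simp add: fourier_parseval V(1) W(1) frac_form_def)
  also have "\<dots> = inner_L2 lebesgue (riesz_hat s v) (riesz_hat s w)"
    unfolding inner_L2_def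
  proof (rule integral_cong_AE)
    show "AE x in lebesgue. fourier (frac_laplacian (s/2) v) x \<bullet> fourier (frac_laplacian (s/2) w) x = riesz_hat s v x \<bullet> riesz_hat s w x"
      using V(2) W(2) by eventually_elim simp
  qed (auto intro!: borel_measurable_inner fourier_measurable riesz_hat_measurable V W Hs_L2[OF v] Hs_L2[OF w])
  finally show ?thesis .
qed

lemma inner_L2_cong_AE:
  assumes "f \<in> borel_measurable M" "f' \<in> borel_measurable M" "g \<in> borel_measurable M" "AE x in M. f' x = f x"
  shows "inner_L2 M f' g = inner_L2 M f g"
  unfolding inner_L2_def by (rule integral_cong_AE) (use assms in \<open>auto elim!: eventually_mono\<close>)

lemma frac_form_add:
  assumes v: "v \<in> Hs s" and w: "w \<in> Hs s" and u: "u \<in> Hs s" and s: "0 \<le> s"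
  shows "frac_form s (\<lambda>x. v x + w x) u = frac_form s v u + frac_form s w u"
proof -
  have "inner_L2 lebesgue (riesz_hat s (\<lambda>x. v x + w x)) (riesz_hat s u) = inner_L2 lebesgue (\<lambda>x. riesz_hat s v x + riesz_hat s w x) (riesz_hat s u)"
    by (rule inner_L2_cong_AE[OF L2_measurable[OF L2_add[OF riesz_hat_L2[OF v s] riesz_hat_L2[OF w s]]]
          riesz_hat_measurable[OF Hs_L2[OF Hs_add[OF v w]]] riesz_hat_measurable[OF Hs_L2[OF u]] riesz_hat_add[OF Hs_L2[OF v] Hs_L2[OF w]]])
  then show ?thesis
    by (simp add: frac_form_eq assms Hs_add inner_L2_add riesz_hat_L2)
qed

lemma frac_form_cmult:
  assumes v: "v \<in> Hs s" and u: "u \<in> Hs s" and s: "0 \<le> s"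
  shows "frac_form s (\<lambda>x. c * v x) u = c * frac_form s v u"
proof -
  have "inner_L2 lebesgue (riesz_hat s (\<lambda>x. c * v x)) (riesz_hat s u) = inner_L2 lebesgue (\<lambda>x. c *\<^sub>R riesz_hat s v x) (riesz_hat s u)"
    by (rule inner_L2_cong_AE[OF L2_measurable[OF L2_scaleR[OF riesz_hat_L2[OF v s]]]
          riesz_hat_measurable[OF Hs_L2[OF Hs_cmult[OF v]]] riesz_hat_measurable[OF Hs_L2[OF u]] riesz_hat_cmult[OF Hs_L2[OF v]]])
  then show ?thesis
    by (simp add: frac_form_eq assms Hs_cmult inner_L2_scaleR)
qed

lemma frac_form_commute: "frac_form s v w = frac_form s w v"
  by (simp add: frac_form_def mult.commute)

lemma frac_form_diff:
  assumes v: "v \<in> Hs s" and w: "w \<in> Hs s" and u: "u \<in> Hs s" and s: "0 \<le> s"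
  shows "frac_form s (\<lambda>x. v x - w x) u = frac_form s v u - frac_form s w u"
  using frac_form_add[OF v Hs_cmult[OF w, of "-1"] u s] frac_form_cmult[OF w u s, of "-1"] by simp

lemma frac_form_bound:
  assumes v: "v \<in> Hs s" and w: "w \<in> Hs s" and s: "0 \<le> s"
  shows "\<bar>frac_form s v w\<bar> \<le> Hs_norm s v * Hs_norm s w"
proof -
  have "\<bar>frac_form s v w\<bar> \<le> norm_L2 lebesgue (riesz_hat s v) * norm_L2 lebesgue (riesz_hat s w)"
    unfolding frac_form_eq[OF assms] by (intro inner_L2_CS riesz_hat_L2 assms)
  also have "\<dots> \<le> Hs_norm s v * Hs_norm s w"
    by (intro mult_mono norm_L2_riesz_hat_le assms) auto
  finally show ?thesis .
qed

lemma frac_form_self: "v \<in> Hs s \<Longrightarrow> 0 \<le> s \<Longrightarrow> frac_form s v v = (norm_L2 lebesgue (riesz_hat s v))\<^sup>2"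
  by (simp add: frac_form_eq inner_L2_self)

text \<open>The functions and their weighted transforms converge separately in L2. Along a common
  subsequence both converge almost everywhere in frequency, which identifies the second limit as the
  weighted transform of the first.\<close>

lemma Hs_complete:
  fixes p :: "nat \<Rightarrow> real^'n \<Rightarrow> real"
  assumes p: "\<And>n. p n \<in> Hs s" and s: "0 \<le> s"
    and cauchy: "\<And>e. 0 < e \<Longrightarrow> \<exists>N. \<forall>m\<ge>N. \<forall>n\<ge>N. Hs_norm s (\<lambda>x. p m x - p n x) < e"
  shows "\<exists>q. q \<in> Hs s \<and> (\<lambda>n. Hs_norm s (\<lambda>x. p n x - q x)) \<longlonglongrightarrow> 0"
proof -
  have pL: "p n \<in> L2 lebesgue" for n by (rule Hs_L2[OF p])
  have le: "norm_L2 lebesgue (\<lambda>x. p m x - p n x) \<le> Hs_norm s (\<lambda>x. p m x - p n x)" for m n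
    by (intro norm_L2_le_Hs_norm Hs_diff p s)
  have "\<exists>q. q \<in> L2 lebesgue \<and> (\<lambda>n. norm_L2 lebesgue (\<lambda>x. p n x - q x)) \<longlonglongrightarrow> 0"
  proof (rule L2_complete[OF pL])
    fix e :: real assume "0 < e"
    then obtain N where "\<And>m n. m \<ge> N \<Longrightarrow> n \<ge> N \<Longrightarrow> Hs_norm s (\<lambda>x. p m x - p n x) < e"
      using cauchy by blast
    then show "\<exists>N. \<forall>m\<ge>N. \<forall>n\<ge>N. norm_L2 lebesgue (\<lambda>x. p m x - p n x) < e"
      using le_less_trans[OF le] by blast
  qed
  then obtain q where q: "q \<in> L2 lebesgue" "(\<lambda>n. norm_L2 lebesgue (\<lambda>x. p n x - q x)) \<longlonglongrightarrow> 0" by blast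
  have "\<exists>G. G \<in> L2 lebesgue \<and> (\<lambda>n. norm_L2 lebesgue (\<lambda>x. bessel_hat s (p n) x - G x)) \<longlonglongrightarrow> 0"
    by (rule L2_complete[OF Hs_bessel_hat_L2[OF p]]) (use cauchy in \<open>simp add: Hs_norm_diff p\<close>)
  then obtain G where G: "G \<in> L2 lebesgue" "(\<lambda>n. norm_L2 lebesgue (\<lambda>x. bessel_hat s (p n) x - G x)) \<longlonglongrightarrow> 0" by blast
  obtain r where r: "strict_mono r" "AE x in lebesgue. (\<lambda>n. bessel_hat s (p (r n)) x) \<longlonglongrightarrow> G x"
    using L2_limit_AE[OF Hs_bessel_hat_L2[OF p] G] by blast
  have "norm_L2 lebesgue (\<lambda>x. fourier (p n) x - fourier q x) = norm_L2 lebesgue (\<lambda>x. p n x - q x)" for n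
    unfolding fourier_eq_fourier_cplx norm_L2_fourier_cplx_diff[OF L2_of_real[OF pL] L2_of_real[OF q(1)]]
    by (simp add: norm_L2_def flip: of_real_diff)
  then have "(\<lambda>n. norm_L2 lebesgue (\<lambda>x. fourier (p (r n)) x - fourier q x)) \<longlonglongrightarrow> 0"
    using LIMSEQ_subseq_LIMSEQ[OF q(2) r(1)] by (simp add: comp_def)
  from L2_limit_AE[OF fourier_in_L2[OF pL] fourier_in_L2[OF q(1)] this]
  obtain r' where r': "strict_mono r'" "AE x in lebesgue. (\<lambda>n. fourier (p (r (r' n))) x) \<longlonglongrightarrow> fourier q x"
    by blast
  have eq: "AE x in lebesgue. bessel_hat s q x = G x"
    using r(2) r'(2)
  proof eventually_elim
    case (elim x)
    have "(\<lambda>n. bessel_hat s (p (r (r' n))) x) \<longlonglongrightarrow> bessel_hat s q x"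
      unfolding bessel_hat_def by (intro tendsto_intros elim)
    moreover have "(\<lambda>n. bessel_hat s (p (r (r' n))) x) \<longlonglongrightarrow> G x"
      using LIMSEQ_subseq_LIMSEQ[OF elim(1) r'(1)] by (simp add: comp_def)
    ultimately show ?case by (rule LIMSEQ_unique)
  qed
  have wq: "bessel_hat s q \<in> L2 lebesgue" by (rule L2_cong_AE(1)[OF G(1) bessel_hat_measurable[OF q(1)] eq])
  then have qH: "q \<in> Hs s" by (simp add: Hs_iff q)
  have "Hs_norm s (\<lambda>x. p n x - q x) = norm_L2 lebesgue (\<lambda>x. bessel_hat s (p n) x - G x)" for n
    unfolding Hs_norm_diff[OF p qH]
    by (rule L2_cong_AE(2)) (use eq Hs_bessel_hat_L2[OF p] G(1) wq in \<open>auto intro: L2_measurable elim!: eventually_mono\<close>)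
  then show ?thesis using qH G(2) by auto
qed

text \<open>\<open>1 + t\<^sup>2\<close> is at most twice the larger of 1 and
  \<open>t\<^sup>2\<close>, whence the factor \<open>2 powr s\<close>.\<close>

lemma weight_split: "0 \<le> s \<Longrightarrow> 0 \<le> t \<Longrightarrow> (1 + t\<^sup>2) powr s \<le> 2 powr s * (1 + (t powr s)\<^sup>2)" for s t :: real
proof (cases "t \<le> 1")
  case True
  assume s: "0 \<le> s" "0 \<le> t"
  have "(1 + t\<^sup>2) powr s \<le> 2 powr s" using True s by (intro powr_mono2) (auto simp: power_le_one)
  also have "\<dots> \<le> 2 powr s * (1 + (t powr s)\<^sup>2)" by simp
  finally show ?thesis .
next
  case False
  assume s: "0 \<le> s" "0 \<le> t"
  have "1 \<le> t\<^sup>2" using False by simp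
  then have "(1 + t\<^sup>2) powr s \<le> (2 * t\<^sup>2) powr s" using s by (intro powr_mono2) auto
  also have "\<dots> = 2 powr s * (t powr s)\<^sup>2"
    using s powr_half_sq[of t "2 * s"] by (simp add: powr_mult sq_powr)
  also have "\<dots> \<le> 2 powr s * (1 + (t powr s)\<^sup>2)" by simp
  finally show ?thesis .
qed

text \<open>For a radius at most 1 the power \<open>r ^ CARD('n)\<close> is at most
  \<open>r\<close>, so a radius proportional to \<open>c\<close> suffices.\<close>

lemma small_ball:
  assumes "0 < c"
  shows "\<exists>r>0. measure lebesgue (ball (0::real^'n) r) < c"
proof -
  define r where "r = min 1 (c / (unit_ball_vol (real CARD('n)) + 1))"
  have u: "0 \<le> unit_ball_vol (real CARD('n))" by simp
  have r: "0 < r" "r \<le> 1" using assms u by (auto simp: r_def intro!: divide_pos_pos add_nonneg_pos)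
  have "measure lebesgue (ball (0::real^'n) r) = unit_ball_vol (real CARD('n)) * r ^ CARD('n)"
    using r content_ball[of r "0::real^'n"] by simp
  also have "r ^ CARD('n) \<le> r ^ 1" using r by (intro power_decreasing) auto
  then have "unit_ball_vol (real CARD('n)) * r ^ CARD('n) \<le> unit_ball_vol (real CARD('n)) * r"
    using u by (simp add: mult_left_mono)
  also have "\<dots> < (unit_ball_vol (real CARD('n)) + 1) * r" using r by simp
  also have "\<dots> \<le> (unit_ball_vol (real CARD('n)) + 1) * (c / (unit_ball_vol (real CARD('n)) + 1))"
    using u by (intro mult_left_mono) (auto simp: r_def)
  also have "\<dots> = c" using u by (simp add: add_nonneg_eq_0_iff)
  finally show ?thesis using r(1) by blast
qed

text \<open>Cauchy-Schwarz against the indicator of the ball controls the L1 norm by the L2 norm.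
  The transform is then a genuine integral, bounded uniformly in the frequency.\<close>

lemma fourier_bounded_support:
  fixes v :: "real^'n \<Rightarrow> real"
  assumes v: "v \<in> L2 lebesgue" and supp: "AE x in lebesgue. R < norm x \<longrightarrow> v x = 0"
  shows "integrable lebesgue v"
    "AE \<xi> in lebesgue. fourier v \<xi> = fourier_integral (\<lambda>x. complex_of_real (v x)) \<xi>"
    "norm (fourier_integral (\<lambda>x. complex_of_real (v x)) \<xi>) \<le> ft_const TYPE('n) * norm_L2 lebesgue (indicat_real (cball (0::real^'n) R)) * norm_L2 lebesgue v"
proof -
  have IL: "indicat_real (cball (0::real^'n) R) \<in> L2 lebesgue" by (intro L2_indicator) auto
  have e: "AE x in lebesgue. norm (v x) = norm (indicat_real (cball 0 R) x) * norm (v x)"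
    using supp by eventually_elim (auto simp: indicator_def)
  have i: "integrable lebesgue (\<lambda>x. norm (indicat_real (cball 0 R) x) * norm (v x))"
    by (intro L2_norm_mult_integrable IL v)
  show vi: "integrable lebesgue v"
    by (rule Bochner_Integration.integrable_bound[OF i L2_measurable[OF v]])
      (use e in \<open>auto elim!: eventually_mono\<close>)
  show "AE \<xi> in lebesgue. fourier v \<xi> = fourier_integral (\<lambda>x. complex_of_real (v x)) \<xi>"
    unfolding fourier_eq_fourier_cplx by (intro fourier_cplx_integrable L2_of_real v integrable_of_real vi)
  have "(LINT x|lebesgue. norm (v x)) = (LINT x|lebesgue. norm (indicat_real (cball 0 R) x) * norm (v x))"
    by (rule integral_cong_AE) (use e vi i in auto)
  also have "\<dots> \<le> norm_L2 lebesgue (indicat_real (cball (0::real^'n) R)) * norm_L2 lebesgue v"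
    by (rule L2_CS[OF IL v])
  finally show "norm (fourier_integral (\<lambda>x. complex_of_real (v x)) \<xi>) \<le> ft_const TYPE('n) * norm_L2 lebesgue (indicat_real (cball (0::real^'n) R)) * norm_L2 lebesgue v"
    using norm_fourier_integral_le[of "\<lambda>x. complex_of_real (v x)" \<xi>] ft_const_pos[where 'n='n]
    by (auto simp: mult.assoc intro: order_trans mult_left_mono)
qed

text \<open>On a bounded set the low frequencies carry only a small part of the mass, because the transform
  is bounded by a multiple of the norm.\<close>

lemma poincare:
  assumes s: "0 \<le> s"
  shows "\<exists>C\<ge>0. \<forall>v::real^'n \<Rightarrow> real. v \<in> Hs s \<longrightarrow> (AE x in lebesgue. R < norm x \<longrightarrow> v x = 0) \<longrightarrow>
     Hs_norm s v \<le> C * norm_L2 lebesgue (riesz_hat s v)"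
proof -
  define K where "K = ft_const TYPE('n) * norm_L2 lebesgue (indicat_real (cball (0::real^'n) R))"
  have "0 < 1 / (2 * (K\<^sup>2 + 1))" by (simp add: add_nonneg_pos)
  \<comment> \<open>On this ball the uniform bound by \<open>K\<close> accounts for at most half of
    the mass of the transform, and that half can be absorbed on the left.\<close>
  then obtain r where r: "0 < r" "measure lebesgue (ball (0::real^'n) r) < 1 / (2 * (K\<^sup>2 + 1))"
    using small_ball[where 'n='n] by blast
  have K2: "K\<^sup>2 * measure lebesgue (ball (0::real^'n) r) \<le> 1/2"
  proof -
    have "K\<^sup>2 * measure lebesgue (ball (0::real^'n) r) \<le> K\<^sup>2 * (1 / (2 * (K\<^sup>2 + 1)))"
      using r by (intro mult_left_mono) auto
    also have "\<dots> \<le> 1/2" by (simp add: divide_simps add_nonneg_pos)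
    finally show ?thesis .
  qed
  \<comment> \<open>Outside the ball the transform is at most \<open>1 / r powr s\<close> times the
    weighted one; the factor 2 compensates for the absorbed half.\<close>
  define A where "A = 2 * (1 / r powr s)\<^sup>2"
  have main: "(Hs_norm s v)\<^sup>2 \<le> 2 powr s * (A + 1) * (norm_L2 lebesgue (riesz_hat s v))\<^sup>2"
    if v: "v \<in> Hs s" and supp: "AE x in lebesgue. R < norm x \<longrightarrow> v x = 0" for v :: "real^'n \<Rightarrow> real"
  proof -
    have vL: "v \<in> L2 lebesgue" by (rule Hs_L2[OF v])
    note fb = fourier_bounded_support[OF vL supp, folded K_def]
    have K0: "0 \<le> K" using ft_const_pos[where 'n='n] by (simp add: K_def less_imp_le)
    have iF: "integrable lebesgue (\<lambda>\<xi>. (norm (fourier v \<xi>))\<^sup>2)" by (intro L2_integrable fourier_in_L2 vL)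
    have iG: "integrable lebesgue (\<lambda>\<xi>. (norm (riesz_hat s v \<xi>))\<^sup>2)" by (intro L2_integrable riesz_hat_L2 v s)
    have iB: "integrable lebesgue (indicat_real (ball (0::real^'n) r))"
      using bounded_emeasure_lebesgue[of "ball (0::real^'n) r"] by simp
    let ?h = "\<lambda>\<xi>. (K * norm_L2 lebesgue v)\<^sup>2 * indicat_real (ball 0 r) \<xi> + (1 / r powr s)\<^sup>2 * (norm (riesz_hat s v \<xi>))\<^sup>2"
    have "(norm_L2 lebesgue v)\<^sup>2 = (LINT \<xi>|lebesgue. (norm (fourier v \<xi>))\<^sup>2)"
      unfolding norm_L2_sq[symmetric] by (simp add: norm_L2_fourier vL)
    also have "\<dots> \<le> (LINT \<xi>|lebesgue. ?h \<xi>)"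
    proof (rule integral_mono_AE[OF iF])
      show "integrable lebesgue ?h" using iG iB by simp
      show "AE \<xi> in lebesgue. (norm (fourier v \<xi>))\<^sup>2 \<le> ?h \<xi>"
        using fb(2)
      proof eventually_elim
        case (elim \<xi>)
        show ?case
        proof (cases "norm \<xi> < r")
          case True
          have "(norm (fourier v \<xi>))\<^sup>2 \<le> (K * norm_L2 lebesgue v)\<^sup>2"
            unfolding elim using fb(3) by (intro power_mono) auto
          also have "\<dots> \<le> ?h \<xi>" using True by simp
          finally show ?thesis .
        next
          case False
          have "r powr s \<le> norm \<xi> powr s" using False r s by (intro powr_mono2) auto
          then have "1 * norm (fourier v \<xi>) \<le> (1 / r powr s * norm \<xi> powr s) * norm (fourier v \<xi>)"
            using r by (intro mult_right_mono) (auto simp: divide_simps)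
          then have "norm (fourier v \<xi>) \<le> 1 / r powr s * norm (riesz_hat s v \<xi>)"
            by (simp add: riesz_hat_def)
          then have "(norm (fourier v \<xi>))\<^sup>2 \<le> (1 / r powr s * norm (riesz_hat s v \<xi>))\<^sup>2"
            by (intro power_mono) auto
          also have "\<dots> \<le> ?h \<xi>" using False by (simp add: power_mult_distrib power_divide)
          finally show ?thesis .
        qed
      qed
    qed
    also have "\<dots> = (K * norm_L2 lebesgue v)\<^sup>2 * measure lebesgue (ball (0::real^'n) r) + (1 / r powr s)\<^sup>2 * (norm_L2 lebesgue (riesz_hat s v))\<^sup>2"
      using iG iB by (simp add: norm_L2_sq)
    also have "(K * norm_L2 lebesgue v)\<^sup>2 * measure lebesgue (ball (0::real^'n) r) \<le> 1/2 * (norm_L2 lebesgue v)\<^sup>2"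
      using mult_right_mono[OF K2, of "(norm_L2 lebesgue v)\<^sup>2"] by (simp add: power_mult_distrib mult_ac)
    finally have L: "(norm_L2 lebesgue v)\<^sup>2 \<le> A * (norm_L2 lebesgue (riesz_hat s v))\<^sup>2" by (simp add: A_def)
    have "(Hs_norm s v)\<^sup>2 = (LINT \<xi>|lebesgue. (norm (bessel_hat s v \<xi>))\<^sup>2)" by (simp add: Hs_norm_eq norm_L2_sq)
    also have "\<dots> \<le> (LINT \<xi>|lebesgue. 2 powr s * ((norm (fourier v \<xi>))\<^sup>2 + (norm (riesz_hat s v \<xi>))\<^sup>2))"
    proof (rule integral_mono)
      fix \<xi> :: "real^'n"
      show "(norm (bessel_hat s v \<xi>))\<^sup>2 \<le> 2 powr s * ((norm (fourier v \<xi>))\<^sup>2 + (norm (riesz_hat s v \<xi>))\<^sup>2)"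
        using mult_right_mono[OF weight_split[OF s norm_ge_zero[of \<xi>]], of "(norm (fourier v \<xi>))\<^sup>2"]
        unfolding norm_bessel_hat_sq by (simp add: riesz_hat_def power_mult_distrib algebra_simps)
    qed (use iF iG L2_integrable[OF Hs_bessel_hat_L2[OF v]] in auto)
    also have "\<dots> = 2 powr s * ((norm_L2 lebesgue v)\<^sup>2 + (norm_L2 lebesgue (riesz_hat s v))\<^sup>2)"
      using iF iG norm_L2_fourier[OF vL] by (simp add: norm_L2_sq flip: norm_L2_sq[of _ "fourier v"] norm_L2_sq[of _ v])
    also have "\<dots> \<le> 2 powr s * (A * (norm_L2 lebesgue (riesz_hat s v))\<^sup>2 + (norm_L2 lebesgue (riesz_hat s v))\<^sup>2)"
      using L by (intro mult_left_mono) auto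
    finally show ?thesis by (simp add: algebra_simps)
  qed
  show ?thesis
  proof (intro exI[of _ "sqrt (2 powr s * (A + 1))"] conjI allI impI)
    fix v :: "real^'n \<Rightarrow> real" assume "v \<in> Hs s" "AE x in lebesgue. R < norm x \<longrightarrow> v x = 0"
    from real_sqrt_le_mono[OF main[OF this]]
    show "Hs_norm s v \<le> sqrt (2 powr s * (A + 1)) * norm_L2 lebesgue (riesz_hat s v)"
      by (simp add: real_sqrt_mult)
  qed (simp add: A_def)
qed

text \<open>A multiplier of modulus at most 1 does not enlarge the weighted transform. Translations,
  and averages of translations such as mollification, are of this kind.\<close>

lemma Hs_multiplier:
  assumes v: "v \<in> Hs s" and w: "w \<in> L2 lebesgue"
    and m: "AE \<xi> in lebesgue. fourier w \<xi> = m \<xi> * fourier v \<xi>" and le: "\<And>\<xi>. norm (m \<xi>) \<le> 1"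
  shows "w \<in> Hs s"
proof -
  have "AE \<xi> in lebesgue. norm (bessel_hat s w \<xi>) \<le> 1 * norm (bessel_hat s v \<xi>)"
    using m
  proof eventually_elim
    case (elim \<xi>)
    show ?case using mult_right_mono[OF le[of \<xi>] norm_ge_zero[of "fourier v \<xi>"]]
      by (simp add: bessel_hat_def elim norm_mult mult_left_mono)
  qed
  then have "bessel_hat s w \<in> L2 lebesgue"
    by (intro L2_dominate(1)[OF Hs_bessel_hat_L2[OF v] bessel_hat_measurable[OF w], of 1]) auto
  then show ?thesis using w by (simp add: Hs_iff)
qed

text \<open>Dominated convergence in frequency, with the weighted transform of \<open>v\<close> as
  majorant.\<close>

lemma Hs_multiplier_tendsto:
  fixes w :: "nat \<Rightarrow> real^'n \<Rightarrow> real"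
  assumes v: "v \<in> Hs s" and w: "\<And>n. w n \<in> L2 lebesgue"
    and m: "\<And>n. AE \<xi> in lebesgue. fourier (w n) \<xi> = m n \<xi> * fourier v \<xi>"
    and le: "\<And>n \<xi>. norm (m n \<xi>) \<le> 1" and lim: "\<And>\<xi>. (\<lambda>n. m n \<xi>) \<longlonglongrightarrow> 1"
  shows "(\<lambda>n. Hs_norm s (\<lambda>x. w n x - v x)) \<longlonglongrightarrow> 0"
  unfolding Hs_norm_diff[OF Hs_multiplier[OF v w m le] v]
proof (rule L2_dominated_convergence(2)[OF bessel_hat_measurable[OF w] bessel_hat_measurable[OF Hs_L2[OF v]] Hs_bessel_hat_L2[OF v]])
  show "AE \<xi> in lebesgue. norm (bessel_hat s (w n) \<xi>) \<le> norm (bessel_hat s v \<xi>)" for n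
    using m[of n]
  proof eventually_elim
    case (elim \<xi>)
    show ?case using mult_right_mono[OF le[of n \<xi>] norm_ge_zero[of "fourier v \<xi>"]]
      by (simp add: bessel_hat_def elim norm_mult mult_left_mono)
  qed
  have "AE \<xi> in lebesgue. \<forall>n. fourier (w n) \<xi> = m n \<xi> * fourier v \<xi>" using m by (simp add: AE_all_countable)
  then show "AE \<xi> in lebesgue. (\<lambda>n. bessel_hat s (w n) \<xi>) \<longlonglongrightarrow> bessel_hat s v \<xi>"
  proof eventually_elim
    case (elim \<xi>)
    have "(\<lambda>n. ((1 + (norm \<xi>)\<^sup>2) powr (s/2)) *\<^sub>R (m n \<xi> * fourier v \<xi>)) \<longlonglongrightarrow> ((1 + (norm \<xi>)\<^sup>2) powr (s/2)) *\<^sub>R (1 * fourier v \<xi>)"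
      by (intro tendsto_intros lim)
    then show ?case using elim by (simp add: bessel_hat_def)
  qed
qed

lemma Hs_shift:
  assumes v: "v \<in> Hs s" shows "(\<lambda>x. v (x + h)) \<in> Hs s"
  by (rule Hs_multiplier[OF v L2_shift[OF Hs_L2[OF v]] fourier_shift[OF Hs_L2[OF v]]]) simp

lemma Hs_shift_tendsto:
  fixes h :: "nat \<Rightarrow> real^'n"
  assumes v: "v \<in> Hs s" and h: "h \<longlonglongrightarrow> 0"
  shows "(\<lambda>n. Hs_norm s (\<lambda>x. v (x + h n) - v x)) \<longlonglongrightarrow> 0"
proof (rule Hs_multiplier_tendsto[OF v L2_shift[OF Hs_L2[OF v]] fourier_shift[OF Hs_L2[OF v]]])
  fix \<xi> :: "real^'n"
  have "(\<lambda>n. cis (h n \<bullet> \<xi>)) \<longlonglongrightarrow> cis (0 \<bullet> \<xi>)" by (intro tendsto_intros h)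
  then show "(\<lambda>n. cis (h n \<bullet> \<xi>)) \<longlonglongrightarrow> 1" by simp
qed simp

subsection \<open>Dyadic differences\<close>

text \<open>Summability of \<open>4\<^sup>s\<^sup>k \<parallel>v(\<cdot> + 2\<^sup>-\<^sup>k b) - v\<parallel>\<^sup>2\<close> over \<open>k\<close> and the basis vectors \<open>b\<close> characterises \<open>Hs s\<close> for
  \<open>0 < s < 1\<close>. It plays the role of the Gagliardo seminorm and shows that Lipschitz functions are
  multipliers.\<close>

lemma norm_cis_minus_1: "(norm (cis t - 1))\<^sup>2 = 2 - 2 * cos t"
proof -
  have "(norm (cis t - 1))\<^sup>2 = (cos t - 1)\<^sup>2 + (sin t)\<^sup>2" by (simp add: cmod_power2)
  also have "\<dots> = 2 - 2 * cos t" using sin_cos_squared_add[of t] by (simp add: power2_diff)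
  finally show ?thesis .
qed

lemma norm_cis_minus_1_le: "(norm (cis t - 1))\<^sup>2 \<le> 4" "(norm (cis t - 1))\<^sup>2 \<le> t\<^sup>2"
proof -
  show "(norm (cis t - 1))\<^sup>2 \<le> 4" unfolding norm_cis_minus_1 using cos_ge_minus_one[of t] by linarith
  have "2 - 2 * cos t = 4 * (sin (t/2))\<^sup>2"
    using cos_double_sin[of "t/2"] by simp
  also have "\<dots> \<le> 4 * (t/2)\<^sup>2"
    using abs_sin_x_le_abs_x[of "t/2"] by (intro mult_left_mono) (auto simp: abs_le_square_iff[symmetric] simp del: power_divide)
  also have "\<dots> = t\<^sup>2" by (simp add: power_divide)
  finally show "(norm (cis t - 1))\<^sup>2 \<le> t\<^sup>2" unfolding norm_cis_minus_1 .
qed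

text \<open>The interval from 1 to 2 lies where cosine decreases, because 2 is at most pi.\<close>

lemma norm_cis_minus_1_ge: "1 \<le> \<bar>t\<bar> \<Longrightarrow> \<bar>t\<bar> \<le> 2 \<Longrightarrow> 2 - 2 * cos 1 \<le> (norm (cis t - 1))\<^sup>2"
  unfolding norm_cis_minus_1 using cos_monotone_0_pi_le[of 1 "\<bar>t\<bar>"] pi_ge_two by simp

lemma cos_1_less_1: "cos 1 < (1::real)"
  using cos_monotone_0_pi[of 0 1] pi_ge_two by simp

text \<open>The invariant of the induction on \<open>j\<close> comes from \<open>S (2 x) = \<bar>cis (2 x) - 1\<bar>\<^sup>2 + q S x\<close>.\<close>

lemma dyadic_sum_le:
  fixes q :: real
  assumes q: "1 < q" "q < 4"
  shows "\<bar>x\<bar> \<le> 2 ^ j \<Longrightarrow> (\<Sum>k<N. q ^ k * (norm (cis (x / 2 ^ k) - 1))\<^sup>2)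
     \<le> (1 / (1 - q/4) + 4 / (q - 1)) * q ^ j - 4 / (q - 1)"
proof (induction j arbitrary: x N)
  case 0
  \<comment> \<open>Base range: the quadratic bound near 0 makes each term at most
    \<open>(q/4) ^ k\<close>, and the sum of this geometric series is the first constant.\<close>
  have "(\<Sum>k<N. q ^ k * (norm (cis (x / 2 ^ k) - 1))\<^sup>2) \<le> (\<Sum>k<N. (q/4) ^ k)"
  proof (rule sum_mono)
    fix k
    have "(norm (cis (x / 2 ^ k) - 1))\<^sup>2 \<le> (x / 2 ^ k)\<^sup>2" by (rule norm_cis_minus_1_le)
    also have "\<dots> \<le> (1 / 2 ^ k)\<^sup>2" using 0 by (intro power2_le_iff_abs_le[THEN iffD2]) (auto simp: divide_right_mono)
    also have "\<dots> = (1/4) ^ k" by (simp add: power_divide power_mult[symmetric] mult.commute[of k] power_mult)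
    finally have "q ^ k * (norm (cis (x / 2 ^ k) - 1))\<^sup>2 \<le> q ^ k * (1/4) ^ k"
      using q by (intro mult_left_mono) auto
    then show "q ^ k * (norm (cis (x / 2 ^ k) - 1))\<^sup>2 \<le> (q/4) ^ k" by (simp add: power_divide)
  qed
  also have "\<dots> \<le> (\<Sum>k. (q/4) ^ k)"
    using q by (intro sum_le_suminf summable_geometric) auto
  also have "\<dots> = 1 / (1 - q/4)" using q by (intro suminf_geometric) auto
  finally show ?case by simp
next
  case (Suc j)
  let ?A = "1 / (1 - q/4) + 4 / (q - 1)"
  have "(\<Sum>k<N. q ^ k * (norm (cis (x / 2 ^ k) - 1))\<^sup>2) \<le> (\<Sum>k<Suc N. q ^ k * (norm (cis (x / 2 ^ k) - 1))\<^sup>2)"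
    using q by simp
  also have "\<dots> = (norm (cis x - 1))\<^sup>2 + (\<Sum>k<N. q ^ Suc k * (norm (cis (x / 2 ^ Suc k) - 1))\<^sup>2)"
    unfolding sum.lessThan_Suc_shift by simp
  also have "(\<Sum>k<N. q ^ Suc k * (norm (cis (x / 2 ^ Suc k) - 1))\<^sup>2) = q * (\<Sum>k<N. q ^ k * (norm (cis ((x/2) / 2 ^ k) - 1))\<^sup>2)"
    by (simp add: sum_distrib_left mult.assoc)
  also have "(norm (cis x - 1))\<^sup>2 + \<dots> \<le> 4 + q * (?A * q ^ j - 4 / (q - 1))"
    using q Suc.prems by (intro add_mono mult_left_mono Suc.IH norm_cis_minus_1_le) auto
  \<comment> \<open>The first term of the sum was bounded by 4, and \<open>4 / (q - 1)\<close> is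
    the c solving \<open>q * c - 4 = c\<close>; hence the invariant reproduces itself.\<close>
  also have "\<dots> = ?A * q ^ Suc j - 4 / (q - 1)"
  proof -
    have "4 - q * (4 / (q - 1)) = - (4 / (q - 1))" using q by (simp add: field_simps)
    then show ?thesis by (simp add: right_diff_distrib mult.assoc mult.left_commute)
  qed
  finally show ?case .
qed

lemma dyadic_bracket:
  fixes x :: real
  assumes "1 \<le> x" shows "\<exists>k. 2 ^ k \<le> x \<and> x < 2 ^ Suc k"
proof -
  obtain n where "x < 2 ^ n" using real_arch_pow[of 2 x] by auto
  moreover have "\<not> x < 2 ^ 0" using assms by simp
  ultimately obtain k where "k < n" "\<forall>i\<le>k. \<not> x < 2 ^ i" "x < 2 ^ Suc k"
    using ex_least_nat_less[of "\<lambda>n. x < 2 ^ n" n] by auto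
  then show ?thesis by (intro exI[of _ k]) (auto simp: not_less)
qed

lemma four_powr_pow: "((4::real) powr s) ^ k = ((2 ^ k)\<^sup>2) powr s"
proof -
  have "((4::real) powr s) ^ k = (4 ^ k) powr s"
    by (simp add: powr_realpow[symmetric] powr_powr mult.commute)
  also have "(4::real) ^ k = (2 ^ k)\<^sup>2" by (simp add: power_mult[symmetric] mult.commute[of k] power_mult)
  finally show ?thesis .
qed

lemma four_powr_bounds: "0 < s \<Longrightarrow> s < 1 \<Longrightarrow> 1 < (4::real) powr s" "0 < s \<Longrightarrow> s < 1 \<Longrightarrow> (4::real) powr s < 4"
  using powr_less_mono[of 0 s "4::real"] powr_less_mono[of s 1 "4::real"] by auto

text \<open>With s between 0 and 1, \<open>q = 4 powr s\<close> lies strictly between 1 and 4: the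
  fine scales form a convergent series, and the coarse ones grow geometrically up to the dyadic
  level \<open>j\<close> of x, where \<open>q ^ j\<close> is at most the weight.\<close>

lemma dyadic_upper:
  assumes s: "0 < s" "s < 1"
  shows "\<exists>A\<ge>0. \<forall>x N. (\<Sum>k<N. (4 powr s) ^ k * (norm (cis (x / 2 ^ k) - 1))\<^sup>2) \<le> A * (1 + x\<^sup>2) powr s"
proof -
  define q where "q = (4::real) powr s"
  have q: "1 < q" "q < 4" unfolding q_def by (rule four_powr_bounds[OF s])+
  define A where "A = 1 / (1 - q/4) + 4 / (q - 1)"
  have A: "0 \<le> A" using q by (simp add: A_def)
  have "(\<Sum>k<N. q ^ k * (norm (cis (x / 2 ^ k) - 1))\<^sup>2) \<le> A * q * (1 + x\<^sup>2) powr s" for x N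
  proof (cases "\<bar>x\<bar> \<le> 1")
    case True
    have "(\<Sum>k<N. q ^ k * (norm (cis (x / 2 ^ k) - 1))\<^sup>2) \<le> A * q ^ 0 - 4 / (q - 1)"
      unfolding A_def using True by (intro dyadic_sum_le q) auto
    also have "\<dots> \<le> A * (q * (1 + x\<^sup>2) powr s)"
    proof -
      have "1 \<le> (1 + x\<^sup>2) powr s" using s by (intro ge_one_powr_ge_zero) auto
      then have "1 * 1 \<le> q * (1 + x\<^sup>2) powr s" using q by (intro mult_mono) auto
      then have "A * 1 \<le> A * (q * (1 + x\<^sup>2) powr s)" using A by (intro mult_left_mono) auto
      moreover have "0 \<le> 4 / (q - 1)" using q by simp
      ultimately show ?thesis unfolding power_0 mult_1_right by linarith
    qed
    finally show ?thesis by (simp add: mult.assoc)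
  next
    case False
    then obtain j where j: "2 ^ j \<le> \<bar>x\<bar>" "\<bar>x\<bar> < 2 ^ Suc j" using dyadic_bracket[of "\<bar>x\<bar>"] by auto
    have "(\<Sum>k<N. q ^ k * (norm (cis (x / 2 ^ k) - 1))\<^sup>2) \<le> A * q ^ Suc j - 4 / (q - 1)"
      unfolding A_def using j by (intro dyadic_sum_le q) auto
    also have "\<dots> \<le> A * (q * q ^ j)" using q by simp
    also have "q ^ j \<le> (1 + x\<^sup>2) powr s"
    proof -
      have "(2 ^ j)\<^sup>2 \<le> \<bar>x\<bar>\<^sup>2" using j by (intro power_mono) auto
      then show ?thesis unfolding q_def four_powr_pow using s by (intro powr_mono2) auto
    qed
    then have "A * (q * q ^ j) \<le> A * (q * (1 + x\<^sup>2) powr s)" using A q by (intro mult_left_mono) auto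
    finally show ?thesis by (simp add: mult.assoc)
  qed
  then show ?thesis using A q unfolding q_def[symmetric] by (intro exI[of _ "A * q"]) auto
qed

text \<open>One scale is enough: the k for which \<open>\<bar>x\<bar> / 2 ^ k\<close> lies between 1
  and 2 keeps the phase away from 1.\<close>

lemma dyadic_lower:
  assumes s: "0 < s" "s < 1"
  shows "\<exists>c>0. \<forall>x. 1 \<le> \<bar>x\<bar> \<longrightarrow> (\<exists>k. (x\<^sup>2) powr s \<le> c * ((4 powr s) ^ k * (norm (cis (x / 2 ^ k) - 1))\<^sup>2))"
proof -
  define c where "c = 2 - 2 * cos (1::real)"
  have c: "0 < c" using cos_1_less_1 by (simp add: c_def)
  have "\<exists>k. (x\<^sup>2) powr s \<le> 4 powr s / c * ((4 powr s) ^ k * (norm (cis (x / 2 ^ k) - 1))\<^sup>2)" if x: "1 \<le> \<bar>x\<bar>" for x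
  proof -
    obtain k where k: "2 ^ k \<le> \<bar>x\<bar>" "\<bar>x\<bar> < 2 ^ Suc k" using dyadic_bracket[OF x] by auto
    have "\<bar>x\<bar>\<^sup>2 \<le> (2 ^ Suc k)\<^sup>2" using k by (intro power_mono) auto
    then have "(x\<^sup>2) powr s \<le> ((2 ^ Suc k)\<^sup>2) powr s" using s by (intro powr_mono2) auto
    also have "\<dots> = 4 powr s * (4 powr s) ^ k" unfolding four_powr_pow[symmetric] by simp
    also have "\<dots> = 4 powr s / c * ((4 powr s) ^ k * c)" using c by simp
    also have "\<dots> \<le> 4 powr s / c * ((4 powr s) ^ k * (norm (cis (x / 2 ^ k) - 1))\<^sup>2)"
      unfolding c_def using k c by (intro mult_left_mono norm_cis_minus_1_ge) (auto simp: divide_simps c_def)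
    finally show ?thesis by blast
  qed
  then show ?thesis using c by (intro exI[of _ "4 powr s / c"]) auto
qed

text \<open>Translation by \<open>h\<close> multiplies the transform by
  \<open>cis (h \<bullet> \<xi>)\<close>, so Plancherel turns a difference into a weight in
  frequency.\<close>

lemma
  fixes v :: "real^'n \<Rightarrow> real"
  assumes v: "v \<in> L2 lebesgue"
  shows shift_diff_integrable: "integrable lebesgue (\<lambda>\<xi>. (norm (cis (h \<bullet> \<xi>) - 1))\<^sup>2 * (norm (fourier v \<xi>))\<^sup>2)"
    and shift_diff_sq: "(norm_L2 lebesgue (\<lambda>x. v (x + h) - v x))\<^sup>2 = (LINT \<xi>|lebesgue. (norm (cis (h \<bullet> \<xi>) - 1))\<^sup>2 * (norm (fourier v \<xi>))\<^sup>2)"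
proof -
  let ?w = "\<lambda>x. v (x + h) - v x"
  have w: "?w \<in> L2 lebesgue" by (intro L2_diff L2_shift v)
  have F: "AE \<xi> in lebesgue. (norm (fourier ?w \<xi>))\<^sup>2 = (norm (cis (h \<bullet> \<xi>) - 1))\<^sup>2 * (norm (fourier v \<xi>))\<^sup>2"
    using fourier_diff[OF L2_shift[OF v] v, of h] fourier_shift[OF v, of h]
  proof eventually_elim
    case (elim \<xi>)
    have "fourier ?w \<xi> = (cis (h \<bullet> \<xi>) - 1) * fourier v \<xi>" using elim by (simp add: left_diff_distrib)
    then show ?case by (simp add: norm_mult power_mult_distrib)
  qed
  have [measurable]: "(\<lambda>\<xi>. cis (h \<bullet> \<xi>)) \<in> borel_measurable lebesgue"
    using cis_inner_measurable(4)[of h] by (simp add: inner_commute)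
  have m: "(\<lambda>\<xi>. (norm (cis (h \<bullet> \<xi>) - 1))\<^sup>2 * (norm (fourier v \<xi>))\<^sup>2) \<in> borel_measurable lebesgue"
    using fourier_measurable[OF v] by measurable
  have i: "integrable lebesgue (\<lambda>\<xi>. (norm (fourier ?w \<xi>))\<^sup>2)" by (intro L2_integrable fourier_in_L2 w)
  then show "integrable lebesgue (\<lambda>\<xi>. (norm (cis (h \<bullet> \<xi>) - 1))\<^sup>2 * (norm (fourier v \<xi>))\<^sup>2)"
    using integrable_cong_AE[OF _ m F] by auto
  have "(norm_L2 lebesgue ?w)\<^sup>2 = (LINT \<xi>|lebesgue. (norm (fourier ?w \<xi>))\<^sup>2)"
    by (simp add: norm_L2_fourier[OF w, symmetric] norm_L2_sq)
  also have "\<dots> = (LINT \<xi>|lebesgue. (norm (cis (h \<bullet> \<xi>) - 1))\<^sup>2 * (norm (fourier v \<xi>))\<^sup>2)"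
    by (rule integral_cong_AE[OF _ m F]) (use i in auto)
  finally show "(norm_L2 lebesgue ?w)\<^sup>2 = (LINT \<xi>|lebesgue. (norm (cis (h \<bullet> \<xi>) - 1))\<^sup>2 * (norm (fourier v \<xi>))\<^sup>2)" .
qed

lemma inner_scaled_Basis: "((1 / 2 ^ k) *\<^sub>R b) \<bullet> \<xi> = (\<xi> \<bullet> b) / 2 ^ k" for \<xi> b :: "real^'n"
  by (simp add: inner_commute)

text \<open>Under Plancherel the partial sums become integrals of the sums bounded by
  \<open>dyadic_upper\<close>, taken at the coordinate \<open>\<xi> \<bullet> b\<close>.\<close>

lemma Hs_imp_summable_differences:
  fixes v :: "real^'n \<Rightarrow> real"
  assumes v: "v \<in> Hs s" and s: "0 < s" "s < 1" and b: "b \<in> Basis"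
  shows "summable (\<lambda>k. (4 powr s) ^ k * (norm_L2 lebesgue (\<lambda>x. v (x + (1 / 2 ^ k) *\<^sub>R b) - v x))\<^sup>2)"
proof -
  obtain A where A: "0 \<le> A" "\<And>x N. (\<Sum>k<N. (4 powr s) ^ k * (norm (cis (x / 2 ^ k) - 1))\<^sup>2) \<le> A * (1 + x\<^sup>2) powr s"
    using dyadic_upper[OF s] by auto
  have vL: "v \<in> L2 lebesgue" by (rule Hs_L2[OF v])
  let ?P = "\<lambda>k \<xi>. (norm (cis ((\<xi> \<bullet> b) / 2 ^ k) - 1))\<^sup>2"
  have i: "integrable lebesgue (\<lambda>\<xi>. ?P k \<xi> * (norm (fourier v \<xi>))\<^sup>2)" for k
    using shift_diff_integrable[OF vL, of "(1 / 2 ^ k) *\<^sub>R b"] unfolding inner_scaled_Basis .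
  show ?thesis
  proof (rule summableI_nonneg_bounded)
    fix N
    have "(\<Sum>k<N. (4 powr s) ^ k * (norm_L2 lebesgue (\<lambda>x. v (x + (1 / 2 ^ k) *\<^sub>R b) - v x))\<^sup>2)
       = (LINT \<xi>|lebesgue. (\<Sum>k<N. (4 powr s) ^ k * (?P k \<xi> * (norm (fourier v \<xi>))\<^sup>2)))"
      unfolding shift_diff_sq[OF vL] inner_scaled_Basis using i by (simp add: Bochner_Integration.integral_sum)
    also have "\<dots> \<le> (LINT \<xi>|lebesgue. A * (norm (bessel_hat s v \<xi>))\<^sup>2)"
    proof (rule integral_mono)
      fix \<xi> :: "real^'n"
      have "(\<Sum>k<N. (4 powr s) ^ k * (?P k \<xi> * (norm (fourier v \<xi>))\<^sup>2)) = (\<Sum>k<N. (4 powr s) ^ k * ?P k \<xi>) * (norm (fourier v \<xi>))\<^sup>2"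
        by (simp add: sum_distrib_right mult.assoc)
      also have "\<dots> \<le> (A * (1 + (\<xi> \<bullet> b)\<^sup>2) powr s) * (norm (fourier v \<xi>))\<^sup>2"
        by (intro mult_right_mono A) auto
      also have "\<dots> \<le> (A * (1 + (norm \<xi>)\<^sup>2) powr s) * (norm (fourier v \<xi>))\<^sup>2"
      proof -
        have "(\<xi> \<bullet> b)\<^sup>2 \<le> (norm \<xi>)\<^sup>2"
          using Basis_le_norm[OF b, of \<xi>] by (metis abs_norm_cancel abs_le_square_iff)
        then show ?thesis using s A by (intro mult_right_mono mult_left_mono powr_mono2) auto
      qed
      finally show "(\<Sum>k<N. (4 powr s) ^ k * (?P k \<xi> * (norm (fourier v \<xi>))\<^sup>2)) \<le> A * (norm (bessel_hat s v \<xi>))\<^sup>2"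
        by (simp add: norm_bessel_hat_sq mult.assoc)
    qed (use i L2_integrable[OF Hs_bessel_hat_L2[OF v]] in auto)
    finally show "(\<Sum>k<N. (4 powr s) ^ k * (norm_L2 lebesgue (\<lambda>x. v (x + (1 / 2 ^ k) *\<^sub>R b) - v x))\<^sup>2) \<le> (LINT \<xi>|lebesgue. A * (norm (bessel_hat s v \<xi>))\<^sup>2)" .
  qed simp
qed

lemma ennreal_le_suminf: "e k \<le> (\<Sum>k. e k)" for e :: "nat \<Rightarrow> ennreal"
  using sum_le_suminf[of e "{k}"] by simp

text \<open>The largest coordinate of the frequency controls its norm up to the dimension. If it is
  below 1 the weight is bounded; otherwise \<open>dyadic_lower\<close> finds one scale whose term
  bounds the weight. Adding the terms for all \<open>b\<close> and \<open>k\<close> avoids choosing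
  them measurably in \<xi>.\<close>

lemma Hs_if_summable_differences:
  fixes v :: "real^'n \<Rightarrow> real"
  assumes vL: "v \<in> L2 lebesgue" and s: "0 < s" "s < 1"
    and sm: "\<And>b. b \<in> Basis \<Longrightarrow> summable (\<lambda>k. (4 powr s) ^ k * (norm_L2 lebesgue (\<lambda>x. v (x + (1 / 2 ^ k) *\<^sub>R b) - v x))\<^sup>2)"
  shows "v \<in> Hs s"
proof -
  obtain c where c: "0 < c" "\<And>x. 1 \<le> \<bar>x\<bar> \<Longrightarrow> \<exists>k. (x\<^sup>2) powr s \<le> c * ((4 powr s) ^ k * (norm (cis (x / 2 ^ k) - 1))\<^sup>2)"
    using dyadic_lower[OF s] by auto
  let ?P = "\<lambda>b k \<xi>. (norm (cis ((\<xi> \<bullet> b) / 2 ^ k) - 1))\<^sup>2"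
  let ?T = "\<lambda>b k \<xi>. (4 powr s) ^ k * (?P b k \<xi> * (norm (fourier v \<xi>))\<^sup>2)"
  \<comment> \<open>\<open>B\<close> bounds the weight when all coordinates are at most 1, and is
    also the loss in passing from the norm to the largest coordinate; \<open>C\<close> covers both
    cases.\<close>
  define B where "B = (1 + real CARD('n)) powr s"
  define C where "C = B * (1 + c)"
  have B: "0 \<le> B" by (simp add: B_def)
  have C: "B \<le> C" "B * c \<le> C" "0 \<le> C" using B c by (auto simp: C_def distrib_left)
  have i: "integrable lebesgue (\<lambda>\<xi>. ?P b k \<xi> * (norm (fourier v \<xi>))\<^sup>2)" for k b
    using shift_diff_integrable[OF vL, of "(1 / 2 ^ k) *\<^sub>R b"] unfolding inner_scaled_Basis .
  have Tm: "?T b k \<in> borel_measurable lebesgue" for b k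
    using borel_measurable_integrable[OF i[of b k]] by measurable
  have Tint: "(\<integral>\<^sup>+\<xi>. ennreal (?T b k \<xi>) \<partial>lebesgue) = ennreal ((4 powr s) ^ k * (norm_L2 lebesgue (\<lambda>x. v (x + (1 / 2 ^ k) *\<^sub>R b) - v x))\<^sup>2)" for b k
    unfolding shift_diff_sq[OF vL] inner_scaled_Basis using i[of b k]
    by (subst nn_integral_eq_integral) auto
  have ptw: "ennreal ((norm (bessel_hat s v \<xi>))\<^sup>2) \<le> ennreal C * (ennreal ((norm (fourier v \<xi>))\<^sup>2) + (\<Sum>b\<in>Basis. \<Sum>k. ennreal (?T b k \<xi>)))" for \<xi>
  proof -
    obtain b where b: "b \<in> Basis" "\<And>b'. b' \<in> Basis \<Longrightarrow> \<bar>\<xi> \<bullet> b'\<bar> \<le> \<bar>\<xi> \<bullet> b\<bar>"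
    proof -
      let ?S = "(\<lambda>b. \<bar>\<xi> \<bullet> b\<bar>) ` Basis"
      have "Max ?S \<in> ?S" by (intro Max_in) (auto simp: nonempty_Basis)
      then obtain b where "Max ?S = \<bar>\<xi> \<bullet> b\<bar>" "b \<in> Basis" by (rule imageE)
      moreover have "\<bar>\<xi> \<bullet> b'\<bar> \<le> Max ?S" if "b' \<in> Basis" for b' using that by (intro Max_ge) auto
      ultimately show ?thesis using that by metis
    qed
    have "(norm \<xi>)\<^sup>2 = (\<Sum>b'\<in>Basis. (\<xi> \<bullet> b')\<^sup>2)"
      by (subst power2_norm_eq_inner, subst euclidean_inner) (simp add: power2_eq_square)
    also have "\<dots> \<le> (\<Sum>b'\<in>(Basis::(real^'n) set). (\<xi> \<bullet> b)\<^sup>2)"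
      using b(2) by (intro sum_mono) (simp add: abs_le_square_iff)
    finally have n2: "(norm \<xi>)\<^sup>2 \<le> real CARD('n) * (\<xi> \<bullet> b)\<^sup>2" by simp
    show ?thesis
    proof (cases "\<bar>\<xi> \<bullet> b\<bar> < 1")
      case True
      then have "(\<xi> \<bullet> b)\<^sup>2 \<le> 1" by (simp add: abs_square_le_1)
      then have "real CARD('n) * (\<xi> \<bullet> b)\<^sup>2 \<le> real CARD('n) * 1" by (intro mult_left_mono) auto
      then have "1 + (norm \<xi>)\<^sup>2 \<le> 1 + real CARD('n)" using n2 by linarith
      then have "(1 + (norm \<xi>)\<^sup>2) powr s \<le> B"
        unfolding B_def using s by (intro powr_mono2) auto
      then have "(norm (bessel_hat s v \<xi>))\<^sup>2 \<le> C * (norm (fourier v \<xi>))\<^sup>2"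
        unfolding norm_bessel_hat_sq using C by (intro mult_right_mono) auto
      then have "ennreal ((norm (bessel_hat s v \<xi>))\<^sup>2) \<le> ennreal C * ennreal ((norm (fourier v \<xi>))\<^sup>2)"
        using C by (simp add: ennreal_mult[symmetric])
      also have "\<dots> \<le> ennreal C * (ennreal ((norm (fourier v \<xi>))\<^sup>2) + (\<Sum>b\<in>Basis. \<Sum>k. ennreal (?T b k \<xi>)))"
        by (intro mult_left_mono) auto
      finally show ?thesis .
    next
      case False
      then obtain k where k: "((\<xi> \<bullet> b)\<^sup>2) powr s \<le> c * ((4 powr s) ^ k * ?P b k \<xi>)" using c(2)[of "\<xi> \<bullet> b"] by auto
      have "1 \<le> (\<xi> \<bullet> b)\<^sup>2" using False by (simp add: abs_square_less_1 not_less[symmetric])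
      then have "1 + (norm \<xi>)\<^sup>2 \<le> (1 + real CARD('n)) * (\<xi> \<bullet> b)\<^sup>2" using n2 by (simp add: distrib_right)
      then have "(1 + (norm \<xi>)\<^sup>2) powr s \<le> B * ((\<xi> \<bullet> b)\<^sup>2) powr s"
        unfolding B_def using s by (subst powr_mult[symmetric]) (auto intro!: powr_mono2)
      also have "\<dots> \<le> B * (c * ((4 powr s) ^ k * ?P b k \<xi>))" using k B by (intro mult_left_mono)
      also have "\<dots> \<le> C * ((4 powr s) ^ k * ?P b k \<xi>)"
        using mult_right_mono[OF C(2), of "(4 powr s) ^ k * ?P b k \<xi>"] by (simp add: mult.assoc)
      finally have "(norm (bessel_hat s v \<xi>))\<^sup>2 \<le> C * ((4 powr s) ^ k * ?P b k \<xi>) * (norm (fourier v \<xi>))\<^sup>2"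
        unfolding norm_bessel_hat_sq by (intro mult_right_mono) auto
      also have "\<dots> = C * ?T b k \<xi>" by (simp add: mult.assoc)
      finally have 1: "ennreal ((norm (bessel_hat s v \<xi>))\<^sup>2) \<le> ennreal C * ennreal (?T b k \<xi>)"
        using C by (simp add: ennreal_mult[symmetric])
      have "ennreal (?T b k \<xi>) \<le> (\<Sum>k. ennreal (?T b k \<xi>))"
        by (rule ennreal_le_suminf)
      also have "\<dots> \<le> (\<Sum>b\<in>Basis. \<Sum>k. ennreal (?T b k \<xi>))"
        by (rule member_le_sum[OF b(1)]) simp_all
      also have "\<dots> \<le> ennreal ((norm (fourier v \<xi>))\<^sup>2) + (\<Sum>b\<in>Basis. \<Sum>k. ennreal (?T b k \<xi>))"
        by (rule add_increasing) simp_all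
      finally show ?thesis using 1 by (meson mult_left_mono order_trans zero_le)
    qed
  qed
  have fm: "(\<lambda>\<xi>. ennreal ((norm (fourier v \<xi>))\<^sup>2)) \<in> borel_measurable lebesgue"
    using fourier_measurable[OF vL] by measurable
  have Sm: "(\<lambda>\<xi>. \<Sum>k. ennreal (?T b k \<xi>)) \<in> borel_measurable lebesgue" for b
    by (intro borel_measurable_suminf_order measurable_compose[OF Tm measurable_ennreal])
  have "(\<integral>\<^sup>+\<xi>. ennreal ((norm (bessel_hat s v \<xi>))\<^sup>2) \<partial>lebesgue)
     \<le> (\<integral>\<^sup>+\<xi>. ennreal C * (ennreal ((norm (fourier v \<xi>))\<^sup>2) + (\<Sum>b\<in>Basis. \<Sum>k. ennreal (?T b k \<xi>))) \<partial>lebesgue)"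
    by (intro nn_integral_mono ptw)
  also have "\<dots> = ennreal C * ((\<integral>\<^sup>+\<xi>. ennreal ((norm (fourier v \<xi>))\<^sup>2) \<partial>lebesgue) + (\<Sum>b\<in>Basis. \<Sum>k. \<integral>\<^sup>+\<xi>. ennreal (?T b k \<xi>) \<partial>lebesgue))"
  proof -
    have "(\<integral>\<^sup>+\<xi>. (\<Sum>k. ennreal (?T b k \<xi>)) \<partial>lebesgue) = (\<Sum>k. \<integral>\<^sup>+\<xi>. ennreal (?T b k \<xi>) \<partial>lebesgue)" for b
      by (rule nn_integral_suminf) (rule measurable_compose[OF Tm measurable_ennreal])
    then have "(\<integral>\<^sup>+\<xi>. (\<Sum>b\<in>Basis. \<Sum>k. ennreal (?T b k \<xi>)) \<partial>lebesgue) = (\<Sum>b\<in>Basis. \<Sum>k. \<integral>\<^sup>+\<xi>. ennreal (?T b k \<xi>) \<partial>lebesgue)"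
      by (subst nn_integral_sum[OF Sm]) (rule sum.cong[OF refl])
    then show ?thesis
      by (subst nn_integral_cmult[OF borel_measurable_add[OF fm borel_measurable_sum[OF Sm]]],
          subst nn_integral_add[OF fm borel_measurable_sum[OF Sm]]) (rule arg_cong)
  qed
  also have "\<dots> < \<infinity>"
  proof -
    have "(\<Sum>k. \<integral>\<^sup>+\<xi>. ennreal (?T b k \<xi>) \<partial>lebesgue) < \<infinity>" if "b \<in> Basis" for b
      unfolding Tint using sm[OF that] by (subst suminf_ennreal2) auto
    then have "(\<Sum>b\<in>Basis. \<Sum>k. \<integral>\<^sup>+\<xi>. ennreal (?T b k \<xi>) \<partial>lebesgue) < \<infinity>"
      by simp
    then show ?thesis
      unfolding nn_integral_L2[OF fourier_in_L2[OF vL]] by (simp add: ennreal_mult_less_top)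
  qed
  finally have "bessel_hat s v \<in> L2 lebesgue" by (intro L2_I_nn bessel_hat_measurable vL)
  then show ?thesis using vL by (simp add: Hs_iff)
qed

text \<open>The difference of a product splits as in the Leibniz rule. One part is at most
  \<open>B\<close> times a difference of \<open>v\<close>; in the other the Lipschitz bound
  contributes a factor of order \<open>(1/2) ^ k\<close>, so its terms form a geometric series of
  ratio \<open>4 powr s / 4\<close>, convergent because s is below 1.\<close>

lemma Hs_mult_Lipschitz:
  fixes v \<eta> :: "real^'n \<Rightarrow> real"
  assumes v: "v \<in> Hs s" and s: "0 < s" "s < 1"
    and B: "\<And>x. \<bar>\<eta> x\<bar> \<le> B" and L: "\<And>x y. \<bar>\<eta> x - \<eta> y\<bar> \<le> L * norm (x - y)"
  shows "(\<lambda>x. \<eta> x * v x) \<in> Hs s"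
proof -
  have vL: "v \<in> L2 lebesgue" by (rule Hs_L2[OF v])
  have B0: "0 \<le> B" using B[of 0] by linarith
  have L0: "0 \<le> L"
  proof -
    obtain b :: "real^'n" where "b \<in> Basis" using nonempty_Basis by blast
    then show ?thesis using L[of b 0] by simp
  qed
  have "L-lipschitz_on UNIV \<eta>" using L L0 by (intro lipschitz_onI) (auto simp: dist_norm)
  then have "continuous_on UNIV \<eta>" by (rule lipschitz_on_continuous_on)
  then have cm: "\<eta> \<in> borel_measurable lebesgue" by (rule continuous_lebesgue_measurable)
  have mL: "(\<lambda>x. \<eta> x * u x) \<in> L2 lebesgue" and mN: "norm_L2 lebesgue (\<lambda>x. \<eta> x * u x) \<le> B * norm_L2 lebesgue u"
    if u: "u \<in> L2 lebesgue" for u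
  proof -
    have "AE x in lebesgue. norm (\<eta> x * u x) \<le> B * norm (u x)"
      using B by (auto simp: abs_mult intro!: mult_right_mono)
    from L2_dominate[OF u _ B0 this] cm L2_measurable[OF u]
    show "(\<lambda>x. \<eta> x * u x) \<in> L2 lebesgue" "norm_L2 lebesgue (\<lambda>x. \<eta> x * u x) \<le> B * norm_L2 lebesgue u" by auto
  qed
  let ?n = "\<lambda>u h. norm_L2 lebesgue (\<lambda>x. u (x + h) - u x)"
  let ?w = "\<lambda>x. \<eta> x * v x"
  have le: "?n ?w h \<le> B * ?n v h + L * norm h * norm_L2 lebesgue v" for h
  proof -
    \<comment> \<open>The difference is first taken backwards, so that the bound for multiplication
      by the unshifted \<eta> applies; translating by \<open>h\<close> afterwards gives the forward
      one.\<close>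
    have 1: "(\<lambda>x. v x - v (x - h)) \<in> L2 lebesgue" using L2_diff[OF vL L2_shift[OF vL, of "-h"]] by simp
    have t1: "(\<lambda>x. \<eta> x * (v x - v (x - h))) \<in> L2 lebesgue" by (rule mL[OF 1])
    have t1': "(\<lambda>x. \<eta> (x + h) * (v (x + h) - v x)) \<in> L2 lebesgue"
      "norm_L2 lebesgue (\<lambda>x. \<eta> (x + h) * (v (x + h) - v x)) \<le> B * ?n v h"
      using L2_shift[OF t1, of h] norm_L2_shift[OF t1, of h] mN[OF 1] norm_L2_shift[OF 1, of h] by simp_all
    have "AE x in lebesgue. norm ((\<eta> (x + h) - \<eta> x) * v x) \<le> (L * norm h) * norm (v x)"
    proof (rule AE_I2)
      fix x show "norm ((\<eta> (x + h) - \<eta> x) * v x) \<le> (L * norm h) * norm (v x)"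
        using mult_right_mono[OF L[of "x + h" x], of "\<bar>v x\<bar>"] by (simp add: abs_mult)
    qed
    from L2_dominate[OF vL _ _ this]
    have t2: "(\<lambda>x. (\<eta> (x + h) - \<eta> x) * v x) \<in> L2 lebesgue"
       "norm_L2 lebesgue (\<lambda>x. (\<eta> (x + h) - \<eta> x) * v x) \<le> (L * norm h) * norm_L2 lebesgue v"
      using L0 borel_measurable_lebesgue_shift[OF cm, of h] cm L2_measurable[OF vL]
      by auto
    have "?n ?w h = norm_L2 lebesgue (\<lambda>x. \<eta> (x + h) * (v (x + h) - v x) + (\<eta> (x + h) - \<eta> x) * v x)"
      by (simp add: algebra_simps)
    also have "\<dots> \<le> B * ?n v h + L * norm h * norm_L2 lebesgue v"
      using norm_L2_triangle[OF t1'(1) t2(1)] t1'(2) t2(2) by linarith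
    finally show ?thesis .
  qed
  show ?thesis
  proof (rule Hs_if_summable_differences[OF mL[OF vL] s])
    fix b :: "real^'n" assume b: "b \<in> Basis"
    let ?q = "4 powr s"
    have s1: "summable (\<lambda>k. ?q ^ k * (?n v ((1 / 2 ^ k) *\<^sub>R b))\<^sup>2)"
      by (rule Hs_imp_summable_differences[OF v s b])
    have s2: "summable (\<lambda>k. (?q / 4) ^ k)"
      using four_powr_bounds[OF s] by (intro summable_geometric) auto
    have s3: "summable (\<lambda>k. (2 * B\<^sup>2) * (?q ^ k * (?n v ((1 / 2 ^ k) *\<^sub>R b))\<^sup>2) + (2 * L\<^sup>2 * (norm_L2 lebesgue v)\<^sup>2) * (?q / 4) ^ k)"
      by (intro summable_add summable_mult s1 s2)
    show "summable (\<lambda>k. ?q ^ k * (?n ?w ((1 / 2 ^ k) *\<^sub>R b))\<^sup>2)"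
    proof (rule summable_comparison_test[OF _ s3], intro exI allI impI)
      fix k
      let ?h = "(1 / 2 ^ k) *\<^sub>R b"
      have nh: "norm ?h = 1 / 2 ^ k" using b by simp
      have "(?n ?w ?h)\<^sup>2 \<le> (B * ?n v ?h + L * norm ?h * norm_L2 lebesgue v)\<^sup>2"
        by (intro power_mono le) simp
      also have "\<dots> \<le> 2 * (B * ?n v ?h)\<^sup>2 + 2 * (L * norm ?h * norm_L2 lebesgue v)\<^sup>2"
        using norm_add_sq_le[of "B * ?n v ?h" "L * norm ?h * norm_L2 lebesgue v"]
        unfolding real_norm_def power2_abs .
      also have "\<dots> = 2 * B\<^sup>2 * (?n v ?h)\<^sup>2 + 2 * L\<^sup>2 * (norm_L2 lebesgue v)\<^sup>2 * (1/4) ^ k"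
        unfolding nh by (simp add: power_mult_distrib power_divide power_mult[symmetric] mult.commute[of k] power_mult[of 2 2])
      finally have "?q ^ k * (?n ?w ?h)\<^sup>2 \<le> ?q ^ k * (2 * B\<^sup>2 * (?n v ?h)\<^sup>2 + 2 * L\<^sup>2 * (norm_L2 lebesgue v)\<^sup>2 * (1/4) ^ k)"
        by (intro mult_left_mono) auto
      also have "\<dots> = (2 * B\<^sup>2) * (?q ^ k * (?n v ?h)\<^sup>2) + (2 * L\<^sup>2 * (norm_L2 lebesgue v)\<^sup>2) * (?q / 4) ^ k"
        by (simp add: distrib_left power_divide)
      finally show "norm (?q ^ k * (?n ?w ?h)\<^sup>2) \<le> (2 * B\<^sup>2) * (?q ^ k * (?n v ?h)\<^sup>2) + (2 * L\<^sup>2 * (norm_L2 lebesgue v)\<^sup>2) * (?q / 4) ^ k"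
        by simp
    qed
  qed
qed

subsection \<open>Smooth functions\<close>

lemma partial_eqI: "(\<phi> has_derivative D) (at x) \<Longrightarrow> partial i \<phi> x = D (axis i 1)"
  unfolding partial_def by (drule frechet_derivative_at) simp

lemma has_derivative_partial:
  fixes \<phi> :: "real^'n \<Rightarrow> real"
  assumes "\<phi> differentiable (at x)"
  shows "(\<phi> has_derivative (\<lambda>h. \<Sum>i\<in>UNIV. h $ i * partial i \<phi> x)) (at x)"
proof -
  obtain D where D: "(\<phi> has_derivative D) (at x)" using assms unfolding differentiable_def by blast
  then interpret bounded_linear D by (rule has_derivative_bounded_linear)
  have "D h = (\<Sum>i\<in>UNIV. h $ i * partial i \<phi> x)" for h
  proof -
    have "D h = D (\<Sum>i\<in>UNIV. h $ i *s axis i 1)" by (simp only: basis_expansion)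
    also have "\<dots> = (\<Sum>i\<in>UNIV. D (h $ i *\<^sub>R axis i 1))" by (simp add: sum scalar_mult_eq_scaleR)
    also have "\<dots> = (\<Sum>i\<in>UNIV. h $ i * partial i \<phi> x)" by (simp add: scaleR partial_eqI[OF D])
    finally show ?thesis .
  qed
  then have "D = (\<lambda>h. \<Sum>i\<in>UNIV. h $ i * partial i \<phi> x)" by (rule ext)
  then show ?thesis using D by simp
qed

lemma differentiable_imp_continuous:
  fixes \<phi> :: "real^'n \<Rightarrow> real"
  assumes "\<And>x. \<phi> differentiable (at x)" shows "continuous_on UNIV \<phi>"
  using assms by (simp add: continuous_on_eq_continuous_at differentiable_imp_continuous_within)

lemma Ck_Suc_imp: "Ck (Suc k) \<phi> \<Longrightarrow> Ck k \<phi>"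
proof (induction k arbitrary: \<phi>)
  case 0
  then show ?case by (simp add: differentiable_imp_continuous)
next
  case (Suc k)
  then show ?case by (metis Ck.simps(2))
qed

lemma partial_add:
  assumes "\<phi> differentiable (at x)" "\<psi> differentiable (at x)"
  shows "partial i (\<lambda>x. \<phi> x + \<psi> x) x = partial i \<phi> x + partial i \<psi> x"
proof -
  obtain D E where D: "(\<phi> has_derivative D) (at x)" "(\<psi> has_derivative E) (at x)"
    using assms unfolding differentiable_def by blast
  show ?thesis by (simp add: partial_eqI[OF has_derivative_add[OF D]] partial_eqI[OF D(1)] partial_eqI[OF D(2)])
qed

lemma partial_mult:
  assumes "\<phi> differentiable (at x)" "\<psi> differentiable (at x)"
  shows "partial i (\<lambda>x. \<phi> x * \<psi> x) x = \<phi> x * partial i \<psi> x + partial i \<phi> x * \<psi> x"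
proof -
  obtain D E where D: "(\<phi> has_derivative D) (at x)" "(\<psi> has_derivative E) (at x)"
    using assms unfolding differentiable_def by blast
  show ?thesis by (simp add: partial_eqI[OF has_derivative_mult[OF D]] partial_eqI[OF D(1)] partial_eqI[OF D(2)])
qed

lemma Ck_add: "Ck k \<phi> \<Longrightarrow> Ck k \<psi> \<Longrightarrow> Ck k (\<lambda>x. \<phi> x + \<psi> x)"
proof (induction k arbitrary: \<phi> \<psi>)
  case 0
  then show ?case by (simp add: continuous_on_add)
next
  case (Suc k)
  then have d: "\<And>x. \<phi> differentiable (at x)" "\<And>x. \<psi> differentiable (at x)" by auto
  have "partial i (\<lambda>x. \<phi> x + \<psi> x) = (\<lambda>x. partial i \<phi> x + partial i \<psi> x)" for i
    by (intro ext partial_add d)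
  then show ?case using Suc d by (auto intro: differentiable_add)
qed

lemma Ck_mult: "Ck k \<phi> \<Longrightarrow> Ck k \<psi> \<Longrightarrow> Ck k (\<lambda>x. \<phi> x * \<psi> x)"
proof (induction k arbitrary: \<phi> \<psi>)
  case 0
  then show ?case by (simp add: continuous_on_mult)
next
  case (Suc k)
  then have d: "\<And>x. \<phi> differentiable (at x)" "\<And>x. \<psi> differentiable (at x)" by auto
  have p: "Ck k (partial i \<phi>)" "Ck k (partial i \<psi>)" for i using Suc.prems by auto
  have "partial i (\<lambda>x. \<phi> x * \<psi> x) = (\<lambda>x. \<phi> x * partial i \<psi> x + partial i \<phi> x * \<psi> x)" for i
    by (intro ext partial_mult d)
  then have "Ck k (partial i (\<lambda>x. \<phi> x * \<psi> x))" for i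
    by (simp only:) (intro Ck_add Suc.IH p Ck_Suc_imp[OF Suc.prems(1)] Ck_Suc_imp[OF Suc.prems(2)])
  then show ?case using d by (auto intro: differentiable_mult)
qed

lemma Ck_const: "Ck k (\<lambda>x. c)"
proof (induction k arbitrary: c)
  case (Suc k)
  have "partial i (\<lambda>x. c) = (\<lambda>x. 0)" for i :: 'a
    by (intro ext) (simp add: partial_eqI[OF has_derivative_const])
  then show ?case using Suc by simp
qed simp

lemma Ck_inner: "Ck k (\<lambda>x. x \<bullet> \<xi>)"
proof (cases k)
  case (Suc l)
  have d: "((\<lambda>x. x \<bullet> \<xi>) has_derivative (\<lambda>h. h \<bullet> \<xi>)) (at x)" for x
    by (auto intro!: derivative_eq_intros)
  have "partial i (\<lambda>x. x \<bullet> \<xi>) = (\<lambda>x. axis i 1 \<bullet> \<xi>)" for i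
    by (intro ext partial_eqI d)
  then show ?thesis using Suc d by (auto simp: Ck_const differentiable_def)
qed (auto intro!: continuous_intros)

lemma Ck_nth: "Ck k (\<lambda>x. x $ i)"
  using Ck_inner[of k "axis i 1"] by (simp add: inner_axis)

lemma
  shows partial_cos: "partial i (\<lambda>x. cos (x \<bullet> \<xi>)) x = - (\<xi> $ i) * sin (x \<bullet> \<xi>)"
    and partial_sin: "partial i (\<lambda>x. sin (x \<bullet> \<xi>)) x = \<xi> $ i * cos (x \<bullet> \<xi>)"
    and differentiable_cos_inner: "(\<lambda>x. cos (x \<bullet> \<xi>)) differentiable (at x)"
    and differentiable_sin_inner: "(\<lambda>x. sin (x \<bullet> \<xi>)) differentiable (at x)"
proof -
  have c: "((\<lambda>x. cos (x \<bullet> \<xi>)) has_derivative (\<lambda>h. - (h \<bullet> \<xi>) * sin (x \<bullet> \<xi>))) (at x)"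
    and s: "((\<lambda>x. sin (x \<bullet> \<xi>)) has_derivative (\<lambda>h. (h \<bullet> \<xi>) * cos (x \<bullet> \<xi>))) (at x)"
    by (auto intro!: derivative_eq_intros)
  show "partial i (\<lambda>x. cos (x \<bullet> \<xi>)) x = - (\<xi> $ i) * sin (x \<bullet> \<xi>)"
    by (subst partial_eqI[OF c]) (simp add: inner_commute[of "axis i 1"] inner_axis)
  show "partial i (\<lambda>x. sin (x \<bullet> \<xi>)) x = \<xi> $ i * cos (x \<bullet> \<xi>)"
    by (subst partial_eqI[OF s]) (simp add: inner_commute[of "axis i 1"] inner_axis)
  show "(\<lambda>x. cos (x \<bullet> \<xi>)) differentiable (at x)" "(\<lambda>x. sin (x \<bullet> \<xi>)) differentiable (at x)"
    using c s unfolding differentiable_def by blast+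
qed

text \<open>Each derivative involves the other function, so one induction treats both.\<close>

lemma Ck_cos_sin: "Ck k (\<lambda>x. cos (x \<bullet> \<xi>)) \<and> Ck k (\<lambda>x. sin (x \<bullet> \<xi>))"
proof (induction k)
  case 0
  show ?case by (auto intro!: continuous_intros)
next
  case (Suc k)
  have "partial i (\<lambda>x. cos (x \<bullet> \<xi>)) = (\<lambda>x. (- (\<xi> $ i)) * sin (x \<bullet> \<xi>))"
    "partial i (\<lambda>x. sin (x \<bullet> \<xi>)) = (\<lambda>x. \<xi> $ i * cos (x \<bullet> \<xi>))" for i
    by (intro ext partial_cos partial_sin)+
  moreover have "Ck k (\<lambda>x. (- (\<xi> $ i)) * sin (x \<bullet> \<xi>))" "Ck k (\<lambda>x. \<xi> $ i * cos (x \<bullet> \<xi>))" for i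
    using Suc by - (rule Ck_mult[OF Ck_const], simp)+
  ultimately show ?case
    by (simp only: Ck.simps) (simp add: differentiable_cos_inner differentiable_sin_inner)
qed

subsection \<open>A smooth bump function\<close>

text \<open>For \<open>m = 0\<close> this is the standard flat function exp(-1/t). The powers of 1/t
  make the family closed under differentiation up to linear combinations.\<close>

definition flat_exp :: "nat \<Rightarrow> real \<Rightarrow> real" where
  "flat_exp m t = (if 0 < t then (1 / t) ^ m * exp (- (1 / t)) else 0)"

lemma flat_exp_nonneg: "0 \<le> flat_exp m t"
  by (simp add: flat_exp_def)

text \<open>A single term of the exponential series at \<open>1 / t\<close> beats the power of
  \<open>1 / t\<close> with one power to spare, and that power leaves the factor t.\<close>

lemma flat_exp_le: "\<bar>flat_exp m t\<bar> \<le> fact (m + 1) * \<bar>t\<bar>"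
proof (cases "0 < t")
  case True
  let ?y = "1 / t"
  have y: "0 < ?y" using True by simp
  have "(\<Sum>n\<in>{m+1}. ?y ^ n /\<^sub>R fact n) \<le> (\<Sum>n. ?y ^ n /\<^sub>R fact n)"
    using y by (intro sum_le_suminf summable_exp_generic) auto
  then have "?y ^ (m + 1) / fact (m + 1) \<le> exp ?y"
    by (simp add: exp_def divide_inverse_commute)
  then have "?y ^ (m + 1) \<le> fact (m + 1) * exp ?y" by (simp only: pos_divide_le_eq[OF fact_gt_zero] mult.commute)
  then have "?y ^ (m + 1) * exp (- ?y) \<le> fact (m + 1) * exp ?y * exp (- ?y)"
    by (intro mult_right_mono) auto
  also have "\<dots> = fact (m + 1)" by (simp add: mult.assoc flip: exp_add)
  finally have "t * (?y ^ (m + 1) * exp (- ?y)) \<le> t * fact (m + 1)" using True by (intro mult_left_mono) auto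
  moreover have "t * (?y ^ (m + 1) * exp (- ?y)) = ?y ^ m * exp (- ?y)" using True by simp
  ultimately show ?thesis using True by (simp add: flat_exp_def mult.commute abs_mult)
next
  case False
  then have "\<bar>flat_exp m t\<bar> = 0" by (simp add: flat_exp_def)
  moreover have "0 \<le> fact (m + 1) * \<bar>t\<bar>" by (intro mult_nonneg_nonneg) auto
  ultimately show ?thesis by linarith
qed

lemma flat_exp_Suc: "flat_exp m t = t * flat_exp (Suc m) t"
  by (simp add: flat_exp_def)

lemma flat_exp_DERIV:
  "(flat_exp m has_real_derivative (- real m * flat_exp (m + 1) t + flat_exp (m + 2) t)) (at t)"
proof (cases t "0::real" rule: linorder_cases)
  case less
  have "((\<lambda>_. 0) has_real_derivative 0) (at t)" by simp
  then have "(flat_exp m has_real_derivative 0) (at t)"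
    by (rule has_field_derivative_transform_within_open[where S="{..<0}"]) (use less in \<open>auto simp: flat_exp_def\<close>)
  then show ?thesis using less by (simp add: flat_exp_def)
next
  case greater
  have "((\<lambda>t. (1 / t) ^ m * exp (- (1 / t))) has_real_derivative
      (- real m * ((1 / t) ^ (m + 1) * exp (- (1 / t))) + (1 / t) ^ (m + 2) * exp (- (1 / t)))) (at t)"
  proof -
    have y: "((\<lambda>t. 1 / t) has_real_derivative - ((1 / t)\<^sup>2)) (at t)"
      using greater by (auto intro!: derivative_eq_intros simp: power2_eq_square)
    have e: "((\<lambda>t. exp (- (1 / t))) has_real_derivative exp (- (1 / t)) * (1 / t)\<^sup>2) (at t)"
      using DERIV_fun_exp[OF DERIV_minus[OF y]] by simp
    have eq: "real m * (- (y\<^sup>2) * y ^ (m - Suc 0)) * e + e * y\<^sup>2 * y ^ m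
        = - real m * (y ^ (m + 1) * e) + y ^ (m + 2) * e" for y e :: real
      by (cases m) (simp_all add: power2_eq_square algebra_simps)
    show ?thesis
      by (rule DERIV_cong[OF DERIV_mult[OF DERIV_power[OF y, of m] e] eq])
  qed
  then have "(flat_exp m has_real_derivative
      (- real m * ((1 / t) ^ (m + 1) * exp (- (1 / t))) + (1 / t) ^ (m + 2) * exp (- (1 / t)))) (at t)"
    by (rule has_field_derivative_transform_within_open[where S="{0<..}"]) (use greater in \<open>auto simp: flat_exp_def\<close>)
  then show ?thesis using greater by (simp add: flat_exp_def)
next
  case equal
  \<comment> \<open>At 0 the difference quotient is again a member of the family, of index
    \<open>Suc m\<close>, and \<open>flat_exp_le\<close> sends it to 0.\<close>
  have "(\<lambda>h. (flat_exp m (0 + h) - flat_exp m 0) / h) \<midarrow>0\<rightarrow> 0"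
  proof (rule Lim_null_comparison)
    have "norm ((flat_exp m (0 + h) - flat_exp m 0) / h) \<le> fact (m + 2) * \<bar>h\<bar>" for h
    proof (cases "h = 0")
      case False
      have "(flat_exp m (0 + h) - flat_exp m 0) / h = flat_exp (Suc m) h"
        using False flat_exp_Suc[of m h] by (simp add: flat_exp_def)
      then show ?thesis using flat_exp_le[of "Suc m" h] by simp
    qed simp
    then show "\<forall>\<^sub>F h in at 0. norm ((flat_exp m (0 + h) - flat_exp m 0) / h) \<le> fact (m + 2) * \<bar>h\<bar>" by simp
    show "(\<lambda>h. fact (m + 2) * \<bar>h\<bar>) \<midarrow>0\<rightarrow> (0::real)" by (auto intro!: tendsto_eq_intros)
  qed
  then have "(flat_exp m has_real_derivative 0) (at 0)" by (simp add: DERIV_def)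
  then show ?thesis using equal by (simp add: flat_exp_def)
qed

text \<open>The argument is a polynomial in x, so no smoothness is lost at the origin. With
  \<open>a = 1 / d\<^sup>2\<close> the support lies in the ball of radius d; the index m keeps
  partial derivatives inside the family.\<close>

definition bump :: "real \<Rightarrow> nat \<Rightarrow> real^'n \<Rightarrow> real" where
  "bump a m x = flat_exp m (1 - a * (x \<bullet> x))"

lemma bump_has_derivative:
  "(bump a m has_derivative (\<lambda>h. (- real m * bump a (m + 1) x + bump a (m + 2) x) * (- (2 * a) * (x \<bullet> h)))) (at x)"
proof -
  have q: "((\<lambda>x. 1 - a * (x \<bullet> x)) has_derivative (\<lambda>h. - (2 * a) * (x \<bullet> h))) (at x)"
    by (auto intro!: derivative_eq_intros simp: inner_commute algebra_simps)
  show ?thesis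
    using DERIV_compose_FDERIV[OF flat_exp_DERIV q] unfolding bump_def[abs_def]
    by (simp add: mult.commute)
qed

text \<open>The induction treats all m at once, since differentiation raises the index.\<close>

lemma Ck_bump: "Ck k (bump a m)"
proof (induction k arbitrary: m)
  case 0
  show ?case unfolding Ck.simps
    by (rule differentiable_imp_continuous) (use bump_has_derivative differentiable_def in blast)
next
  case (Suc k)
  have "partial i (bump a m) = (\<lambda>x. ((- real m) * bump a (m + 1) x + bump a (m + 2) x) * ((- (2 * a)) * x $ i))" for i :: 'a
    by (intro ext) (simp add: partial_eqI[OF bump_has_derivative] inner_axis)
  moreover have "Ck k (\<lambda>x::real^'a. ((- real m) * bump a (m + 1) x + bump a (m + 2) x) * ((- (2 * a)) * x $ i))" for i
    by (intro Ck_mult Ck_add Ck_const Ck_nth Suc)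
  ultimately show ?case using bump_has_derivative[of a m] by (auto simp: differentiable_def)
qed

lemma bump_nonneg: "0 \<le> bump a m x"
  by (simp add: bump_def flat_exp_nonneg)

lemma bump_le: "0 \<le> a \<Longrightarrow> bump a 0 x \<le> 1"
  by (auto simp: bump_def flat_exp_def)

lemma bump_support: "0 < d \<Longrightarrow> d < norm x \<Longrightarrow> bump (1 / d\<^sup>2) m x = 0"
proof -
  assume d: "0 < d" "d < norm x"
  then have "d\<^sup>2 \<le> (norm x)\<^sup>2" by (intro power_mono) auto
  then have "1 \<le> 1 / d\<^sup>2 * (x \<bullet> x)" using d by (simp add: power2_norm_eq_inner)
  then show ?thesis by (simp add: bump_def flat_exp_def)
qed

definition mollifier :: "real \<Rightarrow> real^'n \<Rightarrow> real" where
  "mollifier d x = bump (1 / d\<^sup>2) 0 x / (LINT y|lebesgue. bump (1 / d\<^sup>2) 0 (y::real^'n))"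

lemma continuous_bump: "continuous_on UNIV (bump a m)"
  using Ck_bump[of 0] by simp

text \<open>Positivity: were the integral 0, the bump would vanish almost everywhere, although it is
  positive on an open ball.\<close>

lemma
  assumes d: "0 < d"
  shows integrable_bump: "integrable lebesgue (bump (1 / d\<^sup>2) 0 :: real^'n \<Rightarrow> real)"
    and integral_bump_pos: "0 < (LINT y|lebesgue. bump (1 / d\<^sup>2) 0 (y::real^'n))"
proof -
  have i1: "integrable lebesgue (indicat_real (cball (0::real^'n) d))"
    using bounded_emeasure_lebesgue[of "cball (0::real^'n) d"] by simp
  show i: "integrable lebesgue (bump (1 / d\<^sup>2) 0 :: real^'n \<Rightarrow> real)"
  proof (rule Bochner_Integration.integrable_bound[OF i1 continuous_lebesgue_measurable[OF continuous_bump]])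
    show "AE x in lebesgue. norm (bump (1 / d\<^sup>2) 0 x) \<le> norm (indicat_real (cball (0::real^'n) d) x)"
    proof (rule AE_I2)
      fix x :: "real^'n"
      show "norm (bump (1 / d\<^sup>2) 0 x) \<le> norm (indicat_real (cball (0::real^'n) d) x)"
        using d bump_support[OF d, of x] bump_nonneg[of "1 / d\<^sup>2" 0 x] bump_le[of "1 / d\<^sup>2" x]
        by (cases "norm x \<le> d") simp_all
    qed
  qed
  show "0 < (LINT y|lebesgue. bump (1 / d\<^sup>2) 0 (y::real^'n))"
  proof (rule ccontr)
    assume "\<not> 0 < (LINT y|lebesgue. bump (1 / d\<^sup>2) 0 (y::real^'n))"
    moreover have "0 \<le> (LINT y|lebesgue. bump (1 / d\<^sup>2) 0 (y::real^'n))"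
      by (intro Bochner_Integration.integral_nonneg) (simp add: bump_nonneg)
    ultimately have "(LINT y|lebesgue. bump (1 / d\<^sup>2) 0 (y::real^'n)) = 0" by linarith
    then have "AE y in lebesgue. bump (1 / d\<^sup>2) 0 (y::real^'n) = 0"
      using integral_nonneg_eq_0_iff_AE[OF i] by (simp add: bump_nonneg)
    then have "AE y in lebesgue. y \<notin> ball (0::real^'n) d"
    proof eventually_elim
      case (elim y)
      show ?case
      proof
        assume "y \<in> ball 0 d"
        then have "(norm y)\<^sup>2 < d\<^sup>2" by (intro power_strict_mono) auto
        then have "0 < 1 - 1 / d\<^sup>2 * (y \<bullet> y)" using d by (simp add: power2_norm_eq_inner)
        then have "0 < bump (1 / d\<^sup>2) 0 y" by (simp add: bump_def flat_exp_def)
        then show False using elim by simp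
      qed
    qed
    then have "ball (0::real^'n) d \<in> null_sets lebesgue" by (simp add: AE_iff_null_sets)
    then show False using d content_ball_pos[of d "0::real^'n"] by (auto simp: null_sets_def measure_def)
  qed
qed

lemma mollifier_nonneg: "0 < d \<Longrightarrow> 0 \<le> mollifier d x"
  unfolding mollifier_def using integral_bump_pos[where 'n='a] bump_nonneg by (intro divide_nonneg_pos) auto

lemma integrable_mollifier: "0 < d \<Longrightarrow> integrable lebesgue (mollifier d)"
  unfolding mollifier_def[abs_def] using integrable_bump by auto

lemma integral_mollifier: "0 < d \<Longrightarrow> (LINT y|lebesgue. mollifier d (y::real^'n)) = 1"
  unfolding mollifier_def using integral_bump_pos[of d, where 'n='n] by simp

lemma mollifier_support: "0 < d \<Longrightarrow> d < norm x \<Longrightarrow> mollifier d x = 0"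
  by (simp add: mollifier_def bump_support)

lemma Ck_mollifier: "Ck k (mollifier d)"
  using Ck_mult[OF Ck_const[of k "1 / (LINT y|lebesgue. bump (1 / d\<^sup>2) 0 (y::real^'a))"] Ck_bump[of k "1 / d\<^sup>2" 0]]
  by (simp add: mollifier_def[abs_def])

subsection \<open>Mollification\<close>

lemma partial_zero_outside:
  assumes "\<And>x. R < norm x \<Longrightarrow> \<psi> x = 0" "R < norm x"
  shows "partial i \<psi> x = 0"
proof -
  have o: "open {x::real^'a. R < norm x}" by (intro open_Collect_less continuous_intros)
  have "((\<lambda>x. 0) has_derivative (\<lambda>h. 0)) (at x)" by simp
  then have "(\<psi> has_derivative (\<lambda>h. 0)) (at x)"
    by (rule has_derivative_transform_within_open[OF _ o]) (use assms in auto)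
  then show ?thesis by (rule partial_eqI)
qed

text \<open>Correlation rather than convolution, in the shape of
  \<open>fourier_integral_correlation\<close>; a derivative in z therefore falls on \<psi> with a
  minus sign.\<close>

definition mollify :: "(real^'n \<Rightarrow> real) \<Rightarrow> (real^'n \<Rightarrow> real) \<Rightarrow> real^'n \<Rightarrow> real" where
  "mollify u \<psi> z = (LINT y|lebesgue. u y * \<psi> (y - z))"

lemma bounded_if_compact_support:
  fixes \<psi> :: "real^'n \<Rightarrow> real"
  assumes "continuous_on UNIV \<psi>" "\<And>x. R < norm x \<Longrightarrow> \<psi> x = 0"
  shows "\<exists>B\<ge>0. \<forall>x. \<bar>\<psi> x\<bar> \<le> B"
proof -
  have "compact (\<psi> ` cball 0 R)"
    using assms(1) by (intro compact_continuous_image continuous_on_subset[OF assms(1)]) auto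
  then obtain B where B: "\<forall>x\<in>cball 0 R. \<bar>\<psi> x\<bar> \<le> B" by (auto dest!: compact_imp_bounded simp: bounded_iff)
  have "\<bar>\<psi> x\<bar> \<le> max B 0" for x
  proof (cases "norm x \<le> R")
    case True
    then have "\<bar>\<psi> x\<bar> \<le> B" using B by simp
    then show ?thesis by linarith
  qed (use assms(2)[of x] in simp)
  then show ?thesis by (intro exI[of _ "max B 0"]) auto
qed

lemma mollify_integrable:
  assumes u: "integrable lebesgue u" and \<psi>: "continuous_on UNIV \<psi>" and B: "\<And>x. \<bar>\<psi> x\<bar> \<le> B"
  shows "integrable lebesgue (\<lambda>y. u y * \<psi> (y - z) :: real)"
proof (rule Bochner_Integration.integrable_bound)
  show "integrable lebesgue (\<lambda>y. \<bar>u y\<bar> * B)" using u by simp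
  have "(\<lambda>y. \<psi> (y - z)) \<in> borel_measurable lebesgue"
    by (intro continuous_lebesgue_measurable continuous_on_compose2[OF \<psi>]) (auto intro!: continuous_intros)
  then show "(\<lambda>y. u y * \<psi> (y - z)) \<in> borel_measurable lebesgue" using u by simp
  show "AE y in lebesgue. norm (u y * \<psi> (y - z)) \<le> norm (\<bar>u y\<bar> * B)"
  proof (rule AE_I2)
    fix y
    have "\<bar>u y\<bar> * \<bar>\<psi> (y - z)\<bar> \<le> \<bar>u y\<bar> * B" by (intro mult_left_mono B) simp
    moreover have "0 \<le> B" using B[of 0] by linarith
    ultimately show "norm (u y * \<psi> (y - z)) \<le> norm (\<bar>u y\<bar> * B)" by (simp add: abs_mult)
  qed
qed

text \<open>Differentiation under the integral sign: divided by the length of the increment, the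
  remainder tends to 0 pointwise and is dominated by \<open>2 * M\<close> times
  \<open>\<bar>u y\<bar>\<close>, with \<open>M\<close> a Lipschitz constant of \<psi>.\<close>

lemma mollify_has_derivative:
  fixes u \<psi> :: "real^'n \<Rightarrow> real"
  assumes u: "integrable lebesgue u" and \<psi>: "\<And>k. Ck k \<psi>" and supp: "\<And>x. R < norm x \<Longrightarrow> \<psi> x = 0"
  shows "(mollify u \<psi> has_derivative (\<lambda>h. \<Sum>i\<in>UNIV. h $ i * (- mollify u (partial i \<psi>) z))) (at z)"
proof -
  have diff: "\<psi> differentiable (at x)" for x using \<psi>[of "Suc 0"] by simp
  have pc: "continuous_on UNIV (partial i \<psi>)" for i using \<psi>[of "Suc 0"] by simp
  have c: "continuous_on UNIV \<psi>" using \<psi>[of 0] by simp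
  obtain B0 where B0: "0 \<le> B0" "\<And>x. \<bar>\<psi> x\<bar> \<le> B0"
    using bounded_if_compact_support[OF c supp] by auto
  have "\<exists>B\<ge>0. \<forall>x. \<bar>partial i \<psi> x\<bar> \<le> B" for i
    by (rule bounded_if_compact_support[OF pc partial_zero_outside[OF supp]])
  then obtain B where B: "\<And>i. 0 \<le> B i" "\<And>i x. \<bar>partial i \<psi> x\<bar> \<le> B i" by metis
  define M where "M = sum B UNIV"
  have M0: "0 \<le> M" unfolding M_def by (intro sum_nonneg B)
  let ?D = "\<lambda>x h. \<Sum>i\<in>UNIV. h $ i * partial i \<psi> x"
  have Dle: "\<bar>?D x h\<bar> \<le> M * norm h" for x h
  proof -
    have "\<bar>?D x h\<bar> \<le> (\<Sum>i\<in>UNIV. \<bar>h $ i * partial i \<psi> x\<bar>)" by (rule sum_abs)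
    also have "\<dots> \<le> (\<Sum>i\<in>UNIV. norm h * B i)"
      unfolding abs_mult by (intro sum_mono mult_mono B component_le_norm_cart) auto
    finally show ?thesis by (simp add: M_def sum_distrib_left sum_distrib_right mult.commute)
  qed
  have Lip: "\<bar>\<psi> x - \<psi> y\<bar> \<le> M * norm (x - y)" for x y
  proof -
    have "norm (\<psi> x - \<psi> y) \<le> M * norm (x - y)"
    proof (rule differentiable_bound[of UNIV \<psi> ?D])
      show "(\<psi> has_derivative ?D x) (at x within UNIV)" for x using has_derivative_partial[OF diff] by simp
      show "onorm (?D x) \<le> M" for x using Dle by (intro onorm_bound M0) simp
    qed auto
    then show ?thesis by simp
  qed
  \<comment> \<open>The linear term enters with a plus sign because the argument
    \<open>y - z\<close> changes by \<open>- h\<close>.\<close>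
  let ?E = "\<lambda>h y. \<psi> (y - (z + h)) - \<psi> (y - z) + ?D (y - z) h"
  have int1: "integrable lebesgue (\<lambda>y. u y * \<psi> (y - w))" for w by (rule mollify_integrable[OF u c B0(2)])
  have int2: "integrable lebesgue (\<lambda>y. u y * partial i \<psi> (y - w))" for w i by (rule mollify_integrable[OF u pc B(2)])
  have int3: "integrable lebesgue (\<lambda>y. u y * ?D (y - z) h)" for h
  proof -
    have "integrable lebesgue (\<lambda>y. \<Sum>i\<in>UNIV. h $ i * (u y * partial i \<psi> (y - z)))"
      by (intro Bochner_Integration.integrable_sum integrable_mult_right int2)
    then show ?thesis by (simp add: sum_distrib_left mult.left_commute)
  qed
  have lin: "(LINT y|lebesgue. u y * ?D (y - z) h) = (\<Sum>i\<in>UNIV. h $ i * mollify u (partial i \<psi>) z)" for h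
  proof -
    have "(LINT y|lebesgue. u y * ?D (y - z) h) = (LINT y|lebesgue. (\<Sum>i\<in>UNIV. h $ i * (u y * partial i \<psi> (y - z))))"
      by (simp add: sum_distrib_left mult.left_commute)
    also have "\<dots> = (\<Sum>i\<in>UNIV. h $ i * mollify u (partial i \<psi>) z)"
      using int2 by (subst Bochner_Integration.integral_sum) (auto simp: mollify_def)
    finally show ?thesis .
  qed
  have rem: "mollify u \<psi> (z + h) - mollify u \<psi> z - (\<Sum>i\<in>UNIV. h $ i * (- mollify u (partial i \<psi>) z))
     = (LINT y|lebesgue. u y * ?E h y)" for h
  proof -
    have "(LINT y|lebesgue. u y * ?E h y) = (LINT y|lebesgue. u y * \<psi> (y - (z + h)) - u y * \<psi> (y - z) + u y * ?D (y - z) h)"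
      by (simp add: algebra_simps)
    also have "\<dots> = mollify u \<psi> (z + h) - mollify u \<psi> z + (\<Sum>i\<in>UNIV. h $ i * mollify u (partial i \<psi>) z)"
      using int1[of "z + h"] int1[of z] int3[of h] by (simp add: mollify_def lin)
    finally show ?thesis by (simp add: sum_negf)
  qed
  have bl: "bounded_linear (\<lambda>h. \<Sum>i\<in>UNIV. h $ i * (- mollify u (partial i \<psi>) z))"
    by (intro bounded_linear_sum bounded_linear_mult_const bounded_linear_vec_nth)
  have lim: "(\<lambda>h. (LINT y|lebesgue. u y * ?E h y) / norm h) \<midarrow>0\<rightarrow> 0"
    unfolding tendsto_at_iff_sequentially comp_def
  proof (intro allI impI)
    fix X :: "nat \<Rightarrow> real^'n" assume X0: "\<forall>i. X i \<in> UNIV - {0}" and X: "X \<longlonglongrightarrow> 0"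
    have "(\<lambda>k. LINT y|lebesgue. u y * ?E (X k) y / norm (X k)) \<longlonglongrightarrow> (LINT y::real^'n|lebesgue. (0::real))"
    proof (rule integral_dominated_convergence[where w="\<lambda>y. \<bar>u y\<bar> * (2 * M)"])
      show "integrable lebesgue (\<lambda>y. \<bar>u y\<bar> * (2 * M))" using u by simp
      have "integrable lebesgue (\<lambda>y. u y * \<psi> (y - (z + X k)) - u y * \<psi> (y - z) + u y * ?D (y - z) (X k))" for k
        by (intro Bochner_Integration.integrable_add Bochner_Integration.integrable_diff int1 int3)
      then have "integrable lebesgue (\<lambda>y. u y * ?E (X k) y)" for k
        by (simp only: distrib_left right_diff_distrib)
      then show "(\<lambda>y. u y * ?E (X k) y / norm (X k)) \<in> borel_measurable lebesgue" for k
        by (intro borel_measurable_divide) auto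
      show "AE y in lebesgue. norm (u y * ?E (X k) y / norm (X k)) \<le> \<bar>u y\<bar> * (2 * M)" for k
      proof (rule AE_I2)
        fix y
        have n: "0 < norm (X k)" using X0 by simp
        have "\<bar>?E (X k) y\<bar> \<le> \<bar>\<psi> (y - (z + X k)) - \<psi> (y - z)\<bar> + \<bar>?D (y - z) (X k)\<bar>" by linarith
        also have "\<dots> \<le> M * norm (X k) + M * norm (X k)"
          using Lip[of "y - (z + X k)" "y - z"] Dle[of "X k" "y - z"] by (intro add_mono) auto
        finally have "\<bar>?E (X k) y\<bar> / norm (X k) \<le> 2 * M" using n by (simp add: pos_divide_le_eq mult.assoc)
        then have "\<bar>u y\<bar> * (\<bar>?E (X k) y\<bar> / norm (X k)) \<le> \<bar>u y\<bar> * (2 * M)" by (intro mult_left_mono) auto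
        then show "norm (u y * ?E (X k) y / norm (X k)) \<le> \<bar>u y\<bar> * (2 * M)" by (simp add: abs_mult)
      qed
      show "AE y in lebesgue. (\<lambda>k. u y * ?E (X k) y / norm (X k)) \<longlonglongrightarrow> 0"
      proof (rule AE_I2)
        fix y
        have d: "(\<lambda>h. norm (\<psi> (y - z + h) - \<psi> (y - z) - ?D (y - z) h) / norm h) \<midarrow>0\<rightarrow> 0"
          using has_derivative_partial[OF diff, of "y - z"] unfolding has_derivative_at by blast
        have mX: "(\<lambda>k. - X k) \<longlonglongrightarrow> 0" using tendsto_minus[OF X] by simp
        have "(\<lambda>k. norm (\<psi> (y - z + (- X k)) - \<psi> (y - z) - ?D (y - z) (- X k)) / norm (- X k)) \<longlonglongrightarrow> 0"
          by (rule filterlim_compose[OF d]) (use X0 mX in \<open>auto simp: filterlim_at\<close>)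
        moreover have "norm (\<psi> (y - z + (- X k)) - \<psi> (y - z) - ?D (y - z) (- X k)) / norm (- X k) = norm (?E (X k) y / norm (X k))" for k
        proof -
          have "y - z + (- X k) = y - (z + X k)" by simp
          then show ?thesis by (simp only:) (simp add: sum_negf)
        qed
        ultimately have "(\<lambda>k. norm (?E (X k) y / norm (X k))) \<longlonglongrightarrow> 0" by (simp only:)
        then have "(\<lambda>k. ?E (X k) y / norm (X k)) \<longlonglongrightarrow> 0" by (rule tendsto_norm_zero_cancel)
        then have "(\<lambda>k. u y * (?E (X k) y / norm (X k))) \<longlonglongrightarrow> u y * 0" by (intro tendsto_intros)
        then show "(\<lambda>k. u y * ?E (X k) y / norm (X k)) \<longlonglongrightarrow> 0" by simp
      qed
    qed simp
    then show "(\<lambda>k. (LINT y|lebesgue. u y * ?E (X k) y) / norm (X k)) \<longlonglongrightarrow> 0" by simp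
  qed
  show ?thesis
    unfolding has_derivative_at rem using bl lim tendsto_norm_zero_iff[of "\<lambda>h. (LINT y|lebesgue. u y * ?E h y) / norm h" "at 0"]
    by (simp add: norm_divide)
qed

lemma Ck_mollify:
  fixes u \<psi> :: "real^'n \<Rightarrow> real"
  assumes u: "integrable lebesgue u"
  shows "(\<And>k. Ck k \<psi>) \<Longrightarrow> (\<And>x. R < norm x \<Longrightarrow> \<psi> x = 0) \<Longrightarrow> Ck k (mollify u \<psi>)"
proof (induction k arbitrary: \<psi>)
  case 0
  have "mollify u \<psi> differentiable (at z)" for z
    using mollify_has_derivative[OF u 0] unfolding differentiable_def by blast
  then show ?case by (simp add: differentiable_imp_continuous)
next
  case (Suc k)
  note d = mollify_has_derivative[OF u Suc.prems(1) Suc.prems(2)]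
  have p: "partial i (mollify u \<psi>) = (\<lambda>z. (- 1) * mollify u (partial i \<psi>) z)" for i
  proof
    fix z
    have "partial i (mollify u \<psi>) z = (\<Sum>j\<in>UNIV. axis i 1 $ j * (- mollify u (partial j \<psi>) z))"
      by (rule partial_eqI[OF d])
    also have "\<dots> = (\<Sum>j\<in>UNIV. if j = i then - mollify u (partial i \<psi>) z else 0)"
      by (intro sum.cong refl) (auto simp: axis_def)
    finally show "partial i (mollify u \<psi>) z = (- 1) * mollify u (partial i \<psi>) z" by simp
  qed
  have "Ck k (mollify u (partial i \<psi>))" for i
  proof (rule Suc.IH)
    show "Ck l (partial i \<psi>)" for l using Suc.prems(1)[of "Suc l"] by simp
    show "partial i \<psi> x = 0" if "R < norm x" for x by (rule partial_zero_outside[OF Suc.prems(2) that])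
  qed
  then have "Ck k (partial i (mollify u \<psi>))" for i
    unfolding p by (rule Ck_mult[OF Ck_const])
  moreover have "mollify u \<psi> differentiable (at z)" for z
    using d unfolding differentiable_def by blast
  ultimately show ?case by simp
qed

lemma mollify_eq_0:
  assumes "AE y in lebesgue. y \<notin> K \<longrightarrow> u y = 0" "\<And>x. d < norm x \<Longrightarrow> \<psi> x = 0"
    and "\<And>y. y \<in> K \<Longrightarrow> d < norm (y - z)"
  shows "mollify u \<psi> z = 0"
  unfolding mollify_def
proof (rule integral_eq_zero_AE)
  show "AE y in lebesgue. u y * \<psi> (y - z) = 0"
    using assms(1) by eventually_elim (use assms(2,3) in auto)
qed

text \<open>Mollification becomes multiplication by an average of phases, so convergence in
  \<open>Hs s\<close> reduces to pointwise convergence of bounded multipliers.\<close>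

lemma mollify_as_correlation:
  fixes u \<rho> :: "real^'n \<Rightarrow> real"
  assumes u: "integrable lebesgue u" and \<rho>: "continuous_on UNIV \<rho>" "integrable lebesgue \<rho>"
  shows "fourier_integral (\<lambda>z. complex_of_real (mollify u \<rho> z)) \<xi>
      = fourier_integral (\<lambda>z. complex_of_real (u z)) \<xi> * (LINT y|lebesgue. cis (y \<bullet> \<xi>) * complex_of_real (\<rho> y))"
proof -
  have um: "(\<lambda>x. complex_of_real (u x)) \<in> borel_measurable lebesgue" using u by simp
  obtain b where b[measurable]: "b \<in> borel_measurable borel" and ub: "AE x in lebesgue. complex_of_real (u x) = b x"
    using borel_representative[OF um] by auto
  have bL: "b \<in> borel_measurable lebesgue" by (intro borel_imp_lebesgue_measurable b)
  have "integrable lebesgue (\<lambda>x. complex_of_real (u x))" using u by simp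
  then have bi: "integrable lborel b"
    using integrable_cong_AE[OF um bL ub] integrable_completion[of b lborel] b by simp
  have \<rho>m[measurable]: "\<rho> \<in> borel_measurable borel" using \<rho>(1) by (rule borel_measurable_continuous_onI)
  have cm: "(\<lambda>y. complex_of_real (\<rho> y)) \<in> borel_measurable borel" by measurable
  have ci: "integrable lborel (\<lambda>y. complex_of_real (\<rho> y))"
    using \<rho>(2) integrable_completion[of \<rho> lborel] \<rho>m by simp
  define h where "h = (\<lambda>z. LINT y|lborel. b (y + z) * complex_of_real (\<rho> y))"
  note cor = fourier_integral_correlation[OF b cm bi ci, folded h_def]
  have eq: "complex_of_real (mollify u \<rho> z) = h z" for z
  proof -
    have m1: "(\<lambda>y. u (y + z) * \<rho> y) \<in> borel_measurable lebesgue"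
      using borel_measurable_lebesgue_shift[of u z] u borel_imp_lebesgue_measurable[OF \<rho>m] by simp
    have "(\<lambda>y. \<rho> (y - z)) \<in> borel_measurable lebesgue"
      using borel_measurable_lebesgue_shift[OF borel_imp_lebesgue_measurable[OF \<rho>m], of "- z"] by simp
    then have m2: "(\<lambda>y. u y * \<rho> (y - z)) \<in> borel_measurable lebesgue" using u by simp
    have m3: "(\<lambda>y. b (y + z) * complex_of_real (\<rho> y)) \<in> borel_measurable borel" by measurable
    have "mollify u \<rho> z = (LINT y|lebesgue. u (y + z) * \<rho> y)"
      unfolding mollify_def using integral_lebesgue_shift[OF m2, of z] by simp
    then have "complex_of_real (mollify u \<rho> z) = (LINT y|lebesgue. complex_of_real (u (y + z) * \<rho> y))"
      by (simp only: integral_complex_of_real)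
    also have "\<dots> = (LINT y|lebesgue. b (y + z) * complex_of_real (\<rho> y))"
    proof (rule integral_cong_AE)
      show "AE y in lebesgue. complex_of_real (u (y + z) * \<rho> y) = b (y + z) * complex_of_real (\<rho> y)"
        using AE_lebesgue_shift[OF ub, of z] by eventually_elim simp
    qed (rule measurable_compose[OF m1 borel_measurable_of_real], rule borel_imp_lebesgue_measurable[OF m3])
    also have "\<dots> = h z" unfolding h_def by (rule integral_completion) (use m3 in simp)
    finally show ?thesis .
  qed
  have "fourier_integral (\<lambda>z. complex_of_real (mollify u \<rho> z)) \<xi> = fourier_integral h \<xi>" by (simp add: eq)
  also have "\<dots> = fourier_integral b \<xi> * (LINT y|lborel. cis (y \<bullet> \<xi>) * complex_of_real (\<rho> y))" by (rule cor(3))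
  also have "fourier_integral b = fourier_integral (\<lambda>z. complex_of_real (u z))"
    using ub by (intro fourier_integral_cong_AE bL um) (auto elim!: eventually_mono)
  also have "(LINT y|lborel. cis (y \<bullet> \<xi>) * complex_of_real (\<rho> y)) = (LINT y|lebesgue. cis (y \<bullet> \<xi>) * complex_of_real (\<rho> y))"
    by (rule integral_completion[symmetric]) measurable
  finally show ?thesis .
qed

text \<open>An average of phases against a probability density stays in the unit disc, and each
  phase differs from 1 by at most \<open>norm y * norm \<xi>\<close>, where the support bounds
  \<open>norm y\<close>.\<close>

lemma cis_integral_bounds:
  fixes \<rho> :: "real^'n \<Rightarrow> real"
  assumes \<rho>: "integrable lebesgue \<rho>" "\<And>y. 0 \<le> \<rho> y" "(LINT y|lebesgue. \<rho> y) = 1" "\<And>y. d < norm y \<Longrightarrow> \<rho> y = 0"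
  defines "m \<equiv> \<lambda>\<xi>. LINT y|lebesgue. cis (y \<bullet> \<xi>) * complex_of_real (\<rho> y)"
  shows "norm (m \<xi>) \<le> 1" "norm (m \<xi> - 1) \<le> d * norm \<xi>"
proof -
  have i: "integrable lebesgue (\<lambda>y. cis (y \<bullet> \<xi>) * complex_of_real (\<rho> y))"
    by (rule Bochner_Integration.integrable_bound[OF \<rho>(1)]) (use \<rho>(1) in \<open>auto simp: norm_mult\<close>)
  have "norm (m \<xi>) \<le> (LINT y|lebesgue. norm (cis (y \<bullet> \<xi>) * complex_of_real (\<rho> y)))"
    unfolding m_def by (rule integral_norm_bound)
  also have "\<dots> = 1" using \<rho> by (simp add: norm_mult)
  finally show "norm (m \<xi>) \<le> 1" .
  have "1 = (LINT y|lebesgue. complex_of_real (\<rho> y))" using \<rho>(3) by (simp only: integral_complex_of_real of_real_1)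
  then have "m \<xi> - 1 = (LINT y|lebesgue. cis (y \<bullet> \<xi>) * complex_of_real (\<rho> y)) - (LINT y|lebesgue. complex_of_real (\<rho> y))"
    by (simp add: m_def)
  also have "\<dots> = (LINT y|lebesgue. cis (y \<bullet> \<xi>) * complex_of_real (\<rho> y) - complex_of_real (\<rho> y))"
    using i \<rho>(1) by simp
  finally have "norm (m \<xi> - 1) \<le> (LINT y|lebesgue. norm (cis (y \<bullet> \<xi>) * complex_of_real (\<rho> y) - complex_of_real (\<rho> y)))"
    by (simp only: integral_norm_bound)
  also have "\<dots> \<le> (LINT y|lebesgue. d * norm \<xi> * \<rho> y)"
  proof (rule integral_mono)
    fix y
    have "norm (cis (y \<bullet> \<xi>) * complex_of_real (\<rho> y) - complex_of_real (\<rho> y)) = norm (cis (y \<bullet> \<xi>) - 1) * \<rho> y"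
    proof -
      have "cis (y \<bullet> \<xi>) * complex_of_real (\<rho> y) - complex_of_real (\<rho> y) = (cis (y \<bullet> \<xi>) - 1) * complex_of_real (\<rho> y)"
        by (simp add: left_diff_distrib)
      then show ?thesis using \<rho>(2)[of y] by (simp only: norm_mult norm_of_real abs_of_nonneg)
    qed
    also have "\<dots> \<le> d * norm \<xi> * \<rho> y"
    proof (cases "norm y \<le> d")
      case True
      have "(norm (cis (y \<bullet> \<xi>) - 1))\<^sup>2 \<le> \<bar>y \<bullet> \<xi>\<bar>\<^sup>2" using norm_cis_minus_1_le(2)[of "y \<bullet> \<xi>"] by simp
      then have "norm (cis (y \<bullet> \<xi>) - 1) \<le> \<bar>y \<bullet> \<xi>\<bar>" by (rule power2_le_imp_le) simp
      also have "\<dots> \<le> norm y * norm \<xi>" by (rule Cauchy_Schwarz_ineq2)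
      also have "\<dots> \<le> d * norm \<xi>" using True by (simp add: mult_right_mono)
      finally show ?thesis using \<rho>(2) by (simp add: mult_right_mono)
    qed (simp add: \<rho>(4))
    finally show "norm (cis (y \<bullet> \<xi>) * complex_of_real (\<rho> y) - complex_of_real (\<rho> y)) \<le> d * norm \<xi> * \<rho> y" .
  qed (use i \<rho>(1) in auto)
  also have "\<dots> = d * norm \<xi>" using \<rho>(3) by simp
  finally show "norm (m \<xi> - 1) \<le> d * norm \<xi>" .
qed

text \<open>Mollification at a radius smaller than the room around K inside \<Omega> stays a test
  function there; in frequency it multiplies by factors tending to 1.\<close>

lemma Hs_approx_test_functions:
  fixes u :: "real^'n \<Rightarrow> real"
  assumes u: "u \<in> Hs s" and s: "0 \<le> s" and K: "compact K" "K \<subseteq> \<Omega>" "open \<Omega>"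
    and supp: "AE x in lebesgue. x \<notin> K \<longrightarrow> u x = 0"
  shows "\<exists>\<phi>. (\<forall>n::nat. \<phi> n \<in> test_functions \<Omega> \<and> \<phi> n \<in> Hs s) \<and> (\<lambda>n. Hs_norm s (\<lambda>x. \<phi> n x - u x)) \<longlonglongrightarrow> 0"
proof -
  have uL: "u \<in> L2 lebesgue" by (rule Hs_L2[OF u])
  obtain R where R: "\<And>x. x \<in> K \<Longrightarrow> norm x \<le> R" using compact_imp_bounded[OF K(1)] by (auto simp: bounded_iff)
  have suppR: "AE x in lebesgue. R < norm x \<longrightarrow> u x = 0" using supp by eventually_elim (meson R not_le)
  note fb = fourier_bounded_support[OF uL suppR]
  obtain e where e: "0 < e" "(\<Union>x\<in>K. cball x e) \<subseteq> \<Omega>"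
    using compact_subset_open_imp_cball_epsilon_subset[OF K(1,3,2)] by blast
  \<comment> \<open>The radii tend to 0 and never exceed \<open>e\<close>, so all supports lie in
    one compact sum of K and a closed ball.\<close>
  define d where "d = (\<lambda>n::nat. e / real (Suc n))"
  have d: "0 < d n" "d n \<le> e" for n using e by (auto simp: d_def divide_simps)
  have d0: "d \<longlonglongrightarrow> 0"
    using tendsto_mult_right_zero[OF LIMSEQ_inverse_real_of_nat, of e] by (simp add: d_def divide_inverse)
  define \<phi> where "\<phi> = (\<lambda>n. mollify u (mollifier (d n)))"
  have Ck\<phi>: "Ck k (\<phi> n)" for k n
    unfolding \<phi>_def by (rule Ck_mollify[OF fb(1) Ck_mollifier mollifier_support[OF d(1)]])
  have KS: "compact {x + y | x y. x \<in> K \<and> y \<in> cball 0 e}" by (rule compact_sums[OF K(1) compact_cball])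
  have nz: "{x. \<phi> n x \<noteq> 0} \<subseteq> {x + y | x y. x \<in> K \<and> y \<in> cball 0 e}" for n
  proof
    fix z assume z: "z \<in> {x. \<phi> n x \<noteq> 0}"
    have "\<exists>y\<in>K. norm (y - z) \<le> d n"
    proof (rule ccontr)
      assume "\<not> (\<exists>y\<in>K. norm (y - z) \<le> d n)"
      then have "\<phi> n z = 0"
        unfolding \<phi>_def by (intro mollify_eq_0[OF supp, of "d n"]) (auto simp: mollifier_support[OF d(1)] not_le)
      then show False using z by simp
    qed
    then obtain y where "y \<in> K" "norm (y - z) \<le> d n" by blast
    then have "z = y + (z - y)" "z - y \<in> cball 0 e" using d(2)[of n] by (auto simp: norm_minus_commute)
    then show "z \<in> {x + y | x y. x \<in> K \<and> y \<in> cball 0 e}" using \<open>y \<in> K\<close> by blast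
  qed
  have KS\<Omega>: "{x + y | x y. x \<in> K \<and> y \<in> cball 0 e} \<subseteq> \<Omega>"
  proof clarify
    fix x y assume "x \<in> K" "y \<in> cball (0::real^'n) e"
    then have "x + y \<in> cball x e" by (simp add: dist_norm)
    then show "x + y \<in> \<Omega>" using e(2) \<open>x \<in> K\<close> by blast
  qed
  have cl: "closure {x. \<phi> n x \<noteq> 0} \<subseteq> {x + y | x y. x \<in> K \<and> y \<in> cball 0 e}" for n
    by (rule closure_minimal[OF nz compact_imp_closed[OF KS]])
  have test: "\<phi> n \<in> test_functions \<Omega>" for n
  proof -
    have "compact (closure {x. \<phi> n x \<noteq> 0})"
      using cl[of n] KS by (intro compact_closure[THEN iffD2] bounded_subset[OF compact_imp_bounded[OF KS] nz])
    then show ?thesis using Ck\<phi> cl[of n] KS\<Omega> by (auto simp: test_functions_def)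
  qed
  have \<phi>0: "\<phi> n x = 0" if "R + e < norm x" for n x
  proof (rule ccontr)
    assume "\<phi> n x \<noteq> 0"
    then obtain a b where "x = a + b" "a \<in> K" "b \<in> cball 0 e" using nz[of n] by auto
    then show False using R[of a] norm_triangle_ineq[of a b] that by simp
  qed
  have cont: "continuous_on UNIV (\<phi> n)" for n using Ck\<phi>[of 0] by simp
  have \<phi>L: "\<phi> n \<in> L2 lebesgue" for n
  proof -
    obtain B where B: "0 \<le> B" "\<And>x. \<bar>\<phi> n x\<bar> \<le> B" using bounded_if_compact_support[OF cont \<phi>0] by blast
    have "\<bar>\<phi> n x\<bar> \<le> B * indicat_real (cball 0 (R + e)) x" for x
      using B \<phi>0[of x n] by (auto simp: indicator_def)
    then show ?thesis
      by (intro L2_bounded_support(1)[OF continuous_lebesgue_measurable[OF cont], of "cball 0 (R + e)" B]) (use B in auto)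
  qed
  define m where "m = (\<lambda>n \<xi>. LINT y|lebesgue. cis (y \<bullet> \<xi>) * complex_of_real (mollifier (d n) (y::real^'n)))"
  note mb = cis_integral_bounds[OF integrable_mollifier[OF d(1)] mollifier_nonneg[OF d(1)] integral_mollifier[OF d(1)] mollifier_support[OF d(1)]]
  have mF: "AE \<xi> in lebesgue. fourier (\<phi> n) \<xi> = m n \<xi> * fourier u \<xi>" for n
  proof -
    have "AE x in lebesgue. R + e < norm x \<longrightarrow> \<phi> n x = 0" using \<phi>0 by auto
    from fourier_bounded_support(2)[OF \<phi>L this] fb(2)
    show ?thesis
    proof eventually_elim
      case (elim \<xi>)
      have "continuous_on UNIV (mollifier (d n) :: real^'n \<Rightarrow> real)" using Ck_mollifier[of 0] by simp
      then show ?case using elim mollify_as_correlation[OF fb(1) _ integrable_mollifier[OF d(1)], of n \<xi>]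
        by (simp add: \<phi>_def m_def mult.commute)
    qed
  qed
  have "\<phi> n \<in> Hs s" for n
    by (rule Hs_multiplier[OF u \<phi>L mF]) (simp add: m_def mb(1))
  moreover have "(\<lambda>n. Hs_norm s (\<lambda>x. \<phi> n x - u x)) \<longlonglongrightarrow> 0"
  proof (rule Hs_multiplier_tendsto[OF u \<phi>L mF])
    show "norm (m n \<xi>) \<le> 1" for n \<xi> by (simp add: m_def mb(1))
    show "(\<lambda>n. m n \<xi>) \<longlonglongrightarrow> 1" for \<xi>
    proof (rule LIM_zero_cancel, rule Lim_null_comparison)
      show "\<forall>\<^sub>F n in sequentially. norm (m n \<xi> - 1) \<le> d n * norm \<xi>" by (simp add: m_def mb(2))
      show "(\<lambda>n. d n * norm \<xi>) \<longlonglongrightarrow> 0" using tendsto_mult_left_zero[OF d0] .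
    qed
  qed
  ultimately show ?thesis using test by blast
qed

subsection \<open>Spaces with prescribed support\<close>

text \<open>The union of all open sets on which \<open>v\<close> vanishes almost everywhere is
  reduced to a countable union by the Lindelof property; conversely the complement of the closure is
  itself such an open set.\<close>

lemma ess_support_subset_iff:
  "ess_support v \<subseteq> closure E \<longleftrightarrow> (AE x in lebesgue. x \<notin> closure E \<longrightarrow> v x = 0)"
proof
  assume "AE x in lebesgue. x \<notin> closure E \<longrightarrow> v x = 0"
  then have "- closure E \<in> {U. open U \<and> (AE x in lebesgue. x \<in> U \<longrightarrow> v x = 0)}" by auto
  then show "ess_support v \<subseteq> closure E" unfolding ess_support_def by blast
next
  assume sub: "ess_support v \<subseteq> closure E"
  let ?F = "{U. open U \<and> (AE x in lebesgue. x \<in> U \<longrightarrow> v x = 0)}"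
  obtain F where F: "F \<subseteq> ?F" "countable F" "\<Union>F = \<Union>?F"
    using Lindelof[of ?F] by blast
  have "AE x in lebesgue. \<forall>U\<in>F. x \<in> U \<longrightarrow> v x = 0"
    using F by (intro AE_ball_countable') auto
  then show "AE x in lebesgue. x \<notin> closure E \<longrightarrow> v x = 0"
  proof eventually_elim
    case (elim x)
    have "x \<in> \<Union>F" if "x \<notin> closure E" using that sub F(3) unfolding ess_support_def by auto
    then show ?case using elim by blast
  qed
qed

lemma tilde_Hs_iff: "v \<in> tilde_Hs s E \<longleftrightarrow> v \<in> Hs s \<and> (AE x in lebesgue. x \<notin> closure E \<longrightarrow> v x = 0)"
  by (auto simp: tilde_Hs_def ess_support_subset_iff)

lemma tilde_Hs_mono: "E \<subseteq> F \<Longrightarrow> tilde_Hs s E \<subseteq> tilde_Hs s F"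
  unfolding tilde_Hs_def using closure_mono by blast

lemma tilde_Hs_add: "v \<in> tilde_Hs s E \<Longrightarrow> w \<in> tilde_Hs s E \<Longrightarrow> (\<lambda>x. v x + w x) \<in> tilde_Hs s E"
  unfolding tilde_Hs_iff by (auto elim: eventually_elim2)

lemma tilde_Hs_cmult: "v \<in> tilde_Hs s E \<Longrightarrow> (\<lambda>x. c * v x) \<in> tilde_Hs s E"
  unfolding tilde_Hs_iff by (auto elim!: eventually_mono)

lemma tilde_Hs_diff: "v \<in> tilde_Hs s E \<Longrightarrow> w \<in> tilde_Hs s E \<Longrightarrow> (\<lambda>x. v x - w x) \<in> tilde_Hs s E"
  using tilde_Hs_add[OF _ tilde_Hs_cmult[of w s E "-1"]] by simp

lemma dual_add: "l \<in> dual_space V N \<Longrightarrow> v \<in> V \<Longrightarrow> w \<in> V \<Longrightarrow> l (\<lambda>x. v x + w x) = l v + l w"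
  by (simp add: dual_space_def)

lemma dual_cmult: "l \<in> dual_space V N \<Longrightarrow> v \<in> V \<Longrightarrow> l (\<lambda>x. c * v x) = c * l v"
  by (simp add: dual_space_def)

lemma dual_bound:
  assumes "l \<in> dual_space V N"
  obtains C where "\<And>v. v \<in> V \<Longrightarrow> \<bar>l v\<bar> \<le> C * N v"
proof -
  obtain C where "\<forall>v\<in>V. \<bar>l v\<bar> \<le> C * N v" using assms by (auto simp: dual_space_def)
  then show thesis by (intro that[of C]) auto
qed

lemma dual_diff:
  assumes "l \<in> dual_space V N" "v \<in> V" "w \<in> V" "\<And>c v. v \<in> V \<Longrightarrow> (\<lambda>x. c * v x) \<in> V"
  shows "l (\<lambda>x. v x - w x) = l v - l w"
  using dual_add[OF assms(1,2) assms(4)[OF assms(3), of "-1"]] dual_cmult[OF assms(1,3), of "-1"]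
  by simp

lemma dual_tendsto:
  assumes l: "l \<in> dual_space V N" and v: "v \<in> V" and x: "\<And>n. x n \<in> V"
    and sub: "\<And>c v. v \<in> V \<Longrightarrow> (\<lambda>x. c * v x) \<in> V" "\<And>v w. v \<in> V \<Longrightarrow> w \<in> V \<Longrightarrow> (\<lambda>x. v x - w x) \<in> V"
    and lim: "((\<lambda>n. N (\<lambda>y. x n y - v y)) \<longlongrightarrow> 0) F"
  shows "((\<lambda>n. l (x n)) \<longlongrightarrow> l v) F"
proof -
  obtain C where C: "\<And>v. v \<in> V \<Longrightarrow> \<bar>l v\<bar> \<le> C * N v" using dual_bound[OF l] by blast
  show ?thesis
  proof (rule LIM_zero_cancel, rule Lim_null_comparison)
    show "\<forall>\<^sub>F n in F. norm (l (x n) - l v) \<le> C * N (\<lambda>y. x n y - v y)"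
      using C[OF sub(2)[OF x v]] by (simp add: dual_diff[OF l x v sub(1)])
    show "((\<lambda>n. C * N (\<lambda>y. x n y - v y)) \<longlongrightarrow> 0) F" using tendsto_mult_right_zero[OF lim] .
  qed
qed

lemma dual_tilde_Hs_tendsto:
  assumes l: "l \<in> dual_space (tilde_Hs s E) (Hs_norm s)" and v: "v \<in> tilde_Hs s E" and x: "\<And>n. x n \<in> tilde_Hs s E"
    and lim: "((\<lambda>n. Hs_norm s (\<lambda>y. x n y - v y)) \<longlongrightarrow> 0) F"
  shows "((\<lambda>n. l (x n)) \<longlongrightarrow> l v) F"
  by (rule dual_tendsto[OF l v x tilde_Hs_cmult tilde_Hs_diff lim])

text \<open>In a boundary chart, moving by t along \<nu> raises the height \<open>G\<close> over the
  graph by exactly t, and points of the closure have nonnegative height.\<close>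

lemma bounded_Lipschitz_domain_cone:
  assumes \<Omega>: "bounded_Lipschitz_domain \<Omega>" and p: "p \<in> closure \<Omega>"
  shows "\<exists>r>0. \<exists>\<nu>. \<forall>x \<in> closure \<Omega> \<inter> cball p r. \<forall>t. 0 < t \<longrightarrow> t < r \<longrightarrow> x + t *\<^sub>R \<nu> \<in> \<Omega>"
proof (cases "p \<in> \<Omega>")
  case True
  have "open \<Omega>" using \<Omega> by (simp add: bounded_Lipschitz_domain_def)
  then obtain r where "0 < r" "cball p r \<subseteq> \<Omega>" using True open_contains_cball by blast
  \<comment> \<open>At an interior point the zero direction serves, a whole ball around the point
    lying in \<Omega>.\<close>
  then show ?thesis by (intro exI[of _ r] conjI exI[of _ 0]) auto
next
  case False
  have op: "open \<Omega>" using \<Omega> by (simp add: bounded_Lipschitz_domain_def)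
  have "p \<in> frontier \<Omega>" using False p op by (simp add: frontier_def interior_open)
  then obtain r \<nu> \<gamma> L where r: "0 < r" and \<nu>: "norm \<nu> = 1" and \<gamma>: "L-lipschitz_on {y. y \<bullet> \<nu> = 0} \<gamma>"
    and eq: "\<Omega> \<inter> ball p r = {x \<in> ball p r. x \<bullet> \<nu> > (\<gamma> (x - (x \<bullet> \<nu>) *\<^sub>R \<nu>) :: real)}"
    using \<Omega> unfolding bounded_Lipschitz_domain_def by blast
  have \<nu>\<nu>: "\<nu> \<bullet> \<nu> = 1" using \<nu> by (simp add: norm_eq_1)
  define P where "P = (\<lambda>x. x - (x \<bullet> \<nu>) *\<^sub>R \<nu>)"
  define G where "G = (\<lambda>x. x \<bullet> \<nu> - \<gamma> (P x))"
  have PH: "P x \<in> {y. y \<bullet> \<nu> = 0}" for x by (simp add: P_def inner_diff_left \<nu>\<nu>)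
  have contG: "continuous_on UNIV G"
    unfolding G_def
  proof (intro continuous_on_diff continuous_on_compose2[OF lipschitz_on_continuous_on[OF \<gamma>]])
    show "continuous_on UNIV P" unfolding P_def by (intro continuous_intros)
  qed (use PH in \<open>auto intro!: continuous_intros\<close>)
  have shift: "G (x + t *\<^sub>R \<nu>) = G x + t" for x t
  proof -
    have i: "(x + t *\<^sub>R \<nu>) \<bullet> \<nu> = x \<bullet> \<nu> + t" by (simp add: inner_add_left \<nu>\<nu>)
    have "P (x + t *\<^sub>R \<nu>) = P x" unfolding P_def i scaleR_add_left by simp
    then show ?thesis by (simp add: G_def i)
  qed
  have memb: "x \<in> \<Omega> \<longleftrightarrow> 0 < G x" if "x \<in> ball p r" for x
  proof -
    have "x \<in> \<Omega> \<longleftrightarrow> x \<in> \<Omega> \<inter> ball p r" using that by blast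
    also have "\<dots> \<longleftrightarrow> \<gamma> (P x) < x \<bullet> \<nu>" unfolding eq P_def using that by blast
    finally show ?thesis by (simp only: G_def diff_gt_0_iff_gt)
  qed
  \<comment> \<open>Halving the radius keeps the translated point inside the chart.\<close>
  have "x + t *\<^sub>R \<nu> \<in> \<Omega>" if x: "x \<in> closure \<Omega>" "x \<in> cball p (r/2)" and t: "0 < t" "t < r/2" for x t
  proof -
    have xb: "x \<in> ball p r" using x r by simp
    \<comment> \<open>A negative height would persist on a neighbourhood, which must meet \<Omega>,
      where heights are positive.\<close>
    have "0 \<le> G x"
    proof (rule ccontr)
      assume "\<not> 0 \<le> G x"
      then have "x \<in> ball p r \<inter> G -` {..<0}" using xb by auto
      moreover have "open (ball p r \<inter> G -` {..<0})"
        using contG by (intro open_Int open_vimage) auto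
      ultimately obtain y where "y \<in> \<Omega>" "y \<in> ball p r \<inter> G -` {..<0}"
        using x(1) unfolding closure_iff_nhds_not_empty by blast
      then show False using memb[of y] by auto
    qed
    then have "0 < G (x + t *\<^sub>R \<nu>)" using t by (simp add: shift)
    moreover have "dist p (x + t *\<^sub>R \<nu>) \<le> dist p x + dist x (x + t *\<^sub>R \<nu>)" by (rule dist_triangle)
    then have "x + t *\<^sub>R \<nu> \<in> ball p r" using x t \<nu> by (simp add: dist_norm)
    ultimately show ?thesis using memb by blast
  qed
  then show ?thesis using r by (intro exI[of _ "r/2"] conjI exI[of _ \<nu>]) auto
qed

lemma Hs_norm_AE_0:
  assumes "v \<in> Hs s" "AE x in lebesgue. v x = 0" shows "Hs_norm s v = 0"
proof -
  have vL: "v \<in> L2 lebesgue" by (rule Hs_L2[OF assms(1)])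
  have "norm_L2 lebesgue (fourier v) = 0"
    unfolding norm_L2_fourier[OF vL] using assms(2) by (simp only: norm_L2_eq_0_iff[OF vL])
  then have "AE \<xi> in lebesgue. fourier v \<xi> = 0" by (simp only: norm_L2_eq_0_iff[OF fourier_in_L2[OF vL]])
  then have "AE \<xi> in lebesgue. bessel_hat s v \<xi> = 0" by eventually_elim (simp add: bessel_hat_def)
  then show ?thesis by (simp only: Hs_norm_eq norm_L2_eq_0_iff[OF Hs_bessel_hat_L2[OF assms(1)]])
qed

text \<open>Test functions are dense in \<open>tilde_Hs s \<Omega>\<close>, in dual form: localise near the boundary, translate
  into the domain, mollify.\<close>

lemma dual_tilde_Hs_eq_0:
  fixes \<Omega> :: "(real^'n) set"
  assumes s: "0 < s" "s < 1" and \<Omega>: "bounded_Lipschitz_domain \<Omega>"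
    and l: "l \<in> dual_space (tilde_Hs s \<Omega>) (Hs_norm s)"
    and l0: "\<And>\<phi>. \<phi> \<in> test_functions \<Omega> \<Longrightarrow> \<phi> \<in> tilde_Hs s \<Omega> \<Longrightarrow> l \<phi> = 0"
    and v: "v \<in> tilde_Hs s \<Omega>"
  shows "l v = 0"
proof -
  have op: "open \<Omega>" and bd: "bounded \<Omega>" using \<Omega> by (auto simp: bounded_Lipschitz_domain_def)
  note lim = dual_tilde_Hs_tendsto[OF l]
  \<comment> \<open>With compact support inside \<Omega>, mollification gives test functions
    converging in norm, and \<open>l\<close> is continuous.\<close>
  have inner: "l u = 0" if u: "u \<in> Hs s" and K: "compact K" "K \<subseteq> \<Omega>" and supp: "AE x in lebesgue. x \<notin> K \<longrightarrow> u x = 0" for u K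
  proof -
    obtain \<phi> where \<phi>: "\<And>n::nat. \<phi> n \<in> test_functions \<Omega>" "\<And>n. \<phi> n \<in> Hs s" "(\<lambda>n. Hs_norm s (\<lambda>x. \<phi> n x - u x)) \<longlonglongrightarrow> 0"
      using Hs_approx_test_functions[OF u _ K op supp] s by auto
    have ut: "u \<in> tilde_Hs s \<Omega>"
      unfolding tilde_Hs_iff using u supp
    proof (intro conjI)
      show "AE x in lebesgue. x \<notin> closure \<Omega> \<longrightarrow> u x = 0"
        using supp by eventually_elim (use K closure_subset in blast)
    qed
    have \<phi>t: "\<phi> n \<in> tilde_Hs s \<Omega>" for n
    proof -
      have "\<phi> n x = 0" if "x \<notin> closure \<Omega>" for x
        using that \<phi>(1)[of n] closure_subset[of "{x. \<phi> n x \<noteq> 0}"] closure_subset[of \<Omega>] unfolding test_functions_def by blast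
      then show ?thesis unfolding tilde_Hs_iff using \<phi>(2) by auto
    qed
    have "(\<lambda>n. l (\<phi> n)) \<longlonglongrightarrow> l u" by (rule lim[OF ut \<phi>t \<phi>(3)])
    then show ?thesis using l0[OF \<phi>(1) \<phi>t] by (simp add: LIMSEQ_const_iff)
  qed
  have "\<forall>p\<in>closure \<Omega>. \<exists>r>0. \<exists>\<nu>. \<forall>x \<in> closure \<Omega> \<inter> cball p r. \<forall>t. 0 < t \<longrightarrow> t < r \<longrightarrow> x + t *\<^sub>R \<nu> \<in> \<Omega>"
    using bounded_Lipschitz_domain_cone[OF \<Omega>] by blast
  from bchoice[OF this] obtain r
    where r': "\<forall>p\<in>closure \<Omega>. 0 < r p \<and> (\<exists>\<nu>. \<forall>x \<in> closure \<Omega> \<inter> cball p (r p). \<forall>t. 0 < t \<longrightarrow> t < r p \<longrightarrow> x + t *\<^sub>R \<nu> \<in> \<Omega>)" ..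
  then have r: "\<And>p. p \<in> closure \<Omega> \<Longrightarrow> 0 < r p" by blast
  have "\<forall>p\<in>closure \<Omega>. \<exists>\<nu>. \<forall>x \<in> closure \<Omega> \<inter> cball p (r p). \<forall>t. 0 < t \<longrightarrow> t < r p \<longrightarrow> x + t *\<^sub>R \<nu> \<in> \<Omega>"
    using r' by blast
  from bchoice[OF this] obtain \<nu>
    where \<nu>: "\<forall>p\<in>closure \<Omega>. \<forall>x \<in> closure \<Omega> \<inter> cball p (r p). \<forall>t. 0 < t \<longrightarrow> t < r p \<longrightarrow> x + t *\<^sub>R \<nu> p \<in> \<Omega>" ..
  have cone: "x + t *\<^sub>R \<nu> p \<in> \<Omega>"
    if "p \<in> closure \<Omega>" "x \<in> closure \<Omega>" "x \<in> cball p (r p)" "0 < t" "t < r p" for p x t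
    using \<nu> that by blast
  \<comment> \<open>A small translation along \<open>\<nu> p\<close> pushes a support near p into
    \<Omega>, and the translates converge in norm as the step shrinks.\<close>
  have loc: "l u = 0" if p: "p \<in> closure \<Omega>" and u: "u \<in> tilde_Hs s \<Omega>" and supp: "AE x in lebesgue. x \<notin> cball p (r p) \<longrightarrow> u x = 0" for p u
  proof -
    have uH: "u \<in> Hs s" using u by (simp add: tilde_Hs_iff)
    define K where "K = closure \<Omega> \<inter> cball p (r p)"
    have K: "compact K" using bd by (auto simp: K_def compact_Int)
    have suppK: "AE x in lebesgue. x \<notin> K \<longrightarrow> u x = 0"
      using supp u unfolding tilde_Hs_iff by (auto simp: K_def elim: eventually_elim2)
    \<comment> \<open>Starting the denominators at 2 keeps every step strictly below
      \<open>r p\<close>.\<close>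
    define t where "t = (\<lambda>n::nat. r p / real (Suc (Suc n)))"
    have t: "0 < t n" "t n < r p" for n using r[OF p] by (auto simp: t_def divide_simps)
    have t0: "t \<longlonglongrightarrow> 0"
      using tendsto_mult_right_zero[OF LIMSEQ_Suc[OF LIMSEQ_inverse_real_of_nat], of "r p"] by (simp add: t_def divide_inverse)
    define w where "w = (\<lambda>n x. u (x + (- t n) *\<^sub>R \<nu> p))"
    have wH: "w n \<in> Hs s" for n unfolding w_def by (rule Hs_shift[OF uH])
    have KT: "compact ((\<lambda>x. x + t n *\<^sub>R \<nu> p) ` K)" for n
      by (intro compact_continuous_image K continuous_intros)
    have KT\<Omega>: "(\<lambda>x. x + t n *\<^sub>R \<nu> p) ` K \<subseteq> \<Omega>" for n using cone[OF p _ _ t] by (auto simp: K_def)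
    have suppw: "AE x in lebesgue. x \<notin> (\<lambda>x. x + t n *\<^sub>R \<nu> p) ` K \<longrightarrow> w n x = 0" for n
      using AE_lebesgue_shift[OF suppK, of "(- t n) *\<^sub>R \<nu> p"]
    proof eventually_elim
      case (elim x)
      have "x \<in> (\<lambda>x. x + t n *\<^sub>R \<nu> p) ` K" if "x + (- t n) *\<^sub>R \<nu> p \<in> K"
        by (rule image_eqI[OF _ that]) simp
      then show ?case using elim unfolding w_def by blast
    qed
    have wt: "w n \<in> tilde_Hs s \<Omega>" for n
    proof -
      have "AE x in lebesgue. x \<notin> closure \<Omega> \<longrightarrow> w n x = 0"
        using suppw[of n] by eventually_elim (use KT\<Omega>[of n] closure_subset in blast)
      then show ?thesis using wH by (simp add: tilde_Hs_iff)
    qed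
    have "(\<lambda>n. (- t n) *\<^sub>R \<nu> p) \<longlonglongrightarrow> (- 0) *\<^sub>R \<nu> p" by (intro tendsto_intros t0)
    then have "(\<lambda>n. Hs_norm s (\<lambda>x. w n x - u x)) \<longlonglongrightarrow> 0"
      unfolding w_def by (intro Hs_shift_tendsto uH) simp
    then have "(\<lambda>n. l (w n)) \<longlonglongrightarrow> l u" by (rule lim[OF u wt])
    then show ?thesis using inner[OF wH KT KT\<Omega> suppw] by (simp add: LIMSEQ_const_iff)
  qed
  obtain F where F: "F \<subseteq> closure \<Omega>" "finite F" "closure \<Omega> \<subseteq> (\<Union>p\<in>F. ball p (r p / 2))"
  proof (rule compactE_image[of "closure \<Omega>" "closure \<Omega>" "\<lambda>p. ball p (r p / 2)"])
    show "compact (closure \<Omega>)" using bd by simp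
    show "closure \<Omega> \<subseteq> (\<Union>p\<in>closure \<Omega>. ball p (r p / 2))" using r by force
  qed (auto intro: that)
  \<comment> \<open>Induction over the balls of the cover replaces a partition of unity: each stage
    splits off the part near one ball and leaves a remainder that vanishes outside the other
    balls.\<close>
  have "l u = 0" if "finite F" "F \<subseteq> closure \<Omega>" "u \<in> tilde_Hs s \<Omega>" "AE x in lebesgue. x \<notin> (\<Union>p\<in>F. ball p (r p / 2)) \<longrightarrow> u x = 0" for F u
    using that
  proof (induction F arbitrary: u rule: finite_induct)
    case empty
    obtain C where "\<bar>l u\<bar> \<le> C * Hs_norm s u" using dual_bound[OF l] empty(2) by metis
    moreover have "Hs_norm s u = 0" using empty by (intro Hs_norm_AE_0) (auto simp: tilde_Hs_iff)
    ultimately show ?case by simp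
  next
    case (insert p F)
    have p: "p \<in> closure \<Omega>" using insert by auto
    have rp: "0 < r p" by (rule r[OF p])
    have uH: "u \<in> Hs s" using insert.prems by (simp add: tilde_Hs_iff)
    \<comment> \<open>A tent in the distance to p, equal to 1 on the half ball and 0 outside radius
      \<open>r p\<close>, with slope \<open>2 / r p\<close>. The part it cuts out falls under
      \<open>loc\<close>.\<close>
    define \<eta> where "\<eta> = (\<lambda>x. max 0 (min 1 (2 - 2 / r p * dist x p)))"
    have \<eta>1: "\<eta> x = 1" if "x \<in> ball p (r p / 2)" for x
      using that rp by (simp add: \<eta>_def dist_commute field_simps)
    have \<eta>0: "\<eta> x = 0" if "x \<notin> cball p (r p)" for x
      using that rp by (simp add: \<eta>_def dist_commute field_simps)
    have \<eta>b: "0 \<le> \<eta> x" "\<eta> x \<le> 1" for x by (auto simp: \<eta>_def)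
    have \<eta>L: "\<bar>\<eta> x - \<eta> y\<bar> \<le> 2 / r p * norm (x - y)" for x y
    proof -
      have "\<bar>\<eta> x - \<eta> y\<bar> \<le> \<bar>2 / r p * dist x p - 2 / r p * dist y p\<bar>"
        unfolding \<eta>_def by (auto simp: max_def min_def abs_if)
      also have "\<dots> = 2 / r p * \<bar>dist x p - dist y p\<bar>" using rp by (simp only: right_diff_distrib[symmetric] abs_mult) simp
      also have "\<dots> \<le> 2 / r p * dist x y"
        using rp abs_dist_diff_le[of x p y] by (intro mult_left_mono) (auto simp: dist_commute)
      finally show ?thesis by (simp add: dist_norm)
    qed
    have 1: "(\<lambda>x. \<eta> x * u x) \<in> tilde_Hs s \<Omega>"
      unfolding tilde_Hs_iff
    proof
      show "(\<lambda>x. \<eta> x * u x) \<in> Hs s"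
        by (rule Hs_mult_Lipschitz[OF uH s _ \<eta>L, of 1]) (simp add: \<eta>b)
      show "AE x in lebesgue. x \<notin> closure \<Omega> \<longrightarrow> \<eta> x * u x = 0"
        using insert.prems(2) unfolding tilde_Hs_iff by (auto elim!: eventually_mono)
    qed
    have 2: "(\<lambda>x. u x - \<eta> x * u x) \<in> tilde_Hs s \<Omega>"
      by (intro tilde_Hs_diff 1 insert.prems)
    have "AE x in lebesgue. x \<notin> cball p (r p) \<longrightarrow> \<eta> x * u x = 0" using \<eta>0 by auto
    then have z1: "l (\<lambda>x. \<eta> x * u x) = 0" by (rule loc[OF p 1])
    have z2: "l (\<lambda>x. u x - \<eta> x * u x) = 0"
    proof (rule insert.IH[OF _ 2])
      show "AE x in lebesgue. x \<notin> (\<Union>p\<in>F. ball p (r p / 2)) \<longrightarrow> u x - \<eta> x * u x = 0"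
        using insert.prems(3) by eventually_elim (use \<eta>1 in auto)
    qed (use insert.prems in auto)
    have "l u = l (\<lambda>x. \<eta> x * u x + (u x - \<eta> x * u x))" by simp
    also have "\<dots> = 0" using dual_add[OF l 1 2] z1 z2 by simp
    finally show ?case .
  qed
  note * = this[OF F(2,1) v]
  have "AE x in lebesgue. x \<notin> closure \<Omega> \<longrightarrow> v x = 0" using v by (simp add: tilde_Hs_iff)
  then have "AE x in lebesgue. x \<notin> (\<Union>p\<in>F. ball p (r p / 2)) \<longrightarrow> v x = 0"
    by eventually_elim (use F(3) in blast)
  then show ?thesis by (rule *)
qed

subsection \<open>Test functions as multipliers from \<open>H1 \<Omega>\<close> to \<open>Hs s\<close>\<close>

definition extend0 :: "(real^'n) set \<Rightarrow> (real^'n \<Rightarrow> real) \<Rightarrow> real^'n \<Rightarrow> real" where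
  "extend0 \<Omega> v x = indicator \<Omega> x * v x"

lemma integral_lebesgue_on_open:
  fixes \<Omega> :: "(real^'n) set"
  assumes "open \<Omega>"
  shows "(LINT x|lebesgue_on \<Omega>. v x) = (LINT x|lebesgue. indicator \<Omega> x * v x :: real)"
  using assms by (subst integral_restrict_space) auto

lemma
  fixes \<Omega> :: "(real^'n) set"
  assumes \<Omega>: "open \<Omega>"
  shows extend0_L2: "v \<in> L2 (lebesgue_on \<Omega>) \<Longrightarrow> extend0 \<Omega> v \<in> L2 lebesgue"
    and norm_L2_extend0: "(norm_L2 lebesgue (extend0 \<Omega> v))\<^sup>2 = (LINT x|lebesgue_on \<Omega>. (v x)\<^sup>2)"
proof -
  have S: "\<Omega> \<inter> space lebesgue \<in> sets lebesgue" using \<Omega> by auto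
  have e: "(extend0 \<Omega> v x)\<^sup>2 = indicator \<Omega> x * (v x)\<^sup>2" for x v by (simp add: extend0_def indicator_def)
  show "extend0 \<Omega> v \<in> L2 lebesgue" if "v \<in> L2 (lebesgue_on \<Omega>)"
  proof -
    have "v \<in> borel_measurable (lebesgue_on \<Omega>)" "integrable (lebesgue_on \<Omega>) (\<lambda>x. (v x)\<^sup>2)"
      using that by (auto simp: L2_def)
    then have "(\<lambda>x. indicator \<Omega> x *\<^sub>R v x) \<in> borel_measurable lebesgue" "integrable lebesgue (\<lambda>x. indicator \<Omega> x *\<^sub>R (v x)\<^sup>2)"
      using borel_measurable_restrict_space_iff[OF S, of v] integrable_restrict_space[OF S, of "\<lambda>x. (v x)\<^sup>2"] by auto
    moreover have "extend0 \<Omega> v = (\<lambda>x. indicator \<Omega> x *\<^sub>R v x)" by (auto simp: extend0_def)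
    ultimately show ?thesis unfolding L2_def mem_Collect_eq real_norm_def power2_abs e by simp
  qed
  show "(norm_L2 lebesgue (extend0 \<Omega> v))\<^sup>2 = (LINT x|lebesgue_on \<Omega>. (v x)\<^sup>2)"
    unfolding norm_L2_sq integral_lebesgue_on_open[OF \<Omega>] real_norm_def power2_abs e ..
qed

lemma H1_norm_sq:
  assumes "open \<Omega>"
  shows "(H1_norm \<Omega> v)\<^sup>2 = (norm_L2 lebesgue (extend0 \<Omega> v))\<^sup>2 + (\<Sum>i\<in>UNIV. (norm_L2 lebesgue (extend0 \<Omega> (weak_partial \<Omega> i v)))\<^sup>2)"
  unfolding H1_norm_def norm_L2_extend0[OF assms, symmetric] by (simp add: sum_nonneg)

lemma H1_norm_nonneg [simp]: "0 \<le> H1_norm \<Omega> v"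
  unfolding H1_norm_def by (intro real_sqrt_ge_zero add_nonneg_nonneg sum_nonneg Bochner_Integration.integral_nonneg) auto

lemma weak_partial_spec:
  assumes "v \<in> H1 \<Omega>" shows "is_weak_partial \<Omega> i v (weak_partial \<Omega> i v)"
proof -
  have "\<exists>h. is_weak_partial \<Omega> i v h" using assms by (simp add: H1_def)
  then show ?thesis unfolding weak_partial_def by (rule someI_ex)
qed

lemma test_functions_mult:
  assumes \<phi>: "\<phi> \<in> test_functions \<Omega>" and \<theta>: "\<And>k. Ck k \<theta>"
  shows "(\<lambda>x. \<phi> x * \<theta> x) \<in> test_functions \<Omega>"
proof -
  have sub: "closure {x. \<phi> x * \<theta> x \<noteq> 0} \<subseteq> closure {x. \<phi> x \<noteq> 0}" by (intro closure_mono) auto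
  have "bounded {x. \<phi> x \<noteq> 0}" using \<phi> by (simp add: test_functions_def)
  then have "compact (closure {x. \<phi> x * \<theta> x \<noteq> 0})"
    unfolding compact_closure by (rule bounded_subset) auto
  then show ?thesis using \<phi> sub \<theta> by (auto simp: test_functions_def intro: Ck_mult)
qed

text \<open>Test functions are real, so the phase is split into cosine and sine before a weak
  derivative can be tested.\<close>

lemma fourier_integral_real:
  fixes w :: "real^'n \<Rightarrow> real"
  assumes w: "integrable lebesgue w"
  shows "fourier_integral (\<lambda>x. complex_of_real (w x)) \<xi> =
    complex_of_real (ft_const TYPE('n)) * Complex (LINT x|lebesgue. w x * cos (x \<bullet> \<xi>)) (- (LINT x|lebesgue. w x * sin (x \<bullet> \<xi>)))"
proof -
  have i: "integrable lebesgue (\<lambda>x. cis (- (x \<bullet> \<xi>)) * complex_of_real (w x))"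
    using w by (intro integrable_cis_mult) simp
  have "(LINT x|lebesgue. cis (- (x \<bullet> \<xi>)) * complex_of_real (w x))
     = Complex (LINT x|lebesgue. w x * cos (x \<bullet> \<xi>)) (- (LINT x|lebesgue. w x * sin (x \<bullet> \<xi>)))"
    using integral_Re[OF i] integral_Im[OF i] by (simp add: complex_eq_iff mult.commute)
  then show ?thesis by (simp add: fourier_integral_eq)
qed

lemma test_function_support:
  assumes "\<phi> \<in> test_functions \<Omega>"
  obtains R where "\<And>x. R < norm x \<Longrightarrow> \<phi> x = 0"
proof -
  have "bounded {x. \<phi> x \<noteq> 0}" using assms by (simp add: test_functions_def)
  then obtain R where R: "\<And>x. x \<in> {x. \<phi> x \<noteq> 0} \<Longrightarrow> norm x \<le> R" unfolding bounded_iff by blast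
  show thesis using R by (intro that[of R]) (metis mem_Collect_eq not_le)
qed

text \<open>Testing the weak derivative against \<open>\<phi> cos\<close> and \<open>\<phi> sin\<close> yields the Fourier transform of the
  derivative of \<open>\<phi> v\<close>.\<close>

lemma H1_mult_fourier:
  fixes \<phi> v :: "real^'n \<Rightarrow> real" and i :: 'n
  assumes \<Omega>: "open \<Omega>" and \<phi>: "\<phi> \<in> test_functions \<Omega>" and v: "v \<in> H1 \<Omega>"
  defines "G \<equiv> \<lambda>x. partial i \<phi> x * extend0 \<Omega> v x + \<phi> x * extend0 \<Omega> (weak_partial \<Omega> i v) x"
  assumes w: "integrable lebesgue (\<lambda>x. \<phi> x * v x)" and G: "integrable lebesgue G"
  shows "fourier_integral (\<lambda>x. complex_of_real (G x)) \<xi> = \<i> * complex_of_real (\<xi> $ i) * fourier_integral (\<lambda>x. complex_of_real (\<phi> x * v x)) \<xi>"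
proof -
  let ?h = "weak_partial \<Omega> i v"
  have \<phi>0: "\<phi> x = 0" if "x \<notin> \<Omega>" for x
    using that \<phi> closure_subset[of "{x. \<phi> x \<noteq> 0}"] by (auto simp: test_functions_def)
  have Ck\<phi>: "Ck k \<phi>" for k using \<phi> by (simp add: test_functions_def)
  have d\<phi>: "\<phi> differentiable (at x)" for x using Ck\<phi>[of "Suc 0"] by simp
  have test: "(LINT x|lebesgue. indicator \<Omega> x * (v x * partial i \<theta> x)) = - (LINT x|lebesgue. indicator \<Omega> x * (?h x * \<theta> x))"
    if "\<theta> \<in> test_functions \<Omega>" for \<theta>
    using weak_partial_spec[OF v, of i] that unfolding is_weak_partial_def integral_lebesgue_on_open[OF \<Omega>] by blast
  have fi: "integrable lebesgue (\<lambda>x. \<phi> x * v x * cos (x \<bullet> \<xi>))" "integrable lebesgue (\<lambda>x. \<phi> x * v x * sin (x \<bullet> \<xi>))"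
    "integrable lebesgue (\<lambda>x. G x * cos (x \<bullet> \<xi>))" "integrable lebesgue (\<lambda>x. G x * sin (x \<bullet> \<xi>))"
  proof -
    have m: "(\<lambda>x. cos (x \<bullet> \<xi>)) \<in> borel_measurable lebesgue" "(\<lambda>x. sin (x \<bullet> \<xi>)) \<in> borel_measurable lebesgue"
      by (auto intro!: continuous_lebesgue_measurable continuous_intros)
    have "integrable lebesgue (\<lambda>x. a x * c x)"
      if a: "integrable lebesgue a" and c: "c \<in> borel_measurable lebesgue" "\<And>x. \<bar>c x\<bar> \<le> 1" for a c :: "real^'n \<Rightarrow> real"
    proof (rule Bochner_Integration.integrable_bound[OF a])
      show "AE x in lebesgue. norm (a x * c x) \<le> norm (a x)"
        using c(2) by (auto simp: abs_mult mult_left_le)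
    qed (use a c in auto)
    then show "integrable lebesgue (\<lambda>x. \<phi> x * v x * cos (x \<bullet> \<xi>))" "integrable lebesgue (\<lambda>x. \<phi> x * v x * sin (x \<bullet> \<xi>))"
      "integrable lebesgue (\<lambda>x. G x * cos (x \<bullet> \<xi>))" "integrable lebesgue (\<lambda>x. G x * sin (x \<bullet> \<xi>))"
      using w G m by auto
  qed
  \<comment> \<open>The weak derivative is tested with \<open>\<phi> x * c x\<close>; the Leibniz
    terms regroup into \<open>G x * c x\<close> and the term with \<open>c'\<close>.\<close>
  have step: "(LINT x|lebesgue. G x * c x) = - (LINT x|lebesgue. \<phi> x * v x * c' x)"
    if c: "\<And>k. Ck k c" and c': "\<And>x. partial i c x = c' x"
      and I: "integrable lebesgue (\<lambda>x. G x * c x)" "integrable lebesgue (\<lambda>x. \<phi> x * v x * c' x)" for c c'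
  proof -
    have dc: "c differentiable (at x)" for x using c[of "Suc 0"] by simp
    have p: "partial i (\<lambda>x. \<phi> x * c x) x = \<phi> x * c' x + partial i \<phi> x * c x" for x
      by (simp add: partial_mult[OF d\<phi> dc] c')
    have t: "(LINT x|lebesgue. indicator \<Omega> x * (v x * (\<phi> x * c' x + partial i \<phi> x * c x))) = - (LINT x|lebesgue. indicator \<Omega> x * (?h x * (\<phi> x * c x)))"
      using test[OF test_functions_mult[OF \<phi> c]] unfolding p .
    define A where "A = (\<lambda>x. indicator \<Omega> x * (v x * (\<phi> x * c' x + partial i \<phi> x * c x)))"
    define D where "D = (\<lambda>x. indicator \<Omega> x * (?h x * (\<phi> x * c x)))"
    have AD: "A x + D x = \<phi> x * v x * c' x + G x * c x" for x
      using \<phi>0[of x] by (cases "x \<in> \<Omega>") (simp_all add: A_def D_def G_def extend0_def algebra_simps)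
    have hL: "extend0 \<Omega> ?h \<in> L2 lebesgue"
      using weak_partial_spec[OF v, of i] extend0_L2[OF \<Omega>] by (simp add: is_weak_partial_def)
    have \<phi>ct: "(\<lambda>x. \<phi> x * c x) \<in> test_functions \<Omega>" by (rule test_functions_mult[OF \<phi> c])
    \<comment> \<open>Only \<open>D\<close> is shown integrable directly; \<open>A\<close> follows
      from the sum, whose integrability is part of the assumptions of this step.\<close>
    have iD: "integrable lebesgue D"
    proof -
      have cont: "continuous_on UNIV (\<lambda>x. \<phi> x * c x)" using \<phi>ct by (auto simp: test_functions_def dest: spec[of _ 0])
      obtain R where R: "\<And>x. R < norm x \<Longrightarrow> \<phi> x * c x = 0" using test_function_support[OF \<phi>ct] by blast
      obtain B where B: "0 \<le> B" "\<And>x. \<bar>\<phi> x * c x\<bar> \<le> B" using bounded_if_compact_support[OF cont R] by blast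
      have "(\<lambda>x. \<phi> x * c x) \<in> L2 lebesgue"
      proof (rule L2_bounded_support(1)[OF continuous_lebesgue_measurable[OF cont], of "cball 0 R" B])
        have "norm (\<phi> x * c x) \<le> B * indicat_real (cball 0 R) x" for x
          using B(2)[of x] R[of x] by (cases "norm x \<le> R") simp_all
        then show "AE x in lebesgue. norm (\<phi> x * c x) \<le> B * indicat_real (cball 0 R) x" by simp
      qed (use B in auto)
      from L2_inner_integrable[OF hL this] show ?thesis by (simp add: D_def extend0_def mult.assoc)
    qed
    have "integrable lebesgue (\<lambda>x. A x + D x)" unfolding AD using I by simp
    from Bochner_Integration.integrable_diff[OF this iD] have iA: "integrable lebesgue A" by simp
    have "(LINT x|lebesgue. A x + D x) = 0" using t iA iD by (simp add: A_def[symmetric] D_def[symmetric])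
    then show ?thesis unfolding AD using I by simp
  qed
  have c1: "(LINT x|lebesgue. G x * cos (x \<bullet> \<xi>)) = \<xi> $ i * (LINT x|lebesgue. \<phi> x * v x * sin (x \<bullet> \<xi>))"
  proof -
    have e: "\<phi> x * v x * (- (\<xi> $ i) * sin (x \<bullet> \<xi>)) = (- (\<xi> $ i)) * (\<phi> x * v x * sin (x \<bullet> \<xi>))" for x by simp
    have "(LINT x|lebesgue. G x * cos (x \<bullet> \<xi>)) = - (LINT x|lebesgue. \<phi> x * v x * (- (\<xi> $ i) * sin (x \<bullet> \<xi>)))"
      by (rule step[OF conjunct1[OF Ck_cos_sin] partial_cos fi(3)]) (unfold e, intro integrable_mult_right fi)
    then show ?thesis unfolding e by simp
  qed
  have c2: "(LINT x|lebesgue. G x * sin (x \<bullet> \<xi>)) = - (\<xi> $ i * (LINT x|lebesgue. \<phi> x * v x * cos (x \<bullet> \<xi>)))"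
  proof -
    have e: "\<phi> x * v x * (\<xi> $ i * cos (x \<bullet> \<xi>)) = \<xi> $ i * (\<phi> x * v x * cos (x \<bullet> \<xi>))" for x by simp
    have "(LINT x|lebesgue. G x * sin (x \<bullet> \<xi>)) = - (LINT x|lebesgue. \<phi> x * v x * (\<xi> $ i * cos (x \<bullet> \<xi>)))"
      by (rule step[OF conjunct2[OF Ck_cos_sin] partial_sin fi(4)]) (unfold e, intro integrable_mult_right fi)
    then show ?thesis unfolding e by simp
  qed
  show ?thesis
    unfolding fourier_integral_real[OF w] fourier_integral_real[OF G] c1 c2
    by (simp add: complex_eq_iff algebra_simps)
qed

text \<open>For s at most 1 the weight is at most \<open>1 + (norm \<xi>)\<^sup>2\<close>, and each
  coordinate times the transform of the product is, in modulus, the transform of the corresponding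
  derivative, an L2 function.\<close>

lemma H1_mult_Hs:
  fixes \<phi> :: "real^'n \<Rightarrow> real"
  assumes \<Omega>: "open \<Omega>" and \<phi>: "\<phi> \<in> test_functions \<Omega>" and s: "0 \<le> s" "s \<le> 1"
  shows "\<exists>C. \<forall>v\<in>H1 \<Omega>. (\<lambda>x. \<phi> x * v x) \<in> Hs s \<and> Hs_norm s (\<lambda>x. \<phi> x * v x) \<le> C * H1_norm \<Omega> v"
proof -
  have Ck\<phi>: "Ck k \<phi>" for k using \<phi> by (simp add: test_functions_def)
  have \<phi>\<Omega>: "\<phi> x = 0" if "x \<notin> \<Omega>" for x
    using that \<phi> closure_subset[of "{x. \<phi> x \<noteq> 0}"] by (auto simp: test_functions_def)
  obtain R where R: "\<And>x. R < norm x \<Longrightarrow> \<phi> x = 0" using test_function_support[OF \<phi>] by blast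
  have pR: "R < norm x \<Longrightarrow> partial i \<phi> x = 0" for x i by (rule partial_zero_outside[OF R])
  have cont: "continuous_on UNIV \<phi>" "continuous_on UNIV (partial i \<phi>)" for i using Ck\<phi>[of 0] Ck\<phi>[of "Suc 0"] by auto
  obtain B where B: "0 \<le> B" "\<And>x. \<bar>\<phi> x\<bar> \<le> B" using bounded_if_compact_support[OF cont(1) R] by blast
  have "\<exists>B\<ge>0. \<forall>x. \<bar>partial i \<phi> x\<bar> \<le> B" for i by (rule bounded_if_compact_support[OF cont(2) pR])
  then obtain B' where B': "\<And>i. 0 \<le> B' i" "\<And>i x. \<bar>partial i \<phi> x\<bar> \<le> B' i" by metis
  have mult: "(\<lambda>x. c x * a x) \<in> L2 lebesgue" "norm_L2 lebesgue (\<lambda>x. c x * a x) \<le> b * norm_L2 lebesgue a"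
    if a: "a \<in> L2 lebesgue" and c: "continuous_on UNIV c" "\<And>x. \<bar>c x\<bar> \<le> b" for a c :: "real^'n \<Rightarrow> real" and b
  proof -
    have b: "0 \<le> b" using c(2)[of 0] by linarith
    have m: "(\<lambda>x. c x * a x) \<in> borel_measurable lebesgue"
      using L2_measurable[OF a] continuous_lebesgue_measurable[OF c(1)] by simp
    have le: "AE x in lebesgue. norm (c x * a x) \<le> b * norm (a x)"
      using c(2) by (auto simp: abs_mult mult_right_mono)
    show "(\<lambda>x. c x * a x) \<in> L2 lebesgue" "norm_L2 lebesgue (\<lambda>x. c x * a x) \<le> b * norm_L2 lebesgue a"
      by (rule L2_dominate[OF a m b le])+
  qed
  \<comment> \<open>\<open>C\<close> dominates both the coefficient collected by \<open>v\<close>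
    itself and the one collected by its weak derivatives.\<close>
  define C where "C = B\<^sup>2 + (\<Sum>i\<in>UNIV. 2 * (B' i)\<^sup>2) + 2 * B\<^sup>2"
  have C0: "0 \<le> C" unfolding C_def by (intro add_nonneg_nonneg sum_nonneg) auto
  have main: "(\<lambda>x. \<phi> x * v x) \<in> Hs s \<and> Hs_norm s (\<lambda>x. \<phi> x * v x) \<le> sqrt C * H1_norm \<Omega> v" if v: "v \<in> H1 \<Omega>" for v
  proof -
    let ?w = "\<lambda>x. \<phi> x * v x" and ?e = "extend0 \<Omega> v" and ?d = "\<lambda>i. extend0 \<Omega> (weak_partial \<Omega> i v)"
    define G where "G = (\<lambda>i x. partial i \<phi> x * ?e x + \<phi> x * ?d i x)"
    have eL: "?e \<in> L2 lebesgue" using v extend0_L2[OF \<Omega>] by (simp add: H1_def)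
    have dL: "?d i \<in> L2 lebesgue" for i
      using weak_partial_spec[OF v, of i] extend0_L2[OF \<Omega>] by (simp add: is_weak_partial_def)
    have we: "?w = (\<lambda>x. \<phi> x * ?e x)" by (rule ext) (use \<phi>\<Omega> in \<open>auto simp: extend0_def indicator_def\<close>)
    have wL: "?w \<in> L2 lebesgue" and wN: "norm_L2 lebesgue ?w \<le> B * norm_L2 lebesgue ?e"
      unfolding we by (rule mult[OF eL cont(1) B(2)])+
    have GL: "G i \<in> L2 lebesgue" for i
      unfolding G_def by (intro L2_add mult(1)[OF eL cont(2) B'(2)] mult(1)[OF dL cont(1) B(2)])
    have GN: "(norm_L2 lebesgue (G i))\<^sup>2 \<le> 2 * (B' i)\<^sup>2 * (norm_L2 lebesgue ?e)\<^sup>2 + 2 * B\<^sup>2 * (norm_L2 lebesgue (?d i))\<^sup>2" for i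
    proof -
      have "norm_L2 lebesgue (G i) \<le> B' i * norm_L2 lebesgue ?e + B * norm_L2 lebesgue (?d i)"
        unfolding G_def
        using norm_L2_triangle[OF mult(1)[OF eL cont(2) B'(2)] mult(1)[OF dL cont(1) B(2)], of i i]
          mult(2)[OF eL cont(2) B'(2), of i] mult(2)[OF dL cont(1) B(2), of i] by linarith
      then have "(norm_L2 lebesgue (G i))\<^sup>2 \<le> (B' i * norm_L2 lebesgue ?e + B * norm_L2 lebesgue (?d i))\<^sup>2"
        by (intro power_mono) auto
      also have "\<dots> \<le> 2 * (B' i * norm_L2 lebesgue ?e)\<^sup>2 + 2 * (B * norm_L2 lebesgue (?d i))\<^sup>2"
        using norm_add_sq_le[of "B' i * norm_L2 lebesgue ?e" "B * norm_L2 lebesgue (?d i)"] unfolding real_norm_def power2_abs .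
      finally show ?thesis by (simp add: power_mult_distrib mult.assoc)
    qed
    have w0: "AE x in lebesgue. R < norm x \<longrightarrow> ?w x = 0" using R by auto
    have G0: "AE x in lebesgue. R < norm x \<longrightarrow> G i x = 0" for i using R pR by (auto simp: G_def)
    have wi: "integrable lebesgue ?w" by (rule fourier_bounded_support(1)[OF wL w0])
    have Gi: "integrable lebesgue (G i)" for i by (rule fourier_bounded_support(1)[OF GL G0])
    have FG: "AE \<xi> in lebesgue. \<forall>i. norm (fourier (G i) \<xi>) = \<bar>\<xi> $ i\<bar> * norm (fourier ?w \<xi>)"
    proof -
      have "AE \<xi> in lebesgue. \<forall>i. fourier (G i) \<xi> = fourier_integral (\<lambda>x. complex_of_real (G i x)) \<xi>"
        using fourier_bounded_support(2)[OF GL G0] by (simp add: AE_all_countable)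
      then show ?thesis
        using fourier_bounded_support(2)[OF wL w0]
      proof eventually_elim
        case (elim \<xi>)
        show ?case
          using elim H1_mult_fourier[OF \<Omega> \<phi> v wi, of _ \<xi>] Gi unfolding G_def by (simp add: norm_mult)
      qed
    qed
    have ptw: "AE \<xi> in lebesgue. (norm (bessel_hat s ?w \<xi>))\<^sup>2 \<le> (norm (fourier ?w \<xi>))\<^sup>2 + (\<Sum>i\<in>UNIV. (norm (fourier (G i) \<xi>))\<^sup>2)"
      using FG
    proof eventually_elim
      case (elim \<xi>)
      have "(1 + (norm \<xi>)\<^sup>2) powr s \<le> (1 + (norm \<xi>)\<^sup>2) powr 1" using s by (intro powr_mono) auto
      also have "\<dots> = 1 + (norm \<xi>)\<^sup>2" by simp
      finally have "(norm (bessel_hat s ?w \<xi>))\<^sup>2 \<le> (1 + (norm \<xi>)\<^sup>2) * (norm (fourier ?w \<xi>))\<^sup>2"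
        unfolding norm_bessel_hat_sq by (intro mult_right_mono) auto
      also have "(norm \<xi>)\<^sup>2 = (\<Sum>i\<in>UNIV. (\<xi> $ i)\<^sup>2)"
        by (simp add: norm_vec_def L2_set_def sum_nonneg)
      finally show ?case using elim
        by (simp add: distrib_right sum_distrib_right power_mult_distrib)
    qed
    have iF: "integrable lebesgue (\<lambda>\<xi>. (norm (fourier ?w \<xi>))\<^sup>2)" "\<And>i. integrable lebesgue (\<lambda>\<xi>. (norm (fourier (G i) \<xi>))\<^sup>2)"
      by (intro L2_integrable fourier_in_L2 wL GL)+
    have iS: "integrable lebesgue (\<lambda>\<xi>. (norm (fourier ?w \<xi>))\<^sup>2 + (\<Sum>i\<in>UNIV. (norm (fourier (G i) \<xi>))\<^sup>2))"
      using iF by auto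
    have wm: "(\<lambda>\<xi>. (norm (bessel_hat s ?w \<xi>))\<^sup>2) \<in> borel_measurable lebesgue"
      using bessel_hat_measurable[OF wL, of s] by measurable
    have "integrable lebesgue (\<lambda>\<xi>. (norm (bessel_hat s ?w \<xi>))\<^sup>2)"
      by (rule Bochner_Integration.integrable_bound[OF iS wm]) (use ptw in \<open>auto simp: sum_nonneg elim!: eventually_mono\<close>)
    then have wH: "?w \<in> Hs s" and iW: "integrable lebesgue (\<lambda>\<xi>. (norm (bessel_hat s ?w \<xi>))\<^sup>2)"
      using wL bessel_hat_measurable[OF wL, of s] by (auto simp: Hs_iff L2_def)
    have "(Hs_norm s ?w)\<^sup>2 \<le> (LINT \<xi>|lebesgue. (norm (fourier ?w \<xi>))\<^sup>2 + (\<Sum>i\<in>UNIV. (norm (fourier (G i) \<xi>))\<^sup>2))"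
      unfolding Hs_norm_eq norm_L2_sq by (rule integral_mono_AE[OF iW iS ptw])
    also have "\<dots> = (norm_L2 lebesgue (fourier ?w))\<^sup>2 + (\<Sum>i\<in>UNIV. (norm_L2 lebesgue (fourier (G i)))\<^sup>2)"
      using iF unfolding norm_L2_sq by (simp add: Bochner_Integration.integral_sum)
    also have "\<dots> = (norm_L2 lebesgue ?w)\<^sup>2 + (\<Sum>i\<in>UNIV. (norm_L2 lebesgue (G i))\<^sup>2)"
      by (simp only: norm_L2_fourier[OF wL] norm_L2_fourier[OF GL])
    also have "\<dots> \<le> (B * norm_L2 lebesgue ?e)\<^sup>2 + (\<Sum>i\<in>UNIV. 2 * (B' i)\<^sup>2 * (norm_L2 lebesgue ?e)\<^sup>2 + 2 * B\<^sup>2 * (norm_L2 lebesgue (?d i))\<^sup>2)"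
      by (intro add_mono sum_mono GN power_mono wN) auto
    also have "\<dots> = (B\<^sup>2 + (\<Sum>i\<in>UNIV. 2 * (B' i)\<^sup>2)) * (norm_L2 lebesgue ?e)\<^sup>2 + 2 * B\<^sup>2 * (\<Sum>i\<in>UNIV. (norm_L2 lebesgue (?d i))\<^sup>2)"
      by (simp add: sum.distrib sum_distrib_left sum_distrib_right power_mult_distrib distrib_right)
    also have "\<dots> \<le> C * (norm_L2 lebesgue ?e)\<^sup>2 + C * (\<Sum>i\<in>UNIV. (norm_L2 lebesgue (?d i))\<^sup>2)"
    proof -
      have "0 \<le> (\<Sum>i\<in>UNIV. 2 * (B' i)\<^sup>2)" "0 \<le> B\<^sup>2" by (auto intro: sum_nonneg)
      then have "B\<^sup>2 + (\<Sum>i\<in>UNIV. 2 * (B' i)\<^sup>2) \<le> C" "2 * B\<^sup>2 \<le> C" unfolding C_def by linarith+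
      then show ?thesis by (intro add_mono mult_right_mono sum_nonneg) auto
    qed
    also have "\<dots> = C * (H1_norm \<Omega> v)\<^sup>2" by (simp add: H1_norm_sq[OF \<Omega>] distrib_left)
    finally have "Hs_norm s ?w \<le> sqrt (C * (H1_norm \<Omega> v)\<^sup>2)" by (rule real_le_rsqrt)
    then show ?thesis using wH by (simp add: real_sqrt_mult)
  qed
  then show ?thesis by (intro exI[of _ "sqrt C"]) blast
qed

subsection \<open>Convergence of the solutions\<close>

lemma Hs_norm_minus_commute:
  assumes "v \<in> Hs s" "w \<in> Hs s"
  shows "Hs_norm s (\<lambda>x. v x - w x) = Hs_norm s (\<lambda>x. w x - v x)"
  unfolding Hs_norm_diff[OF assms] Hs_norm_diff[OF assms(2,1)] by (rule norm_L2_minus_commute)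

text \<open>Convergence in \<open>Hs s\<close> implies L2 convergence, hence almost everywhere
  convergence of a subsequence, which preserves the zeros outside the closure.\<close>

lemma tilde_Hs_closed:
  assumes p: "\<And>n::nat. p n \<in> tilde_Hs s E" and q: "q \<in> Hs s" and s: "0 \<le> s"
    and lim: "(\<lambda>n. Hs_norm s (\<lambda>x. p n x - q x)) \<longlonglongrightarrow> 0"
  shows "q \<in> tilde_Hs s E"
proof -
  have pH: "p n \<in> Hs s" for n using p by (simp add: tilde_Hs_iff)
  have "(\<lambda>n. norm_L2 lebesgue (\<lambda>x. p n x - q x)) \<longlonglongrightarrow> 0"
    by (rule tendsto_sandwich[OF _ _ tendsto_const lim]) (auto intro!: norm_L2_le_Hs_norm Hs_diff pH q s always_eventually)
  from L2_limit_AE[OF Hs_L2[OF pH] Hs_L2[OF q] this]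
  obtain r where "AE x in lebesgue. (\<lambda>n. p (r n) x) \<longlonglongrightarrow> q x" by blast
  moreover have "AE x in lebesgue. \<forall>n. x \<notin> closure E \<longrightarrow> p n x = 0"
    unfolding AE_all_countable using p by (simp add: tilde_Hs_iff)
  ultimately have "AE x in lebesgue. x \<notin> closure E \<longrightarrow> q x = 0"
  proof eventually_elim
    case (elim x)
    show ?case
    proof
      assume "x \<notin> closure E"
      then have "(\<lambda>n. 0) \<longlonglongrightarrow> q x" using elim by simp
      then show "q x = 0" by (simp add: LIMSEQ_const_iff)
    qed
  qed
  then show ?thesis using q by (simp add: tilde_Hs_iff)
qed

theorem theorem1p2:
  fixes s :: real
    and \<Omega> :: "(real^'n) set"
    and T :: "real \<Rightarrow> (real^'n) set"
    and w :: "real \<Rightarrow> real^'n \<Rightarrow> real"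
    and f :: "(real^'n \<Rightarrow> real) \<Rightarrow> real"
    and g :: "real^'n \<Rightarrow> real"
    and u\<^sub>\<epsilon> :: "real \<Rightarrow> real^'n \<Rightarrow> real"
  assumes "CARD('n) \<ge> 2"
    and "0 < s" and "s < 1"
    and "bounded_Lipschitz_domain \<Omega>"
    and "\<And>\<epsilon>. \<epsilon> > 0 \<Longrightarrow> closed (T \<epsilon>)"
    and "vanishing_holes \<Omega> T"
    and "\<And>\<epsilon>. \<epsilon> > 0 \<Longrightarrow> w \<epsilon> \<in> H1 \<Omega>"
    and "\<And>\<epsilon>. \<epsilon> > 0 \<Longrightarrow> AE x in lebesgue. x \<in> \<Omega> \<inter> holes T \<epsilon> \<longrightarrow> w \<epsilon> x = 0"
    and "weakly_tendsto (H1 \<Omega>) (H1_norm \<Omega>) w (\<lambda>x. 1) (at_right 0)"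
    and "f \<in> tilde_Hs_dual s \<Omega>"
    and "g \<in> Hs s"
    and "\<And>\<epsilon>. \<epsilon> > 0 \<Longrightarrow> is_solution s (perforated \<Omega> T \<epsilon>) f g (u\<^sub>\<epsilon> \<epsilon>)"
  shows "\<exists>u. is_solution s \<Omega> f g u \<and>
           (\<forall>v. is_solution s \<Omega> f g v \<longrightarrow> (AE x in lebesgue. v x = u x)) \<and>
           (\<forall>e::nat \<Rightarrow> real. (\<forall>k. e k > 0) \<and> e \<longlonglongrightarrow> 0 \<longrightarrow>
              (\<exists>r. strict_mono r \<and>
                 weakly_tendsto (Hs s) (Hs_norm s) (\<lambda>k. u\<^sub>\<epsilon> (e (r k))) u sequentially))"
proof -

  \<comment> \<open>Nested spaces and coercivity\<close>
  note s = assms(2,3) and lip = assms(4) and w1 = assms(7) and w0 = assms(8)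
    and wlim = assms(9) and g = assms(11) and sol = assms(12)
  have s0: "0 \<le> s" using s by simp
  have f: "f \<in> dual_space (tilde_Hs s \<Omega>) (Hs_norm s)" using assms(10) by (simp add: tilde_Hs_dual_def)
  have op: "open \<Omega>" and bd: "bounded \<Omega>" using lip by (auto simp: bounded_Lipschitz_domain_def)
  let ?V = "tilde_Hs s \<Omega>"
  let ?W = "\<lambda>\<epsilon>. tilde_Hs s (perforated \<Omega> T \<epsilon>)"
  let ?N = "Hs_norm s" and ?a = "frac_form s"
  have W_mono: "?W \<epsilon> \<subseteq> ?W \<epsilon>'" if "\<epsilon>' \<le> \<epsilon>" for \<epsilon> \<epsilon>'
    using that by (intro tilde_Hs_mono) (auto simp: perforated_def holes_def)
  have WV: "?W \<epsilon> \<subseteq> ?V" for \<epsilon> by (intro tilde_Hs_mono) (auto simp: perforated_def)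
  have VH: "v \<in> Hs s" if "v \<in> ?V" for v using that by (simp add: tilde_Hs_iff)
  obtain R where R: "\<And>x. x \<in> closure \<Omega> \<Longrightarrow> norm x \<le> R"
    using bounded_closure[OF bd] unfolding bounded_iff by blast
  obtain CP where CP: "0 \<le> CP"
    "\<And>v::real^'n \<Rightarrow> real. v \<in> Hs s \<Longrightarrow> (AE x in lebesgue. R < norm x \<longrightarrow> v x = 0) \<Longrightarrow> ?N v \<le> CP * norm_L2 lebesgue (riesz_hat s v)"
    using poincare[OF s0, of R, where 'n='n] by blast
  \<comment> \<open>One ball contains the closure of \<Omega>, so the same constant works in every
    perforated space.\<close>
  have coercive: "(?N v)\<^sup>2 \<le> CP\<^sup>2 * ?a v v" if v: "v \<in> ?V" for v
  proof -
    have "AE x in lebesgue. x \<notin> closure \<Omega> \<longrightarrow> v x = 0" using v by (simp add: tilde_Hs_iff)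
    then have "AE x in lebesgue. R < norm x \<longrightarrow> v x = 0"
      by eventually_elim (meson R not_le)
    then have "?N v \<le> CP * norm_L2 lebesgue (riesz_hat s v)" by (rule CP(2)[OF VH[OF v]])
    then have "(?N v)\<^sup>2 \<le> (CP * norm_L2 lebesgue (riesz_hat s v))\<^sup>2" by (intro power_mono) auto
    then show ?thesis by (simp add: power_mult_distrib frac_form_self[OF VH[OF v] s0])
  qed
  have a_nonneg: "0 \<le> ?a v v" if "v \<in> Hs s" for v by (simp add: frac_form_self[OF that s0])
  have a_diff: "?a (\<lambda>x. v x - v' x) y = ?a v y - ?a v' y" if "v \<in> Hs s" "v' \<in> Hs s" "y \<in> Hs s" for v v' y
    by (rule frac_form_diff[OF that s0])

  \<comment> \<open>Corrections as Galerkin projections\<close>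
  define p where "p = (\<lambda>\<epsilon> x. u\<^sub>\<epsilon> \<epsilon> x - g x)"
  have uH: "u\<^sub>\<epsilon> \<epsilon> \<in> Hs s" and pW: "p \<epsilon> \<in> ?W \<epsilon>" and weak: "\<And>y. y \<in> ?W \<epsilon> \<Longrightarrow> ?a (u\<^sub>\<epsilon> \<epsilon>) y = f y" if "0 < \<epsilon>" for \<epsilon>
    using sol[OF that] by (auto simp: is_solution_def p_def)
  have pV: "p \<epsilon> \<in> ?V" if "0 < \<epsilon>" for \<epsilon> using pW[OF that] WV by blast
  have pH: "p \<epsilon> \<in> Hs s" if "0 < \<epsilon>" for \<epsilon> by (rule VH[OF pV[OF that]])
  \<comment> \<open>Moving \<open>g\<close> to the right makes \<open>p \<epsilon>\<close> the
    solution of a linear problem whose data do not depend on \<epsilon>.\<close>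
  have ap: "?a (p \<epsilon>) y = f y - ?a g y" if "0 < \<epsilon>" "y \<in> ?W \<epsilon>" for \<epsilon> y
  proof -
    have "y \<in> Hs s" using that(2) WV VH by blast
    then show ?thesis using weak[OF that] a_diff[OF uH[OF that(1)] g] by (simp only: p_def)
  qed

  text \<open>Galerkin orthogonality for the nested spaces.\<close>
  have energy: "?a (\<lambda>x. p \<epsilon>' x - p \<epsilon> x) (\<lambda>x. p \<epsilon>' x - p \<epsilon> x) = ?a (p \<epsilon>') (p \<epsilon>') - ?a (p \<epsilon>) (p \<epsilon>)"
    if \<epsilon>: "0 < \<epsilon>'" "\<epsilon>' \<le> \<epsilon>" for \<epsilon> \<epsilon>'
  proof -
    have e: "0 < \<epsilon>" using \<epsilon> by simp
    have H: "p \<epsilon>' \<in> Hs s" "p \<epsilon> \<in> Hs s" using pH \<epsilon> e by auto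
    have "p \<epsilon> \<in> ?W \<epsilon>'" using pW[OF e] W_mono[OF \<epsilon>(2)] by blast
    then have 1: "?a (p \<epsilon>') (p \<epsilon>) = ?a (p \<epsilon>) (p \<epsilon>)" by (simp add: ap \<epsilon>(1) e pW[OF e])
    let ?d = "\<lambda>x. p \<epsilon>' x - p \<epsilon> x"
    have "?a ?d ?d = ?a (p \<epsilon>') ?d - ?a (p \<epsilon>) ?d" by (rule a_diff[OF H Hs_diff[OF H]])
    also have "?a (p \<epsilon>') ?d = ?a (p \<epsilon>') (p \<epsilon>') - ?a (p \<epsilon>) (p \<epsilon>')"
      unfolding frac_form_commute[of s "p \<epsilon>'" ?d] by (rule a_diff[OF H H(1)])
    also have "?a (p \<epsilon>) ?d = ?a (p \<epsilon>') (p \<epsilon>) - ?a (p \<epsilon>) (p \<epsilon>)"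
      unfolding frac_form_commute[of s "p \<epsilon>" ?d] by (rule a_diff[OF H H(2)])
    finally show ?thesis
      using 1 frac_form_commute[of s "p \<epsilon>" "p \<epsilon>'"] by linarith
  qed

  \<comment> \<open>Energy bound and Cauchy property\<close>
  obtain Cf where Cf: "\<And>v. v \<in> ?V \<Longrightarrow> \<bar>f v\<bar> \<le> Cf * ?N v" using dual_bound[OF f] by blast
  \<comment> \<open>Testing the equation of \<open>p \<epsilon>\<close> with itself bounds the
    energy by \<open>M\<close> times its own square root. The absolute value is taken because the
    sign of \<open>Cf\<close> is unknown.\<close>
  define M where "M = (\<bar>Cf\<bar> + ?N g) * CP"
  have M0: "0 \<le> M" using CP by (simp add: M_def)
  have bounded: "?a (p \<epsilon>) (p \<epsilon>) \<le> M\<^sup>2" if \<epsilon>: "0 < \<epsilon>" for \<epsilon>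
  proof -
    let ?J = "?a (p \<epsilon>) (p \<epsilon>)"
    have J: "0 \<le> ?J" by (rule a_nonneg[OF pH[OF \<epsilon>]])
    have N: "?N (p \<epsilon>) \<le> CP * sqrt ?J"
      using real_sqrt_le_mono[OF coercive[OF pV[OF \<epsilon>]]] CP(1) by (simp add: real_sqrt_mult)
    have "?J = f (p \<epsilon>) - ?a g (p \<epsilon>)" by (rule ap[OF \<epsilon> pW[OF \<epsilon>]])
    also have "\<dots> \<le> Cf * ?N (p \<epsilon>) + ?N g * ?N (p \<epsilon>)"
      using Cf[OF pV[OF \<epsilon>]] frac_form_bound[OF g pH[OF \<epsilon>] s0] by linarith
    also have "\<dots> \<le> (\<bar>Cf\<bar> + ?N g) * ?N (p \<epsilon>)"
      by (simp add: distrib_right mult_right_mono)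
    also have "\<dots> \<le> (\<bar>Cf\<bar> + ?N g) * (CP * sqrt ?J)" using N by (intro mult_left_mono) auto
    finally have le: "?J \<le> M * sqrt ?J" by (simp add: M_def mult.assoc)
    have "sqrt ?J \<le> M"
    proof (cases "?J = 0")
      case False
      then have "0 < sqrt ?J" using J by simp
      moreover have "sqrt ?J * sqrt ?J \<le> M * sqrt ?J" using le J by simp
      ultimately show ?thesis by (simp only: mult_le_cancel_right_pos)
    qed (simp add: M0)
    then have "(sqrt ?J)\<^sup>2 \<le> M\<^sup>2" using J by (intro power_mono) auto
    then show ?thesis using J by simp
  qed
  have cauchy: "\<exists>\<epsilon>0>0. \<forall>\<epsilon> \<epsilon>'. 0 < \<epsilon> \<longrightarrow> \<epsilon> \<le> \<epsilon>0 \<longrightarrow> 0 < \<epsilon>' \<longrightarrow> \<epsilon>' \<le> \<epsilon>0 \<longrightarrow> ?N (\<lambda>x. p \<epsilon> x - p \<epsilon>' x) < e"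
    if e: "0 < e" for e
  proof -
    \<comment> \<open>The energies grow as \<epsilon> decreases. Once one of them is within \<eta>
      of the supremum, later energy differences are at most \<eta>, and these are energies of
      differences.\<close>
    define S where "S = (SUP \<epsilon>\<in>{0<..}. ?a (p \<epsilon>) (p \<epsilon>))"
    have bdd: "bdd_above ((\<lambda>\<epsilon>. ?a (p \<epsilon>) (p \<epsilon>)) ` {0<..})" using bounded by (auto intro!: bdd_aboveI)
    have leS: "?a (p \<epsilon>) (p \<epsilon>) \<le> S" if "0 < \<epsilon>" for \<epsilon> unfolding S_def using that by (intro cSUP_upper bdd) auto
    \<comment> \<open>Sized so that \<open>CP\<^sup>2 * \<eta>\<close> stays below
      \<open>e\<^sup>2\<close>.\<close>
    define \<eta> where "\<eta> = e\<^sup>2 / (CP\<^sup>2 + 1)"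
    have \<eta>: "0 < \<eta>" using e by (simp add: \<eta>_def add_nonneg_pos)
    have "S - \<eta> < (SUP \<epsilon>\<in>{0<..}. ?a (p \<epsilon>) (p \<epsilon>))" using \<eta> by (simp add: S_def)
    then obtain \<epsilon>0 where \<epsilon>0: "0 < \<epsilon>0" "S - \<eta> < ?a (p \<epsilon>0) (p \<epsilon>0)"
      using less_cSUP_iff[OF _ bdd, of "S - \<eta>"] by auto
    have main: "?N (\<lambda>x. p \<epsilon>' x - p \<epsilon> x) < e" if \<epsilon>: "0 < \<epsilon>'" "\<epsilon>' \<le> \<epsilon>" "\<epsilon> \<le> \<epsilon>0" for \<epsilon> \<epsilon>'
    proof -
      have e1: "0 < \<epsilon>" using \<epsilon> by simp
      have dV: "(\<lambda>x. p \<epsilon>' x - p \<epsilon> x) \<in> ?V" by (intro tilde_Hs_diff pV \<epsilon> e1)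
      have "?a (p \<epsilon>0) (p \<epsilon>0) \<le> ?a (p \<epsilon>) (p \<epsilon>)"
        using energy[OF e1 \<epsilon>(3)] a_nonneg[OF Hs_diff[OF pH[OF e1] pH[OF \<epsilon>0(1)]]] by simp
      then have "?a (\<lambda>x. p \<epsilon>' x - p \<epsilon> x) (\<lambda>x. p \<epsilon>' x - p \<epsilon> x) \<le> \<eta>"
        using energy[OF \<epsilon>(1,2)] leS[OF \<epsilon>(1)] \<epsilon>0(2) by linarith
      then have "(?N (\<lambda>x. p \<epsilon>' x - p \<epsilon> x))\<^sup>2 \<le> CP\<^sup>2 * \<eta>"
        using coercive[OF dV] mult_left_mono[of _ \<eta> "CP\<^sup>2"] by fastforce
      also have "\<dots> < (CP\<^sup>2 + 1) * \<eta>" using \<eta> by simp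
      also have "\<dots> = e\<^sup>2" by (simp add: \<eta>_def add_nonneg_eq_0_iff)
      finally show ?thesis using e by (intro power_less_imp_less_base[of _ 2 e]) auto
    qed
    show ?thesis
    proof (intro exI[of _ \<epsilon>0] conjI allI impI \<epsilon>0(1))
      fix \<epsilon> \<epsilon>' assume \<epsilon>: "0 < \<epsilon>" "\<epsilon> \<le> \<epsilon>0" "0 < \<epsilon>'" "\<epsilon>' \<le> \<epsilon>0"
      show "?N (\<lambda>x. p \<epsilon> x - p \<epsilon>' x) < e"
        using main[of \<epsilon> \<epsilon>'] main[of \<epsilon>' \<epsilon>] \<epsilon> Hs_norm_minus_commute[OF pH[OF \<epsilon>(1)] pH[OF \<epsilon>(3)]]
        by (cases "\<epsilon> \<le> \<epsilon>'") auto
    qed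
  qed

  \<comment> \<open>The limit, and convergence along every null sequence\<close>
  define a where "a = (\<lambda>n::nat. 1 / real (Suc n))"
  have a: "0 < a n" for n by (simp add: a_def)
  have a0: "a \<longlonglongrightarrow> 0" unfolding a_def using LIMSEQ_Suc[OF lim_1_over_n] .
  have seq_small: "\<forall>\<^sub>F n in sequentially. b n \<le> \<epsilon>0" if "b \<longlonglongrightarrow> 0" "0 < \<epsilon>0" for b :: "nat \<Rightarrow> real" and \<epsilon>0
    using order_tendstoD(2)[OF that] by (auto elim!: eventually_mono)
  have "\<exists>q. q \<in> Hs s \<and> (\<lambda>n. ?N (\<lambda>x. p (a n) x - q x)) \<longlonglongrightarrow> 0"
  proof (rule Hs_complete[OF pH[OF a] s0])
    fix e :: real assume "0 < e"
    then obtain \<epsilon>0 where \<epsilon>0: "0 < \<epsilon>0" "\<And>\<epsilon> \<epsilon>'. 0 < \<epsilon> \<Longrightarrow> \<epsilon> \<le> \<epsilon>0 \<Longrightarrow> 0 < \<epsilon>' \<Longrightarrow> \<epsilon>' \<le> \<epsilon>0 \<Longrightarrow> ?N (\<lambda>x. p \<epsilon> x - p \<epsilon>' x) < e"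
      using cauchy by blast
    obtain K where "\<And>n. n \<ge> K \<Longrightarrow> a n \<le> \<epsilon>0" using seq_small[OF a0 \<epsilon>0(1)] by (auto simp: eventually_sequentially)
    then show "\<exists>K. \<forall>m\<ge>K. \<forall>n\<ge>K. ?N (\<lambda>x. p (a m) x - p (a n) x) < e"
      using \<epsilon>0(2)[OF a _ a] by blast
  qed
  then obtain q where q: "q \<in> Hs s" "(\<lambda>n. ?N (\<lambda>x. p (a n) x - q x)) \<longlonglongrightarrow> 0" by blast
  have qV: "q \<in> ?V" by (rule tilde_Hs_closed[OF pV[OF a] q(1) s0 q(2)])
  have tri: "?N (\<lambda>x. v x - y x) \<le> ?N (\<lambda>x. v x - z x) + ?N (\<lambda>x. z x - y x)"
    if "v \<in> Hs s" "y \<in> Hs s" "z \<in> Hs s" for v y z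
    unfolding Hs_norm_diff[OF that(1,2)] Hs_norm_diff[OF that(1,3)] Hs_norm_diff[OF that(3,2)]
    by (intro norm_L2_triangle_diff Hs_bessel_hat_L2 that)
  define u where "u = (\<lambda>x. g x + q x)"
  have uHs: "u \<in> Hs s" unfolding u_def by (intro Hs_add g q)
  \<comment> \<open>The sequence \<open>a\<close> only produces \<open>q\<close>; the Cauchy
    property, uniform in \<epsilon>, carries the convergence over to any positive null
    sequence.\<close>
  have conv: "(\<lambda>k. ?N (\<lambda>x. u\<^sub>\<epsilon> (b k) x - u x)) \<longlonglongrightarrow> 0" if b: "\<And>k. 0 < b k" "b \<longlonglongrightarrow> 0" for b :: "nat \<Rightarrow> real"
  proof -
    have eq: "(\<lambda>x. u\<^sub>\<epsilon> (b k) x - u x) = (\<lambda>x. p (b k) x - q x)" for k by (simp add: p_def u_def algebra_simps)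
    show ?thesis unfolding eq
    proof (rule LIMSEQ_I)
      fix e :: real assume "0 < e"
      then obtain \<epsilon>0 where \<epsilon>0: "0 < \<epsilon>0" "\<And>\<epsilon> \<epsilon>'. 0 < \<epsilon> \<Longrightarrow> \<epsilon> \<le> \<epsilon>0 \<Longrightarrow> 0 < \<epsilon>' \<Longrightarrow> \<epsilon>' \<le> \<epsilon>0 \<Longrightarrow> ?N (\<lambda>x. p \<epsilon> x - p \<epsilon>' x) < e/2"
        using cauchy[of "e/2"] by auto
      obtain K where K: "\<And>n. n \<ge> K \<Longrightarrow> b n \<le> \<epsilon>0" using seq_small[OF b(2) \<epsilon>0(1)] by (auto simp: eventually_sequentially)
      have "\<forall>\<^sub>F m in sequentially. a m \<le> \<epsilon>0 \<and> ?N (\<lambda>x. p (a m) x - q x) < e/2"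
        using seq_small[OF a0 \<epsilon>0(1)] order_tendstoD(2)[OF q(2), of "e/2"] \<open>0 < e\<close> by (auto elim: eventually_elim2)
      then obtain m where m: "a m \<le> \<epsilon>0" "?N (\<lambda>x. p (a m) x - q x) < e/2"
        using eventually_happens'[OF sequentially_bot] by blast
      show "\<exists>K. \<forall>n\<ge>K. norm (?N (\<lambda>x. p (b n) x - q x) - 0) < e"
      proof (intro exI[of _ K] allI impI)
        fix n assume "K \<le> n"
        then have "?N (\<lambda>x. p (b n) x - p (a m) x) < e/2" by (intro \<epsilon>0(2) b a K m)
        then show "norm (?N (\<lambda>x. p (b n) x - q x) - 0) < e"
          using tri[OF pH[OF b(1)[of n]] q(1) pH[OF a[of m]]] m(2) by simp
      qed
    qed
  qed

  \<comment> \<open>The limit equation on the whole domain\<close>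
  have a_weak: "?a u y = f y" if \<epsilon>: "0 < \<epsilon>" and y: "y \<in> ?W \<epsilon>" for \<epsilon> y
  proof -
    have yH: "y \<in> Hs s" using y WV VH by blast
    have "(\<lambda>k. ?a (u\<^sub>\<epsilon> (a k)) y) \<longlonglongrightarrow> ?a u y"
    proof (rule LIM_zero_cancel, rule Lim_null_comparison)
      show "\<forall>\<^sub>F k in sequentially. norm (?a (u\<^sub>\<epsilon> (a k)) y - ?a u y) \<le> ?N (\<lambda>x. u\<^sub>\<epsilon> (a k) x - u x) * ?N y"
        using frac_form_bound[OF Hs_diff[OF uH[OF a] uHs] yH s0] by (simp add: a_diff[OF uH[OF a] uHs yH])
      show "(\<lambda>k. ?N (\<lambda>x. u\<^sub>\<epsilon> (a k) x - u x) * ?N y) \<longlonglongrightarrow> 0" by (intro tendsto_mult_left_zero conv a a0)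
    qed
    \<comment> \<open>Once \<open>a k\<close> is at most \<epsilon>, the function y is admissible in
      the problem solved by \<open>u\<^sub>\<epsilon> (a k)\<close>.\<close>
    moreover have "\<forall>\<^sub>F k in sequentially. ?a (u\<^sub>\<epsilon> (a k)) y = f y"
      using seq_small[OF a0 \<epsilon>]
    proof eventually_elim
      case (elim k)
      then show ?case using weak[OF a] W_mono[OF elim] y by blast
    qed
    ultimately have "(\<lambda>k. f y) \<longlonglongrightarrow> ?a u y" by (rule Lim_transform_eventually)
    then show ?thesis by (simp add: LIMSEQ_const_iff)
  qed
  \<comment> \<open>The residual of the limit equation; by \<open>a_weak\<close> it vanishes on each
    perforated space.\<close>
  define L where "L = (\<lambda>y. ?a u y - f y)"
  have L: "L \<in> dual_space ?V ?N"
    unfolding dual_space_def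
  proof (intro CollectI conjI ballI allI exI)
    fix v y assume "v \<in> ?V" "y \<in> ?V"
    then show "L (\<lambda>x. v x + y x) = L v + L y"
      using frac_form_add[OF VH VH uHs s0, of v y] dual_add[OF f, of v y]
      by (simp add: L_def frac_form_commute[of s u])
  next
    fix c v assume "v \<in> ?V"
    then show "L (\<lambda>x. c * v x) = c * L v"
      using frac_form_cmult[OF VH uHs s0, of v c] dual_cmult[OF f, of v c]
      by (simp add: L_def frac_form_commute[of s u] right_diff_distrib)
  next
    fix v assume v: "v \<in> ?V"
    show "\<bar>L v\<bar> \<le> (?N u + Cf) * ?N v"
      using frac_form_bound[OF uHs VH[OF v] s0] Cf[OF v] by (simp add: L_def distrib_right)
  qed
  have L_test: "L \<phi> = 0" if \<phi>: "\<phi> \<in> test_functions \<Omega>" and "\<phi> \<in> ?V" for \<phi>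
  proof -
    obtain C where C: "\<And>v. v \<in> H1 \<Omega> \<Longrightarrow> (\<lambda>x. \<phi> x * v x) \<in> Hs s" "\<And>v. v \<in> H1 \<Omega> \<Longrightarrow> ?N (\<lambda>x. \<phi> x * v x) \<le> C * H1_norm \<Omega> v"
      using H1_mult_Hs[OF op \<phi> s0] s by force
    have \<phi>0: "\<phi> x = 0" if "x \<notin> \<Omega>" for x
      using that \<phi> closure_subset[of "{x. \<phi> x \<noteq> 0}"] by (auto simp: test_functions_def)
    have mV: "(\<lambda>x. \<phi> x * v x) \<in> ?V" if "v \<in> H1 \<Omega>" for v
    proof -
      have "\<phi> x * v x = 0" if "x \<notin> closure \<Omega>" for x using that \<phi>0[of x] closure_subset by auto
      then show ?thesis using C(1)[OF that] by (simp add: tilde_Hs_iff)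
    qed
    obtain CL where CL: "\<And>v. v \<in> ?V \<Longrightarrow> \<bar>L v\<bar> \<le> CL * ?N v" using dual_bound[OF L] by blast
    \<comment> \<open>Multiplication by \<phi> maps \<open>H1 \<Omega>\<close> boundedly into the
      fractional space, so \<open>L\<close> pulls back to a functional against which the weak
      convergence of \<open>w\<close> can be tested.\<close>
    have l': "(\<lambda>v. L (\<lambda>x. \<phi> x * v x)) \<in> dual_space (H1 \<Omega>) (H1_norm \<Omega>)"
      unfolding dual_space_def
    proof (intro CollectI conjI ballI allI exI)
      fix v y assume "v \<in> H1 \<Omega>" "y \<in> H1 \<Omega>"
      then show "L (\<lambda>x. \<phi> x * (v x + y x)) = L (\<lambda>x. \<phi> x * v x) + L (\<lambda>x. \<phi> x * y x)"
        using dual_add[OF L mV mV, of v y] by (simp add: distrib_left)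
    next
      fix c v assume "v \<in> H1 \<Omega>"
      then show "L (\<lambda>x. \<phi> x * (c * v x)) = c * L (\<lambda>x. \<phi> x * v x)"
        using dual_cmult[OF L mV, of v c] by (simp add: mult.left_commute)
    next
      fix v assume v: "v \<in> H1 \<Omega>"
      have "\<bar>L (\<lambda>x. \<phi> x * v x)\<bar> \<le> \<bar>CL\<bar> * ?N (\<lambda>x. \<phi> x * v x)"
        using CL[OF mV[OF v]] mult_right_mono[OF abs_ge_self[of CL] Hs_norm_nonneg[of s "\<lambda>x. \<phi> x * v x"]] by linarith
      also have "\<dots> \<le> \<bar>CL\<bar> * (C * H1_norm \<Omega> v)" by (intro mult_left_mono C v) auto
      finally show "\<bar>L (\<lambda>x. \<phi> x * v x)\<bar> \<le> (\<bar>CL\<bar> * C) * H1_norm \<Omega> v" by (simp add: mult.assoc)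
    qed
    have "\<forall>l\<in>dual_space (H1 \<Omega>) (H1_norm \<Omega>). ((\<lambda>\<epsilon>. l (w \<epsilon>)) \<longlongrightarrow> l (\<lambda>x. 1)) (at_right 0)"
      using wlim unfolding weakly_tendsto_def by simp
    from bspec[OF this l'] have lim: "((\<lambda>\<epsilon>. L (\<lambda>x. \<phi> x * w \<epsilon> x)) \<longlongrightarrow> L (\<lambda>x. \<phi> x * 1)) (at_right 0)" .
    \<comment> \<open>The product vanishes outside \<Omega> through \<phi> and on the holes through
      \<open>w \<epsilon>\<close>, so it is admissible in the perforated problem.\<close>
    have zero: "L (\<lambda>x. \<phi> x * w \<epsilon> x) = 0" if \<epsilon>: "0 < \<epsilon>" for \<epsilon>
    proof -
      have "AE x in lebesgue. x \<notin> closure (perforated \<Omega> T \<epsilon>) \<longrightarrow> \<phi> x * w \<epsilon> x = 0"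
        using w0[OF \<epsilon>]
      proof eventually_elim
        case (elim x)
        show ?case
        proof
          assume "x \<notin> closure (perforated \<Omega> T \<epsilon>)"
          then have "x \<notin> perforated \<Omega> T \<epsilon>" using closure_subset by blast
          then show "\<phi> x * w \<epsilon> x = 0" using elim \<phi>0[of x] by (auto simp: perforated_def)
        qed
      qed
      then have "(\<lambda>x. \<phi> x * w \<epsilon> x) \<in> ?W \<epsilon>" using C(1)[OF w1[OF \<epsilon>]] by (simp add: tilde_Hs_iff)
      then show ?thesis using a_weak[OF \<epsilon>] by (simp add: L_def)
    qed
    have "\<forall>\<^sub>F \<epsilon> in at_right 0. L (\<lambda>x. \<phi> x * w \<epsilon> x) = 0"
      using eventually_at_right_less[of "0::real"] by eventually_elim (rule zero)
    then have "((\<lambda>\<epsilon>. 0) \<longlongrightarrow> L (\<lambda>x. \<phi> x * 1)) (at_right (0::real))"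
      using lim by (rule Lim_transform_eventually[rotated])
    then have "L (\<lambda>x. \<phi> x * 1) = 0" by (simp add: tendsto_const_iff)
    then show ?thesis by simp
  qed
  have L0: "L y = 0" if "y \<in> ?V" for y by (rule dual_tilde_Hs_eq_0[OF s lip L L_test that])
  have solu: "is_solution s \<Omega> f g u"
    unfolding is_solution_def
  proof (intro conjI ballI uHs)
    show "(\<lambda>x. u x - g x) \<in> ?V" using qV by (simp add: u_def)
    show "?a u y = f y" if "y \<in> ?V" for y using L0[OF that] by (simp add: L_def)
  qed

  \<comment> \<open>Uniqueness and conclusion\<close>
  have unique: "AE x in lebesgue. v x = u x" if v: "is_solution s \<Omega> f g v" for v
  proof -
    have vH: "v \<in> Hs s" using v by (simp add: is_solution_def)
    have "(\<lambda>x. (v x - g x) - (u x - g x)) \<in> ?V"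
      by (rule tilde_Hs_diff) (use v solu in \<open>auto simp: is_solution_def\<close>)
    then have dV: "(\<lambda>x. v x - u x) \<in> ?V" by simp
    \<comment> \<open>The difference of two solutions is itself admissible, so its energy is 0, and
      coercivity makes its norm 0.\<close>
    have "?a (\<lambda>x. v x - u x) (\<lambda>x. v x - u x) = 0"
      using v solu dV a_diff[OF vH uHs VH[OF dV]] by (simp add: is_solution_def)
    then have "?N (\<lambda>x. v x - u x) = 0" using coercive[OF dV] by simp
    then have "norm_L2 lebesgue (\<lambda>x. v x - u x) \<le> 0" using norm_L2_le_Hs_norm[OF VH[OF dV] s0] by simp
    then have "norm_L2 lebesgue (\<lambda>x. v x - u x) = 0" using norm_L2_nonneg[of lebesgue "\<lambda>x. v x - u x"] by linarith
    then show ?thesis using norm_L2_diff_eq_0_iff[OF Hs_L2[OF vH] Hs_L2[OF uHs]] by simp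
  qed
  \<comment> \<open>Strong convergence along the given sequence implies weak convergence, so the
    identity serves as the subsequence.\<close>
  have weak_lim: "weakly_tendsto (Hs s) ?N (\<lambda>k. u\<^sub>\<epsilon> (e (id k))) u sequentially" if e: "\<forall>k. 0 < e k" "e \<longlonglongrightarrow> 0" for e :: "nat \<Rightarrow> real"
    unfolding weakly_tendsto_def id_apply
  proof (intro conjI ballI uHs)
    show "\<forall>\<^sub>F k in sequentially. u\<^sub>\<epsilon> (e k) \<in> Hs s" using uH e by simp
    fix l :: "(real^'n \<Rightarrow> real) \<Rightarrow> real" assume l: "l \<in> dual_space (Hs s) ?N"
    show "(\<lambda>k. l (u\<^sub>\<epsilon> (e k))) \<longlonglongrightarrow> l u"
      by (rule dual_tendsto[OF l uHs _ Hs_cmult Hs_diff conv]) (use uH e in auto)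
  qed
  show ?thesis
  proof (intro exI[of _ u] conjI allI impI solu)
    show "AE x in lebesgue. v x = u x" if "is_solution s \<Omega> f g v" for v by (rule unique[OF that])
    show "\<exists>r. strict_mono r \<and> weakly_tendsto (Hs s) ?N (\<lambda>k. u\<^sub>\<epsilon> (e (r k))) u sequentially"
      if "(\<forall>k. 0 < e k) \<and> e \<longlonglongrightarrow> 0" for e :: "nat \<Rightarrow> real"
      using weak_lim[of e] that by (intro exI[of _ id]) (simp add: strict_mono_def)
  qed
qed

end
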